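(* Let $K=D(H)$ be the Drinfel'd double of a finite-dimensional Hopf algebra $H$ over $\mathbb F$ and equip the vector space $K^*$ with the algebra structure $$\beta\cdot'\alpha=\langle\alpha_{(1)}\otimes\beta_{(1)},R\rangle\;\alpha_{(2)}\beta_{(2)}\qquad(\alpha,\beta\in K^* ),$$ where the product and coproduct on the right-hand side are those of the dual Hopf algebra $K^*$ (with $K^*=H^{op}\otimes H^*$ as an algebra) and $R=\sum_i1\otimes x_i\otimes\alpha^i\otimes1$ is the standard $R$-matrix of $D(H)$. Then the algebra $(K^*,\cdot')$ is isomorphic to $\mathcal H_L(H)^{op}$, the opposite of the left Heisenberg double of $H$.
   Context: $\mathbb F$ is a field of characteristic zero; Sweedler notation without summation signs is used. The Drinfel'd double $D(H)$ is the vector space $H^*\otimes H$ with unit $1\otimes 1$ and $(\alpha\otimes h)\cdot(\alpha'\otimes h')=\langle\alpha'_{(3)},h_{(1)}\rangle\langle\alpha'_{(1)},S^{-1}(h_{(3)})\rangle\,\alpha\alpha'_{(2)}\otimes h_{(2)}h'$, $\Delta(\alpha\otimes h)=\alpha_{(2)}\otimes h_{(1)}\otimes\alpha_{(1)}\otimes h_{(2)}$, $\epsilon(\alpha\otimes h)=\epsilon(\alpha)\epsilon(h)$, $S(\alpha\otimes h)=(1\otimes S(h))\cdot(S(\alpha)\otimes1)$. Here $\{x_i\}$ is a basis of $H$ and $\{\alpha^i\}$ the dual basis of $H^*$. The pairing is $\langle\alpha\otimes\beta,R\rangle=\langle\alpha,R_{(1)}\rangle\langle\beta,R_{(2)}\rangle$.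 The left Heisenberg double $\mathcal H_L(H)$ is the vector space $H^*\otimes H$ with multiplication $(\alpha\otimes h)\cdot(\alpha'\otimes h')=\langle\alpha'_{(2)},h_{(1)}\rangle\,\alpha\alpha'_{(1)}\otimes h_{(2)}h'$. *)

theory Defs
  imports Complex_Main "HOL-Library.Function_Algebras"
begin

section \<open>Vector spaces and linear maps\<close>

text \<open>
  A vector space is a subspace of an ambient type that is itself a vector space.  Dual spaces and
  tensor products below live in function types; there addition is the pointwise one of
  \<^theory>\<open>HOL-Library.Function_Algebras\<close> and the scalar action is \<open>fun_smul\<close>.
\<close>

record ('f, 'a) vs =
  carrier :: "'a set"
  smul :: "'f \<Rightarrow> 'a \<Rightarrow> 'a"

locale vspace =
  fixes V :: "('f::field, 'a::ab_group_add, 'm) vs_scheme" (structure)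
  assumes ambient: "vector_space (smul V)"
    and subspace: "module.subspace (smul V) (carrier V)"

definition finite_dim :: "('f::field, 'a::ab_group_add, 'm) vs_scheme \<Rightarrow> bool" where
  "finite_dim V \<longleftrightarrow> (\<exists>B. finite B \<and> module.span (smul V) B = carrier V)"

definition basis_of :: "('f::field, 'a::ab_group_add, 'm) vs_scheme \<Rightarrow> 'a set \<Rightarrow> bool" where
  "basis_of V B \<longleftrightarrow> \<not> module.dependent (smul V) B \<and> module.span (smul V) B = carrier V"

definition fun_smul :: "'f::field \<Rightarrow> ('x \<Rightarrow> 'f) \<Rightarrow> 'x \<Rightarrow> 'f" where
  "fun_smul c f = (\<lambda>x. c * f x)"

definition field_vs :: "('f::field, 'f) vs" where
  "field_vs = \<lparr>carrier = UNIV, smul = (*)\<rparr>"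

definition linear_on ::
  "('f::field, 'a::ab_group_add, 'm) vs_scheme \<Rightarrow> ('f, 'b::ab_group_add, 'n) vs_scheme \<Rightarrow>
    ('a \<Rightarrow> 'b) \<Rightarrow> bool" where
  "linear_on V U f \<longleftrightarrow>
     (\<forall>x\<in>carrier V. f x \<in> carrier U) \<and>
     (\<forall>x\<in>carrier V. \<forall>y\<in>carrier V. f (x + y) = f x + f y) \<and>
     (\<forall>c. \<forall>x\<in>carrier V. f (smul V c x) = smul U c (f x))"

definition bilinear_on ::
  "('f::field, 'a::ab_group_add, 'm) vs_scheme \<Rightarrow> ('f, 'b::ab_group_add, 'n) vs_scheme \<Rightarrow>
    ('f, 'c::ab_group_add, 'k) vs_scheme \<Rightarrow> ('a \<Rightarrow> 'b \<Rightarrow> 'c) \<Rightarrow> bool" where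
  "bilinear_on V W U f \<longleftrightarrow>
     (\<forall>v\<in>carrier V. linear_on W U (f v)) \<and> (\<forall>w\<in>carrier W. linear_on V U (\<lambda>v. f v w))"

text \<open>Linear forms on \<open>V\<close> are extended by zero to the ambient type, so that equal forms are
  equal functions.\<close>

definition restrict0 :: "('f, 'a, 'm) vs_scheme \<Rightarrow> ('a \<Rightarrow> 'f::field) \<Rightarrow> 'a \<Rightarrow> 'f" where
  "restrict0 V f = (\<lambda>x. if x \<in> carrier V then f x else 0)"

definition dual_carrier :: "('f::field, 'a::ab_group_add, 'm) vs_scheme \<Rightarrow> ('a \<Rightarrow> 'f) set" where
  "dual_carrier V = {f. linear_on V field_vs f \<and> (\<forall>x. x \<notin> carrier V \<longrightarrow> f x = 0)}"

definition dual_basis ::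
  "('f::field, 'a::ab_group_add, 'm) vs_scheme \<Rightarrow> 'a set \<Rightarrow> 'a \<Rightarrow> 'a \<Rightarrow> 'f" where
  "dual_basis V B x =
     (THE \<alpha>. \<alpha> \<in> dual_carrier V \<and> (\<forall>y\<in>B. \<alpha> y = (if y = x then 1 else 0)))"


section \<open>Tensor products\<close>

text \<open>
  \<open>V \<otimes> W\<close> is realised inside the space of functions on bilinear forms \<open>V \<times> W \<rightarrow> F\<close>: the pure
  tensor \<open>v \<otimes> w\<close> is evaluation at \<open>(v, w)\<close>, and \<open>V \<otimes> W\<close> is the span of the pure tensors.  Over
  a field, bilinear forms separate the elements of \<open>V \<otimes> W\<close>, so this is the usual tensor product.
\<close>

type_synonym ('f, 'a, 'b) tensor = "('a \<Rightarrow> 'b \<Rightarrow> 'f) \<Rightarrow> 'f"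

definition pure_tensor ::
  "'a \<Rightarrow> ('f::field, 'a::ab_group_add, 'm) vs_scheme \<Rightarrow> ('f, 'b::ab_group_add, 'n) vs_scheme \<Rightarrow>
    'b \<Rightarrow> ('f, 'a, 'b) tensor" ("(_ \<otimes>[_,_]/ _)" [71, 0, 0, 71] 70) where
  "v \<otimes>[V,W] w = (\<lambda>B. if bilinear_on V W field_vs B then B v w else 0)"

definition tensor_vs ::
  "('f::field, 'a::ab_group_add, 'm) vs_scheme \<Rightarrow> ('f, 'b::ab_group_add, 'n) vs_scheme \<Rightarrow>
    ('f, ('f, 'a, 'b) tensor) vs" where
  "tensor_vs V W =
     \<lparr>carrier = module.span fun_smul {v \<otimes>[V,W] w | v w. v \<in> carrier V \<and> w \<in> carrier W},
      smul = fun_smul\<rparr>"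

text \<open>
  Sweedler sums: if \<open>t = \<Sum>\<^sub>i v\<^sub>i \<otimes> w\<^sub>i\<close> and \<open>f\<close> is bilinear, then
  \<open>sweedler V W t f = \<Sum>\<^sub>i f v\<^sub>i w\<^sub>i\<close>, i.e. the linear extension of \<open>f\<close> evaluated at \<open>t\<close>.
  The value does not depend on the decomposition; see \<open>sweedler_eq\<close> and
  \<open>tensor_decomposition\<close> below.
\<close>

definition sweedler ::
  "('f::field, 'a::ab_group_add, 'm) vs_scheme \<Rightarrow> ('f, 'b::ab_group_add, 'n) vs_scheme \<Rightarrow>
    ('f, 'a, 'b) tensor \<Rightarrow> ('a \<Rightarrow> 'b \<Rightarrow> 'c::ab_group_add) \<Rightarrow> 'c" where
  "sweedler V W t f =
     (THE u. \<exists>xs. set xs \<subseteq> carrier V \<times> carrier W \<and>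
        t = (\<Sum>(v, w)\<leftarrow>xs. v \<otimes>[V,W] w) \<and> u = (\<Sum>(v, w)\<leftarrow>xs. f v w))"

lemma vector_space_fun_smul: "vector_space fun_smul"
  by unfold_locales (auto simp: fun_smul_def fun_eq_iff algebra_simps)

lemma pure_tensors_apply:
  assumes "bilinear_on V W field_vs B"
  shows "(\<Sum>(v, w)\<leftarrow>xs. v \<otimes>[V,W] w) B = (\<Sum>(v, w)\<leftarrow>xs. B v w)"
  using assms by (induction xs) (auto simp: pure_tensor_def)

lemma sweedler_eq:
  assumes U: "vspace U" and f: "bilinear_on V W U f"
    and xs: "set xs \<subseteq> carrier V \<times> carrier W"
  shows "sweedler V W (\<Sum>(v, w)\<leftarrow>xs. v \<otimes>[V,W] w) f = (\<Sum>(v, w)\<leftarrow>xs. f v w)"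
  unfolding sweedler_def
proof (rule the_equality)
  fix u
  assume "\<exists>ys. set ys \<subseteq> carrier V \<times> carrier W \<and>
    (\<Sum>(v, w)\<leftarrow>xs. v \<otimes>[V,W] w) = (\<Sum>(v, w)\<leftarrow>ys. v \<otimes>[V,W] w) \<and> u = (\<Sum>(v, w)\<leftarrow>ys. f v w)"
  then obtain ys where ys: "set ys \<subseteq> carrier V \<times> carrier W"
    and eq: "(\<Sum>(v, w)\<leftarrow>xs. v \<otimes>[V,W] w) = (\<Sum>(v, w)\<leftarrow>ys. v \<otimes>[V,W] w)"
    and u: "u = (\<Sum>(v, w)\<leftarrow>ys. f v w)"
    by blast
  interpret U: vector_space "smul U" using U by (rule vspace.ambient)
  interpret UF: vector_space_pair "smul U" "(*) :: 'a \<Rightarrow> 'a \<Rightarrow> 'a"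
    by unfold_locales (auto simp: algebra_simps)
  show "u = (\<Sum>(v, w)\<leftarrow>xs. f v w)"
  proof (rule ccontr)
    define z where "z = u - (\<Sum>(v, w)\<leftarrow>xs. f v w)"
    assume "u \<noteq> (\<Sum>(v, w)\<leftarrow>xs. f v w)"
    then have ind: "U.independent {z}" by (simp add: z_def)
    define \<phi> where "\<phi> = UF.construct {z} (\<lambda>_. 1)"
    have lin: "Vector_Spaces.linear (smul U) (*) \<phi>"
      unfolding \<phi>_def by (rule UF.linear_construct[OF ind])
    have \<phi>z: "\<phi> z = 1"
      unfolding \<phi>_def using UF.construct_basis[OF ind] by simp
    interpret \<phi>: Vector_Spaces.linear "smul U" "(*)" \<phi> by (rule lin)
    have B: "bilinear_on V W field_vs (\<lambda>v w. \<phi> (f v w))"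
      using f by (auto simp: bilinear_on_def linear_on_def field_vs_def \<phi>.add \<phi>.scale)
    have \<phi>sum: "\<phi> (\<Sum>(v, w)\<leftarrow>zs. f v w) = (\<Sum>(v, w)\<leftarrow>zs. \<phi> (f v w))" for zs
      by (induction zs) (auto simp: \<phi>.add \<phi>.zero)
    have "(\<Sum>(v, w)\<leftarrow>xs. \<phi> (f v w)) = (\<Sum>(v, w)\<leftarrow>ys. \<phi> (f v w))"
      using fun_cong[OF eq, of "\<lambda>v w. \<phi> (f v w)"] by (simp add: pure_tensors_apply[OF B])
    then have "\<phi> z = 0" by (simp add: z_def u \<phi>.diff \<phi>sum)
    with \<phi>z show False by simp
  qed
qed (use xs in blast)

lemma tensor_decomposition:
  assumes V: "vspace V" and t: "t \<in> carrier (tensor_vs V W)"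
  obtains xs where "set xs \<subseteq> carrier V \<times> carrier W" and "t = (\<Sum>(v, w)\<leftarrow>xs. v \<otimes>[V,W] w)"
proof -
  interpret F: vector_space fun_smul by (rule vector_space_fun_smul)
  have "t \<in> F.span {v \<otimes>[V,W] w | v w. v \<in> carrier V \<and> w \<in> carrier W}"
    using t by (simp add: tensor_vs_def)
  then have "\<exists>xs. set xs \<subseteq> carrier V \<times> carrier W \<and> t = (\<Sum>(v, w)\<leftarrow>xs. v \<otimes>[V,W] w)"
  proof (induction rule: F.span_induct_alt)
    case base
    show ?case by (rule exI[of _ "[]"]) simp
  next
    case (step c x y)
    from step obtain v w xs where x: "x = v \<otimes>[V,W] w" "v \<in> carrier V" "w \<in> carrier W"
      and xs: "set xs \<subseteq> carrier V \<times> carrier W" "y = (\<Sum>(v, w)\<leftarrow>xs. v \<otimes>[V,W] w)"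
      by blast
    have cv: "smul V c v \<in> carrier V"
      using V x(2)
      by (meson module.subspace_scale module_iff_vector_space vspace.ambient vspace.subspace)
    have "fun_smul c (v \<otimes>[V,W] w) = smul V c v \<otimes>[V,W] w"
      using x(2,3)
      by (auto simp: fun_smul_def pure_tensor_def fun_eq_iff bilinear_on_def linear_on_def field_vs_def)
    then show ?case
      using cv x xs by (intro exI[of _ "(smul V c v, w) # xs"]) simp
  qed
  then show thesis using that by blast
qed


section \<open>Algebras and Hopf algebras\<close>

record ('f, 'a) alg = "('f, 'a) vs" +
  mult :: "'a \<Rightarrow> 'a \<Rightarrow> 'a" (infixl "\<cdot>\<index>" 70)
  one :: 'a ("\<one>\<index>")

locale unital_algebra = vspace A
  for A :: "('f::field, 'a::ab_group_add, 'm) alg_scheme" (structure) +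
  assumes mult_bilinear: "bilinear_on A A A (\<lambda>a b. a \<cdot> b)"
    and one_closed: "\<one> \<in> carrier A"
    and mult_assoc:
      "\<lbrakk>a \<in> carrier A; b \<in> carrier A; c \<in> carrier A\<rbrakk> \<Longrightarrow> (a \<cdot> b) \<cdot> c = a \<cdot> (b \<cdot> c)"
    and one_left: "a \<in> carrier A \<Longrightarrow> \<one> \<cdot> a = a"
    and one_right: "a \<in> carrier A \<Longrightarrow> a \<cdot> \<one> = a"

definition op_alg :: "('f, 'a, 'm) alg_scheme \<Rightarrow> ('f, 'a) alg" where
  "op_alg A = \<lparr>carrier = carrier A, smul = smul A, mult = (\<lambda>a b. b \<cdot>\<^bsub>A\<^esub> a), one = \<one>\<^bsub>A\<^esub>\<rparr>"

definition alg_isomorphic ::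
  "('f::field, 'a::ab_group_add, 'm) alg_scheme \<Rightarrow> ('f, 'b::ab_group_add, 'n) alg_scheme \<Rightarrow> bool"
where
  "alg_isomorphic A B \<longleftrightarrow> unital_algebra A \<and> unital_algebra B \<and>
     (\<exists>f. bij_betw f (carrier A) (carrier B) \<and> linear_on A B f \<and>
        (\<forall>a\<in>carrier A. \<forall>b\<in>carrier A. f (a \<cdot>\<^bsub>A\<^esub> b) = f a \<cdot>\<^bsub>B\<^esub> f b) \<and> f \<one>\<^bsub>A\<^esub> = \<one>\<^bsub>B\<^esub>)"

record ('f, 'a) hopf = "('f, 'a) alg" +
  comult :: "'a \<Rightarrow> ('f, 'a, 'a) tensor"
  counit :: "'a \<Rightarrow> 'f"
  antipode :: "'a \<Rightarrow> 'a"

text \<open>\<open>sw2 H h f\<close> and \<open>sw3 H h f\<close> are \<open>f h\<^sub>1 h\<^sub>2\<close> and \<open>f h\<^sub>1 h\<^sub>2 h\<^sub>3\<close> in Sweedler notation without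
  summation signs.\<close>

definition sw2 ::
  "('f::field, 'a::ab_group_add, 'm) hopf_scheme \<Rightarrow> 'a \<Rightarrow> ('a \<Rightarrow> 'a \<Rightarrow> 'c::ab_group_add) \<Rightarrow> 'c" where
  "sw2 H h f = sweedler H H (comult H h) f"

definition sw3 ::
  "('f::field, 'a::ab_group_add, 'm) hopf_scheme \<Rightarrow> 'a \<Rightarrow>
    ('a \<Rightarrow> 'a \<Rightarrow> 'a \<Rightarrow> 'c::ab_group_add) \<Rightarrow> 'c" where
  "sw3 H h f = sw2 H h (\<lambda>k h3. sw2 H k (\<lambda>h1 h2. f h1 h2 h3))"

text \<open>Coassociativity is stated in \<open>H \<otimes> (H \<otimes> H)\<close>.  No bijectivity of the antipode is required.\<close>

locale hopf_algebra = unital_algebra H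
  for H :: "('f::field, 'a::ab_group_add, 'm) hopf_scheme" (structure) +
  assumes comult_linear: "linear_on H (tensor_vs H H) (comult H)"
    and counit_linear: "linear_on H field_vs (counit H)"
    and antipode_linear: "linear_on H H (antipode H)"
    and coassoc:
      "h \<in> carrier H \<Longrightarrow>
        sw3 H h (\<lambda>h1 h2 h3. h1 \<otimes>[H, tensor_vs H H] (h2 \<otimes>[H,H] h3)) =
        sw2 H h (\<lambda>h1 k. h1 \<otimes>[H, tensor_vs H H] comult H k)"
    and counit_left: "h \<in> carrier H \<Longrightarrow> sw2 H h (\<lambda>h1 h2. smul H (counit H h1) h2) = h"
    and counit_right: "h \<in> carrier H \<Longrightarrow> sw2 H h (\<lambda>h1 h2. smul H (counit H h2) h1) = h"
    and comult_mult:
      "\<lbrakk>h \<in> carrier H; k \<in> carrier H\<rbrakk> \<Longrightarrow>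
        comult H (h \<cdot> k) =
        sw2 H h (\<lambda>h1 h2. sw2 H k (\<lambda>k1 k2. (h1 \<cdot> k1) \<otimes>[H,H] (h2 \<cdot> k2)))"
    and comult_one: "comult H \<one> = \<one> \<otimes>[H,H] \<one>"
    and counit_mult:
      "\<lbrakk>h \<in> carrier H; k \<in> carrier H\<rbrakk> \<Longrightarrow> counit H (h \<cdot> k) = counit H h * counit H k"
    and counit_one: "counit H \<one> = 1"
    and antipode_left:
      "h \<in> carrier H \<Longrightarrow> sw2 H h (\<lambda>h1 h2. antipode H h1 \<cdot> h2) = smul H (counit H h) \<one>"
    and antipode_right:
      "h \<in> carrier H \<Longrightarrow> sw2 H h (\<lambda>h1 h2. h1 \<cdot> antipode H h2) = smul H (counit H h) \<one>"

text \<open>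
  The dual of a finite-dimensional Hopf algebra, with the conventions
  \<open>\<langle>\<alpha>\<beta>, h\<rangle> = \<langle>\<alpha>, h\<^sub>1\<rangle>\<langle>\<beta>, h\<^sub>2\<rangle>\<close> and \<open>\<langle>\<alpha>\<^sub>1, h\<rangle>\<langle>\<alpha>\<^sub>2, k\<rangle> = \<langle>\<alpha>, hk\<rangle>\<close>.
\<close>

definition dual_vs :: "('f::field, 'a::ab_group_add, 'm) vs_scheme \<Rightarrow> ('f, 'a \<Rightarrow> 'f) vs" where
  "dual_vs V = \<lparr>carrier = dual_carrier V, smul = fun_smul\<rparr>"

definition dual_hopf ::
  "('f::field, 'a::ab_group_add, 'm) hopf_scheme \<Rightarrow> ('f, 'a \<Rightarrow> 'f) hopf" where
  "dual_hopf H =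
     \<lparr>carrier = carrier (dual_vs H),
      smul = smul (dual_vs H),
      mult = (\<lambda>\<alpha> \<beta>. restrict0 H (\<lambda>h. sw2 H h (\<lambda>h1 h2. \<alpha> h1 * \<beta> h2))),
      one = restrict0 H (counit H),
      comult = (\<lambda>\<alpha>. THE t. t \<in> carrier (tensor_vs (dual_vs H) (dual_vs H)) \<and>
         (\<forall>h\<in>carrier H. \<forall>k\<in>carrier H.
            sweedler (dual_vs H) (dual_vs H) t (\<lambda>\<alpha>1 \<alpha>2. \<alpha>1 h * \<alpha>2 k) = \<alpha> (h \<cdot>\<^bsub>H\<^esub> k))),
      counit = (\<lambda>\<alpha>. \<alpha> \<one>\<^bsub>H\<^esub>),
      antipode = (\<lambda>\<alpha>. restrict0 H (\<lambda>h. \<alpha> (antipode H h)))\<rparr>"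


section \<open>Drinfel'd double and Heisenberg double\<close>

text \<open>In this section \<open>\<alpha> \<otimes> h\<close> always lies in \<open>H\<^sup>* \<otimes> H\<close>; maps on this space are given on pure tensors
  and extended linearly by \<open>sweedler\<close>.\<close>

abbreviation dtensor ::
  "('f::field, 'a::ab_group_add, 'm) hopf_scheme \<Rightarrow> ('a \<Rightarrow> 'f) \<Rightarrow> 'a \<Rightarrow> ('f, 'a \<Rightarrow> 'f, 'a) tensor"
where
  "dtensor H \<alpha> h \<equiv> \<alpha> \<otimes>[dual_hopf H, H] h"

abbreviation dspace ::
  "('f::field, 'a::ab_group_add, 'm) hopf_scheme \<Rightarrow> ('f, ('f, 'a \<Rightarrow> 'f, 'a) tensor) vs" where
  "dspace H \<equiv> tensor_vs (dual_hopf H) H"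

definition antipode_inv :: "('f, 'a, 'm) hopf_scheme \<Rightarrow> 'a \<Rightarrow> 'a" where
  "antipode_inv H = inv_into (carrier H) (antipode H)"

definition double_mult ::
  "('f::field, 'a::ab_group_add, 'm) hopf_scheme \<Rightarrow> ('f, 'a \<Rightarrow> 'f, 'a) tensor \<Rightarrow>
    ('f, 'a \<Rightarrow> 'f, 'a) tensor \<Rightarrow> ('f, 'a \<Rightarrow> 'f, 'a) tensor" where
  "double_mult H s t =
     sweedler (dual_hopf H) H s (\<lambda>\<alpha> h. sweedler (dual_hopf H) H t (\<lambda>\<alpha>' h'.
       sw3 (dual_hopf H) \<alpha>' (\<lambda>\<alpha>'1 \<alpha>'2 \<alpha>'3. sw3 H h (\<lambda>h1 h2 h3.
         fun_smul (\<alpha>'3 h1 * \<alpha>'1 (antipode_inv H h3))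
           (dtensor H (\<alpha> \<cdot>\<^bsub>dual_hopf H\<^esub> \<alpha>'2) (h2 \<cdot>\<^bsub>H\<^esub> h'))))))"

definition drinfeld_double ::
  "('f::field, 'a::ab_group_add, 'm) hopf_scheme \<Rightarrow> ('f, ('f, 'a \<Rightarrow> 'f, 'a) tensor) hopf" where
  "drinfeld_double H =
     \<lparr>carrier = carrier (dspace H),
      smul = smul (dspace H),
      mult = double_mult H,
      one = dtensor H \<one>\<^bsub>dual_hopf H\<^esub> \<one>\<^bsub>H\<^esub>,
      comult = (\<lambda>t. sweedler (dual_hopf H) H t (\<lambda>\<alpha> h.
        sw2 (dual_hopf H) \<alpha> (\<lambda>\<alpha>1 \<alpha>2. sw2 H h (\<lambda>h1 h2.
          dtensor H \<alpha>2 h1 \<otimes>[dspace H, dspace H] dtensor H \<alpha>1 h2)))),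
      counit = (\<lambda>t. sweedler (dual_hopf H) H t (\<lambda>\<alpha> h. counit (dual_hopf H) \<alpha> * counit H h)),
      antipode = (\<lambda>t. sweedler (dual_hopf H) H t (\<lambda>\<alpha> h.
        double_mult H (dtensor H \<one>\<^bsub>dual_hopf H\<^esub> (antipode H h))
          (dtensor H (antipode (dual_hopf H) \<alpha>) \<one>\<^bsub>H\<^esub>)))\<rparr>"

definition R_matrix ::
  "('f::field, 'a::ab_group_add, 'm) hopf_scheme \<Rightarrow> 'a set \<Rightarrow>
    ('f, ('f, 'a \<Rightarrow> 'f, 'a) tensor, ('f, 'a \<Rightarrow> 'f, 'a) tensor) tensor" where
  "R_matrix H B =
     (\<Sum>x\<in>B. dtensor H \<one>\<^bsub>dual_hopf H\<^esub> x
         \<otimes>[drinfeld_double H, drinfeld_double H] dtensor H (dual_basis H B x) \<one>\<^bsub>H\<^esub>)"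

text \<open>\<open>\<langle>\<alpha> \<otimes> \<beta>, R\<rangle> = \<langle>\<alpha>, R\<^sub>1\<rangle>\<langle>\<beta>, R\<^sub>2\<rangle>\<close> for \<open>R \<in> K \<otimes> K\<close>.\<close>

definition pair2 ::
  "('f::field, 'k::ab_group_add, 'm) vs_scheme \<Rightarrow> ('k \<Rightarrow> 'f) \<Rightarrow> ('k \<Rightarrow> 'f) \<Rightarrow>
    ('f, 'k, 'k) tensor \<Rightarrow> 'f" where
  "pair2 K \<alpha> \<beta> R = sweedler K K R (\<lambda>r1 r2. \<alpha> r1 * \<beta> r2)"

definition twisted_dual ::
  "('f::field, 'k::ab_group_add, 'm) hopf_scheme \<Rightarrow> ('f, 'k, 'k) tensor \<Rightarrow> ('f, 'k \<Rightarrow> 'f) alg" where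
  "twisted_dual K R =
     \<lparr>carrier = carrier (dual_hopf K),
      smul = smul (dual_hopf K),
      mult = (\<lambda>\<beta> \<alpha>. sw2 (dual_hopf K) \<alpha> (\<lambda>\<alpha>1 \<alpha>2. sw2 (dual_hopf K) \<beta> (\<lambda>\<beta>1 \<beta>2.
        fun_smul (pair2 K \<alpha>1 \<beta>1 R) (\<alpha>2 \<cdot>\<^bsub>dual_hopf K\<^esub> \<beta>2)))),
      one = \<one>\<^bsub>dual_hopf K\<^esub>\<rparr>"

definition heisenberg_double_left ::
  "('f::field, 'a::ab_group_add, 'm) hopf_scheme \<Rightarrow> ('f, ('f, 'a \<Rightarrow> 'f, 'a) tensor) alg" where
  "heisenberg_double_left H =
     \<lparr>carrier = carrier (dspace H),
      smul = smul (dspace H),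
      mult = (\<lambda>s t. sweedler (dual_hopf H) H s (\<lambda>\<alpha> h. sweedler (dual_hopf H) H t (\<lambda>\<alpha>' h'.
        sw2 (dual_hopf H) \<alpha>' (\<lambda>\<alpha>'1 \<alpha>'2. sw2 H h (\<lambda>h1 h2.
          fun_smul (\<alpha>'2 h1) (dtensor H (\<alpha> \<cdot>\<^bsub>dual_hopf H\<^esub> \<alpha>'1) (h2 \<cdot>\<^bsub>H\<^esub> h'))))))),
      one = dtensor H \<one>\<^bsub>dual_hopf H\<^esub> \<one>\<^bsub>H\<^esub>\<rparr>"

end

theory Submission
  imports Defs
begin

text \<open>
  Both algebras are full matrix algebras of size \<open>dim H\<close>, and transposition makes a matrix algebra
  isomorphic to its opposite.  Concretely, each of them acts on \<open>H\<close> from the right, and every linear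
  endomorphism of \<open>H\<close> is the action of exactly one element.

  For the Heisenberg double, read \<open>t = \<Sum>\<^sub>i \<alpha>\<^sub>i \<otimes> h\<^sub>i\<close> as the endomorphism \<open>R k = \<Sum>\<^sub>i \<langle>\<alpha>\<^sub>i, k\<rangle> h\<^sub>i\<close> of \<open>H\<close>
  (\<open>contraction\<close>) and let \<open>t\<close> act by \<open>k \<mapsto> k\<^sub>2 R(k\<^sub>1)\<close> (\<open>heisenberg_action\<close>).  Because the coproduct of
  \<open>H\<close> is multiplicative, acting with \<open>s t\<close> is acting with \<open>s\<close> and then with \<open>t\<close>.

  For the twisted dual, read \<open>u \<in> K\<^sup>*\<close> as the endomorphism \<open>U\<close> of \<open>H\<close> with
  \<open>\<langle>\<alpha>, U h\<rangle> = \<langle>u, \<alpha> \<otimes> h\<rangle>\<close> (\<open>endo\<close>).  The value of \<open>u \<cdot>' v\<close> at \<open>k \<in> K\<close> is that of \<open>v \<otimes> u\<close> at \<open>R \<Delta>(k)\<close>.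
  In this value the sum over dual bases in \<open>R\<close> feeds the first coproduct leg of \<open>z = U(h\<^sub>2)\<close> into the
  product of the double, which splits it further and produces a factor \<open>z\<^sub>4 S\<inverse>(z\<^sub>3)\<close>.  That factor
  collapses, and \<open>u \<cdot>' v\<close> becomes the endomorphism \<open>h \<mapsto> V(z\<^sub>2 h\<^sub>1) z\<^sub>1\<close> (\<open>endo_twisted_mult\<close>).  Hence
  \<open>h \<mapsto> U(h\<^sub>2) h\<^sub>1\<close> (\<open>twisted_action\<close>) turns \<open>u \<cdot>' v\<close> into the action of \<open>u\<close> followed by that of \<open>v\<close>.

  That both actions hit every endomorphism exactly once is one and the same fact: they arise from
  \<open>R\<close> and \<open>U\<close> by convolution with the identity, where convolution uses the opposite product of \<open>H\<close>,
  and for this convolution \<open>S\<inverse>\<close> is inverse to the identity.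

  The inverse of the antipode must be a linear map for all this, so the antipode of a
  finite-dimensional Hopf algebra has to be shown bijective.  Some even power \<open>N = S\<^sup>n\<close> maps its image
  \<open>I\<close> bijectively to itself (\<open>fitting\<close>), so there is an algebra endomorphism \<open>p\<close> of \<open>H\<close> with image in
  \<open>I\<close> and \<open>p \<circ> S\<^sup>n = S\<^sup>n\<close>.  Uniqueness of convolution inverses lowers the exponent one by one
  (\<open>fix_antipode_descent\<close>) until \<open>p\<close> is the identity, whence \<open>I = H\<close>.

  The two actions together give a canonical isomorphism of the twisted dual with the Heisenberg
  double itself; the opposite algebra is reached by the transposition, which depends on the basis.
\<close>

section \<open>Linear maps between subspaces\<close>

sublocale vspace \<subseteq> amb: vector_space "smul V"
  by (rule ambient)

context vspace
begin

lemma add_closed: "x \<in> carrier V \<Longrightarrow> y \<in> carrier V \<Longrightarrow> x + y \<in> carrier V"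
  by (rule amb.subspace_add[OF subspace])

lemma zero_closed: "0 \<in> carrier V"
  by (rule amb.subspace_0[OF subspace])

lemma smul_closed: "x \<in> carrier V \<Longrightarrow> smul V c x \<in> carrier V"
  by (rule amb.subspace_scale[OF subspace])

lemma diff_closed: "x \<in> carrier V \<Longrightarrow> y \<in> carrier V \<Longrightarrow> x - y \<in> carrier V"
  by (rule amb.subspace_diff[OF subspace])

lemma sum_closed: "(\<And>i. i \<in> I \<Longrightarrow> g i \<in> carrier V) \<Longrightarrow> (\<Sum>i\<in>I. g i) \<in> carrier V"
  by (rule amb.subspace_sum[OF subspace])

lemma pair_sum_closed:
  assumes "set xs \<subseteq> A \<times> C" and "\<And>v w. v \<in> A \<Longrightarrow> w \<in> C \<Longrightarrow> f v w \<in> carrier V"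
  shows "(\<Sum>(v, w)\<leftarrow>xs. f v w) \<in> carrier V"
  using assms by (induction xs) (auto intro: zero_closed add_closed)

end

lemma linear_onI:
  assumes "\<And>x. x \<in> carrier V \<Longrightarrow> f x \<in> carrier U"
    and "\<And>x y. x \<in> carrier V \<Longrightarrow> y \<in> carrier V \<Longrightarrow> f (x + y) = f x + f y"
    and "\<And>c x. x \<in> carrier V \<Longrightarrow> f (smul V c x) = smul U c (f x)"
  shows "linear_on V U f"
  using assms by (simp add: linear_on_def)

lemma linear_on_mem: "linear_on V U f \<Longrightarrow> x \<in> carrier V \<Longrightarrow> f x \<in> carrier U"
  by (simp add: linear_on_def)

lemma linear_on_add:
  "linear_on V U f \<Longrightarrow> x \<in> carrier V \<Longrightarrow> y \<in> carrier V \<Longrightarrow> f (x + y) = f x + f y"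
  by (simp add: linear_on_def)

lemma linear_on_smul: "linear_on V U f \<Longrightarrow> x \<in> carrier V \<Longrightarrow> f (smul V c x) = smul U c (f x)"
  by (simp add: linear_on_def)

lemma linear_on_zero: "vspace V \<Longrightarrow> linear_on V U f \<Longrightarrow> f 0 = 0"
  using linear_on_add[of V U f 0 0] vspace.zero_closed[of V] by simp

lemma linear_on_sum:
  assumes "vspace V" and "linear_on V U f" and "\<And>i. i \<in> I \<Longrightarrow> g i \<in> carrier V"
  shows "f (\<Sum>i\<in>I. g i) = (\<Sum>i\<in>I. f (g i))"
  using assms(3)
  by (induction I rule: infinite_finite_induct)
    (auto simp: linear_on_zero[OF assms(1,2)] linear_on_add[OF assms(2)] vspace.sum_closed[OF assms(1)])

lemma linear_on_lincomb:
  assumes "vspace V" and "linear_on V U f" and "\<And>i. i \<in> I \<Longrightarrow> g i \<in> carrier V"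
  shows "f (\<Sum>i\<in>I. smul V (r i) (g i)) = (\<Sum>i\<in>I. smul U (r i) (f (g i)))"
  using assms(3)
  by (simp add: linear_on_sum[OF assms(1,2)] vspace.smul_closed[OF assms(1)] linear_on_smul[OF assms(2)])

lemma sum_fun_apply: "(\<Sum>i\<in>I. f i) x = (\<Sum>i\<in>I. f i x)"
  by (induction I rule: infinite_finite_induct) auto

lemma linear_on_pair_sum:
  assumes "vspace V" and "linear_on V U \<phi>" and "set xs \<subseteq> A \<times> C"
    and "\<And>v w. v \<in> A \<Longrightarrow> w \<in> C \<Longrightarrow> f v w \<in> carrier V"
  shows "\<phi> (\<Sum>(v, w)\<leftarrow>xs. f v w) = (\<Sum>(v, w)\<leftarrow>xs. \<phi> (f v w))"
  using assms(3)
  by (induction xs)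
    (auto simp: linear_on_zero[OF assms(1,2)] linear_on_add[OF assms(2)]
      vspace.pair_sum_closed[OF assms(1) _ assms(4)] assms(4))

lemma linear_on_diff:
  assumes "vspace V" and "linear_on V U f" and "x \<in> carrier V" and "y \<in> carrier V"
  shows "f (x - y) = f x - f y"
proof -
  have "f (x - y + y) = f (x - y) + f y"
    using assms by (intro linear_on_add[OF assms(2)] vspace.diff_closed)
  then show ?thesis by (simp add: algebra_simps)
qed

lemma linear_on_id: "linear_on V V (\<lambda>x. x)"
  by (simp add: linear_on_def)

lemma linear_on_compose:
  "linear_on V W f \<Longrightarrow> linear_on W U g \<Longrightarrow> linear_on V U (\<lambda>x. g (f x))"
  by (auto simp: linear_on_def)

lemma linear_on_cong:
  assumes "vspace V" and "linear_on V U f" and "\<And>x. x \<in> carrier V \<Longrightarrow> g x = f x"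
  shows "linear_on V U g"
  using assms by (auto simp: linear_on_def vspace.add_closed vspace.smul_closed)

lemma linear_on_sum_fun:
  assumes "vspace U" and "\<And>i. i \<in> I \<Longrightarrow> linear_on V U (g i)"
  shows "linear_on V U (\<lambda>x. \<Sum>i\<in>I. g i x)"
  using assms vspace.ambient[OF assms(1)]
  by (auto simp: linear_on_def sum.distrib module.scale_sum_right module_iff_vector_space
      intro!: vspace.sum_closed)

lemma linear_on_pair_sum_fun:
  assumes "vspace U" and "set xs \<subseteq> A \<times> C"
    and "\<And>v w. v \<in> A \<Longrightarrow> w \<in> C \<Longrightarrow> linear_on Z U (\<lambda>z. f z v w)"
  shows "linear_on Z U (\<lambda>z. \<Sum>(v, w)\<leftarrow>xs. f z v w)"
  using assms(2)
proof (induction xs)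
  interpret U: vspace U by fact
  case Nil
  then show ?case by (simp add: linear_on_def U.zero_closed)
next
  interpret U: vspace U by fact
  case (Cons a xs)
  obtain v w where a: "a = (v, w)" by (cases a)
  have "linear_on Z U (\<lambda>z. f z v w)" using assms(3) Cons.prems a by simp
  then show ?case
    using Cons by (auto simp: a linear_on_def U.add_closed U.amb.scale_right_distrib)
qed

lemma linear_on_scaleR:
  assumes "vspace U" and "linear_on V U f"
  shows "linear_on V U (\<lambda>x. smul U c (f x))"
proof -
  interpret vspace U by fact
  show ?thesis using assms(2)
    by (auto simp: linear_on_def smul_closed amb.scale_right_distrib amb.scale_left_commute)
qed

lemma linear_on_scaleL:
  assumes "vspace U" and "linear_on V field_vs f" and "u \<in> carrier U"
  shows "linear_on V U (\<lambda>x. smul U (f x) u)"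
proof -
  interpret vspace U by fact
  show ?thesis using assms(2,3)
    by (auto simp: linear_on_def smul_closed amb.scale_left_distrib field_vs_def)
qed

lemma linear_on_timesL: "linear_on V field_vs f \<Longrightarrow> linear_on V field_vs (\<lambda>x. f x * c)"
  and linear_on_timesR: "linear_on V field_vs f \<Longrightarrow> linear_on V field_vs (\<lambda>x. c * f x)"
  by (auto simp: linear_on_def field_vs_def algebra_simps)

lemma bilinear_onI:
  assumes "\<And>v. v \<in> carrier V \<Longrightarrow> linear_on W U (\<lambda>w. f v w)"
    and "\<And>w. w \<in> carrier W \<Longrightarrow> linear_on V U (\<lambda>v. f v w)"
  shows "bilinear_on V W U f"
  using assms by (simp add: bilinear_on_def)

lemma bilinear_on_left: "bilinear_on V W U f \<Longrightarrow> w \<in> carrier W \<Longrightarrow> linear_on V U (\<lambda>v. f v w)"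
  and bilinear_on_right: "bilinear_on V W U f \<Longrightarrow> v \<in> carrier V \<Longrightarrow> linear_on W U (\<lambda>w. f v w)"
  by (simp_all add: bilinear_on_def)

lemma bilinear_on_mem:
  "bilinear_on V W U f \<Longrightarrow> v \<in> carrier V \<Longrightarrow> w \<in> carrier W \<Longrightarrow> f v w \<in> carrier U"
  by (simp add: bilinear_on_def linear_on_def)

lemma bilinear_on_compose:
  "bilinear_on V W U f \<Longrightarrow> linear_on U Z \<phi> \<Longrightarrow> bilinear_on V W Z (\<lambda>v w. \<phi> (f v w))"
  by (auto simp: bilinear_on_def linear_on_def)

lemma vspace_field: "vspace (field_vs :: ('f::field, 'f) vs)"
proof (unfold_locales, goal_cases)
  case 5
  show ?case
    by (auto simp: field_vs_def intro!: module.subspace_UNIV) (unfold_locales, auto simp: algebra_simps)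
qed (auto simp: field_vs_def algebra_simps)

lemma carrier_field [simp]: "carrier field_vs = UNIV"
  and smul_field [simp]: "smul field_vs = (*)"
  by (simp_all add: field_vs_def)

section \<open>Sweedler sums\<close>

lemma pure_tensor_mem:
  "v \<in> carrier V \<Longrightarrow> w \<in> carrier W \<Longrightarrow> v \<otimes>[V,W] w \<in> carrier (tensor_vs V W)"
  unfolding tensor_vs_def
  by (simp, rule module.span_base[OF vector_space_fun_smul[folded module_iff_vector_space]]) blast

lemma smul_tensor_vs [simp]: "smul (tensor_vs V W) = fun_smul"
  by (simp add: tensor_vs_def)

lemma vspace_tensor: "vspace (tensor_vs V W)"
  unfolding vspace_def tensor_vs_def
  using vector_space_fun_smul module.subspace_span[of fun_smul] module_iff_vector_space by auto

lemma bilinear_on_pure_tensor: "bilinear_on V W (tensor_vs V W) (\<lambda>v w. v \<otimes>[V,W] w)"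
  by (auto simp: bilinear_on_def linear_on_def pure_tensor_mem)
    (auto simp: pure_tensor_def fun_eq_iff bilinear_on_def linear_on_def fun_smul_def)

lemma sweedler_pure:
  assumes "vspace U" and "bilinear_on V W U f" and "v \<in> carrier V" and "w \<in> carrier W"
  shows "sweedler V W (v \<otimes>[V,W] w) f = f v w"
  using sweedler_eq[OF assms(1,2), of "[(v, w)]"] assms(3,4) by simp

lemma sweedler_cong:
  assumes "\<And>v w. v \<in> carrier V \<Longrightarrow> w \<in> carrier W \<Longrightarrow> f v w = g v w"
  shows "sweedler V W t f = sweedler V W t g"
proof -
  have eq: "(\<Sum>(v, w)\<leftarrow>xs. f v w) = (\<Sum>(v, w)\<leftarrow>xs. g v w)" if "set xs \<subseteq> carrier V \<times> carrier W" for xs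
    using that assms by (induction xs) auto
  then have "(set xs \<subseteq> carrier V \<times> carrier W \<and> t = (\<Sum>(v, w)\<leftarrow>xs. v \<otimes>[V,W] w) \<and> u = (\<Sum>(v, w)\<leftarrow>xs. f v w)) =
    (set xs \<subseteq> carrier V \<times> carrier W \<and> t = (\<Sum>(v, w)\<leftarrow>xs. v \<otimes>[V,W] w) \<and> u = (\<Sum>(v, w)\<leftarrow>xs. g v w))"
    for xs u by (auto simp: eq)
  then show ?thesis
    unfolding sweedler_def by simp
qed

lemma sweedler_mem:
  assumes "vspace V" and "vspace U" and "bilinear_on V W U f" and "t \<in> carrier (tensor_vs V W)"
  shows "sweedler V W t f \<in> carrier U"
proof -
  obtain xs where xs: "set xs \<subseteq> carrier V \<times> carrier W" "t = (\<Sum>(v, w)\<leftarrow>xs. v \<otimes>[V,W] w)"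
    using tensor_decomposition[OF assms(1,4)] .
  show ?thesis
    unfolding xs(2) sweedler_eq[OF assms(2,3) xs(1)]
    by (rule vspace.pair_sum_closed[OF assms(2) xs(1)]) (rule bilinear_on_mem[OF assms(3)])
qed

lemma linear_on_sweedler_tensor:
  assumes V: "vspace V" and U: "vspace U" and f: "bilinear_on V W U f"
  shows "linear_on (tensor_vs V W) U (\<lambda>t. sweedler V W t f)"
proof (rule linear_onI)
  fix s t assume s: "s \<in> carrier (tensor_vs V W)" and t: "t \<in> carrier (tensor_vs V W)"
  obtain xs where xs: "set xs \<subseteq> carrier V \<times> carrier W" "s = (\<Sum>(v, w)\<leftarrow>xs. v \<otimes>[V,W] w)"
    using tensor_decomposition[OF V s] .
  obtain ys where ys: "set ys \<subseteq> carrier V \<times> carrier W" "t = (\<Sum>(v, w)\<leftarrow>ys. v \<otimes>[V,W] w)"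
    using tensor_decomposition[OF V t] .
  show "sweedler V W (s + t) f = sweedler V W s f + sweedler V W t f"
    using sweedler_eq[OF U f, of "xs @ ys"] xs(1) ys(1)
    unfolding xs(2) ys(2) sweedler_eq[OF U f xs(1)] sweedler_eq[OF U f ys(1)] by simp
next
  fix c t assume t: "t \<in> carrier (tensor_vs V W)"
  interpret vspace V by fact
  interpret U: vspace U by fact
  obtain xs where xs: "set xs \<subseteq> carrier V \<times> carrier W" "t = (\<Sum>(v, w)\<leftarrow>xs. v \<otimes>[V,W] w)"
    using tensor_decomposition[OF V t] .
  let ?ys = "map (\<lambda>(v, w). (smul V c v, w)) xs"
  have ys: "set ?ys \<subseteq> carrier V \<times> carrier W"
    using xs(1) by (auto simp: smul_closed)
  have 1: "fun_smul c (\<Sum>(v, w)\<leftarrow>xs. v \<otimes>[V,W] w) = (\<Sum>(v, w)\<leftarrow>?ys. v \<otimes>[V,W] w)"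
    using xs(1)
  proof (induction xs)
    case Nil
    show ?case by (simp add: fun_smul_def fun_eq_iff)
  next
    case (Cons a xs)
    obtain v w where a: "a = (v, w)" by (cases a)
    have "smul V c v \<otimes>[V,W] w = fun_smul c (v \<otimes>[V,W] w)"
      using linear_on_smul[OF bilinear_on_left[OF bilinear_on_pure_tensor], of w W v V c] Cons.prems a
      by simp
    then show ?case
      using Cons by (auto simp: a fun_smul_def fun_eq_iff algebra_simps)
  qed
  have 2: "(\<Sum>(v, w)\<leftarrow>?ys. f v w) = smul U c (\<Sum>(v, w)\<leftarrow>xs. f v w)"
    using xs(1)
  proof (induction xs)
    case (Cons a xs)
    obtain v w where a: "a = (v, w)" by (cases a)
    have "f (smul V c v) w = smul U c (f v w)"
      using linear_on_smul[OF bilinear_on_left[OF f], of w v c] Cons.prems a by simp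
    then show ?case
      using Cons by (auto simp: a U.amb.scale_right_distrib)
  qed simp
  show "sweedler V W (smul (tensor_vs V W) c t) f = smul U c (sweedler V W t f)"
    unfolding smul_tensor_vs xs(2) 1 sweedler_eq[OF U f ys] sweedler_eq[OF U f xs(1)] by (rule 2)
qed (rule sweedler_mem[OF assms])

lemma linear_sweedler:
  assumes V: "vspace V" and U: "vspace U" and Z: "vspace Z" and f: "bilinear_on V W U f"
    and \<phi>: "linear_on U Z \<phi>" and t: "t \<in> carrier (tensor_vs V W)"
  shows "\<phi> (sweedler V W t f) = sweedler V W t (\<lambda>v w. \<phi> (f v w))"
proof -
  obtain xs where xs: "set xs \<subseteq> carrier V \<times> carrier W" "t = (\<Sum>(v, w)\<leftarrow>xs. v \<otimes>[V,W] w)"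
    using tensor_decomposition[OF V t] .
  show ?thesis
    unfolding xs(2) sweedler_eq[OF U f xs(1)] sweedler_eq[OF Z bilinear_on_compose[OF f \<phi>] xs(1)]
    by (rule linear_on_pair_sum[OF U \<phi> xs(1)]) (rule bilinear_on_mem[OF f])
qed

lemma linear_on_sweedler_body:
  assumes V: "vspace V" and U: "vspace U" and Z: "vspace Z" and t: "t \<in> carrier (tensor_vs V W)"
    and f: "\<And>z. z \<in> carrier Z \<Longrightarrow> bilinear_on V W U (f z)"
    and lin: "\<And>v w. v \<in> carrier V \<Longrightarrow> w \<in> carrier W \<Longrightarrow> linear_on Z U (\<lambda>z. f z v w)"
  shows "linear_on Z U (\<lambda>z. sweedler V W t (f z))"
proof -
  interpret U: vspace U by fact
  obtain xs where xs: "set xs \<subseteq> carrier V \<times> carrier W" "t = (\<Sum>(v, w)\<leftarrow>xs. v \<otimes>[V,W] w)"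
    using tensor_decomposition[OF V t] .
  have "linear_on Z U (\<lambda>z. \<Sum>(v, w)\<leftarrow>xs. f z v w)"
    by (rule linear_on_pair_sum_fun[OF U xs(1) lin])
  then show ?thesis
    by (rule linear_on_cong[OF Z]) (simp add: xs sweedler_eq[OF U f xs(1)])
qed

lemma sweedler_swap:
  assumes V: "vspace V" and X: "vspace X" and Y: "vspace Y" and U: "vspace U"
    and s: "s \<in> carrier (tensor_vs V W)" and t: "t \<in> carrier (tensor_vs X Y)"
    and f1: "\<And>v w. v \<in> carrier V \<Longrightarrow> w \<in> carrier W \<Longrightarrow> bilinear_on X Y U (f v w)"
    and f2: "\<And>x y. x \<in> carrier X \<Longrightarrow> y \<in> carrier Y \<Longrightarrow> bilinear_on V W U (\<lambda>v w. f v w x y)"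
  shows "sweedler V W s (\<lambda>v w. sweedler X Y t (f v w)) =
    sweedler X Y t (\<lambda>x y. sweedler V W s (\<lambda>v w. f v w x y))"
proof -
  obtain xs where xs: "set xs \<subseteq> carrier V \<times> carrier W" "s = (\<Sum>(v, w)\<leftarrow>xs. v \<otimes>[V,W] w)"
    using tensor_decomposition[OF V s] .
  have W': "linear_on W U (\<lambda>w. f v w x y)" if "v \<in> carrier V" "x \<in> carrier X" "y \<in> carrier Y" for v x y
    using that f2 bilinear_on_right by blast
  have V': "linear_on V U (\<lambda>v. f v w x y)" if "w \<in> carrier W" "x \<in> carrier X" "y \<in> carrier Y" for w x y
    using that f2 bilinear_on_left by blast
  obtain ys where ys: "set ys \<subseteq> carrier X \<times> carrier Y" "t = (\<Sum>(v, w)\<leftarrow>ys. v \<otimes>[X,Y] w)"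
    using tensor_decomposition[OF X t] .
  have "sweedler V W s (\<lambda>v w. sweedler X Y t (f v w)) =
      sweedler V W s (\<lambda>v w. \<Sum>(x, y)\<leftarrow>ys. f v w x y)"
    by (rule sweedler_cong) (simp add: ys(2) sweedler_eq[OF U f1 ys(1)])
  also have "\<dots> = (\<Sum>(v, w)\<leftarrow>xs. \<Sum>(x, y)\<leftarrow>ys. f v w x y)"
    unfolding xs(2)
    by (rule sweedler_eq[OF U _ xs(1)]) (intro bilinear_onI linear_on_pair_sum_fun[OF U ys(1)] V' W')
  also have "\<dots> = (\<Sum>(x, y)\<leftarrow>ys. \<Sum>(v, w)\<leftarrow>xs. f v w x y)"
    by (induction xs) (auto simp: case_prod_unfold sum_list_addf)
  also have "\<dots> = (\<Sum>(x, y)\<leftarrow>ys. sweedler V W s (\<lambda>v w. f v w x y))"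
    using ys(1) by (induction ys) (auto simp: xs(2) sweedler_eq[OF U f2 xs(1)])
  also have "\<dots> = sweedler X Y t (\<lambda>x y. sweedler V W s (\<lambda>v w. f v w x y))"
    unfolding ys(2)
    by (rule sweedler_eq[OF U _ ys(1), symmetric])
      (intro bilinear_onI linear_on_sweedler_body[OF V U _ s] X Y V' W'
        bilinear_on_left[OF f1] bilinear_on_right[OF f1])
  finally show ?thesis .
qed

section \<open>Duals of finite-dimensional spaces\<close>

lemma linear_on_tensor_eq:
  assumes V: "vspace V" and f: "linear_on (tensor_vs V W) U f" and g: "linear_on (tensor_vs V W) U g"
    and eq: "\<And>v w. v \<in> carrier V \<Longrightarrow> w \<in> carrier W \<Longrightarrow> f (v \<otimes>[V,W] w) = g (v \<otimes>[V,W] w)"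
    and t: "t \<in> carrier (tensor_vs V W)"
  shows "f t = g t"
proof -
  obtain xs where xs: "set xs \<subseteq> carrier V \<times> carrier W" "t = (\<Sum>(v, w)\<leftarrow>xs. v \<otimes>[V,W] w)"
    using tensor_decomposition[OF V t] .
  have "h (\<Sum>(v, w)\<leftarrow>xs. v \<otimes>[V,W] w) = (\<Sum>(v, w)\<leftarrow>xs. h (v \<otimes>[V,W] w))"
    if "linear_on (tensor_vs V W) U h" for h
    by (rule linear_on_pair_sum[OF vspace_tensor that xs(1) pure_tensor_mem])
  moreover have "(\<Sum>(v, w)\<leftarrow>xs. f (v \<otimes>[V,W] w)) = (\<Sum>(v, w)\<leftarrow>xs. g (v \<otimes>[V,W] w))"
    using xs(1) by (induction xs) (auto simp: eq)
  ultimately show ?thesis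
    unfolding xs(2) using f g by simp
qed

lemma pure_tensor_cong:
  assumes "carrier V = carrier V'" "smul V = smul V'" "carrier W = carrier W'" "smul W = smul W'"
  shows "v \<otimes>[V,W] w = v \<otimes>[V',W'] w"
  using assms by (simp add: pure_tensor_def bilinear_on_def linear_on_def)

lemma tensor_vs_cong:
  assumes "carrier V = carrier V'" "smul V = smul V'" "carrier W = carrier W'" "smul W = smul W'"
  shows "tensor_vs V W = tensor_vs V' W'"
  using assms pure_tensor_cong[OF assms] by (simp add: tensor_vs_def)

lemma sweedler_cong_vs:
  assumes "carrier V = carrier V'" "smul V = smul V'" "carrier W = carrier W'" "smul W = smul W'"
  shows "sweedler V W = sweedler V' W'"
  unfolding sweedler_def pure_tensor_cong[OF assms] assms(1,3) ..

locale based_vspace = vspace V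
  for V :: "('f::field, 'a::ab_group_add, 'm) vs_scheme" (structure) and C :: "'a set" +
  assumes finite_basis: "finite C" and basis: "basis_of V C"
begin

abbreviation coord :: "'a \<Rightarrow> 'a \<Rightarrow> 'f" where
  "coord \<equiv> dual_basis V C"

lemma independent: "amb.independent C" and span: "amb.span C = carrier V"
  using basis by (simp_all add: basis_of_def)

lemma basis_closed: "c \<in> C \<Longrightarrow> c \<in> carrier V"
  using amb.span_base span by blast

lemma dual_determined:
  assumes "linear_on V U f" and "linear_on V U g" and "\<And>c. c \<in> C \<Longrightarrow> f c = g c" and "v \<in> carrier V"
  shows "f v = g v"
proof -
  have "v \<in> amb.span C" using assms(4) span by simp
  then obtain r where v: "v = (\<Sum>c\<in>C. smul V (r c) c)"
    using amb.span_finite[OF finite_basis] by auto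
  show ?thesis
    unfolding v
    using assms(3)
    by (simp add: linear_on_sum[OF vspace_axioms assms(1)] linear_on_sum[OF vspace_axioms assms(2)]
        smul_closed basis_closed linear_on_smul[OF assms(1)] linear_on_smul[OF assms(2)])
qed

lemma representation_dual: "(\<lambda>v. amb.representation C v c) \<in> dual_carrier V"
proof -
  have "amb.representation C x c = 0" if "x \<notin> carrier V" for x
    using that span by (simp add: amb.representation_def)
  moreover have "linear_on V field_vs (\<lambda>v. amb.representation C v c)"
  proof (rule linear_onI)
    fix x y assume "x \<in> carrier V" "y \<in> carrier V"
    then show "amb.representation C (x + y) c = amb.representation C x c + amb.representation C y c"
      using amb.representation_add[OF independent, of y x] span by simp
  next
    fix r x assume "x \<in> carrier V"
    then show "amb.representation C (smul V r x) c = smul field_vs r (amb.representation C x c)"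
      using amb.representation_scale[OF independent, of x r] span by simp
  qed simp
  ultimately show ?thesis by (simp add: dual_carrier_def)
qed

lemma coord_eq:
  assumes "c \<in> C"
  shows "coord c = (\<lambda>v. amb.representation C v c)"
  unfolding dual_basis_def
proof (rule the_equality)
  show "(\<lambda>v. amb.representation C v c) \<in> dual_carrier V \<and>
      (\<forall>y\<in>C. amb.representation C y c = (if y = c then 1 else 0))"
    by (simp add: representation_dual amb.representation_basis[OF independent])
next
  fix \<alpha> assume \<alpha>: "\<alpha> \<in> dual_carrier V \<and> (\<forall>y\<in>C. \<alpha> y = (if y = c then 1 else 0))"
  then have lin: "linear_on V field_vs \<alpha>" and zero: "\<forall>v. v \<notin> carrier V \<longrightarrow> \<alpha> v = 0"
    by (simp_all add: dual_carrier_def)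
  have lin': "linear_on V field_vs (\<lambda>v. amb.representation C v c)"
    and zero': "\<forall>v. v \<notin> carrier V \<longrightarrow> amb.representation C v c = 0"
    using representation_dual[of c] by (simp_all add: dual_carrier_def)
  show "\<alpha> = (\<lambda>v. amb.representation C v c)"
  proof
    fix v
    show "\<alpha> v = amb.representation C v c"
    proof (cases "v \<in> carrier V")
      case True
      show ?thesis
        using dual_determined[OF lin lin' _ True] \<alpha>
        by (simp add: amb.representation_basis[OF independent])
    qed (simp add: zero zero')
  qed
qed

lemma coord_dual: "c \<in> C \<Longrightarrow> coord c \<in> dual_carrier V"
  using representation_dual by (simp add: coord_eq)

lemma coord_linear: "c \<in> C \<Longrightarrow> linear_on V field_vs (\<lambda>v. coord c v)"
  using coord_dual by (simp add: dual_carrier_def)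

lemma coord_basis: "c \<in> C \<Longrightarrow> d \<in> C \<Longrightarrow> coord c d = (if d = c then 1 else 0)"
  by (simp add: coord_eq amb.representation_basis[OF independent])

lemma linear_expand:
  assumes U: "vspace U" and f: "linear_on V U f" and v: "v \<in> carrier V"
  shows "f v = (\<Sum>c\<in>C. smul U (coord c v) (f c))"
proof (rule dual_determined[OF f _ _ v])
  show "linear_on V U (\<lambda>v. \<Sum>c\<in>C. smul U (coord c v) (f c))"
    by (intro linear_on_sum_fun linear_on_scaleL U coord_linear linear_on_mem[OF f] basis_closed)
  fix d assume d: "d \<in> C"
  interpret U: vspace U by fact
  have "(\<Sum>c\<in>C. smul U (coord c d) (f c)) = (\<Sum>c\<in>C. if c = d then f d else 0)"
    using d by (intro sum.cong) (auto simp: coord_basis)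
  then show "f d = (\<Sum>c\<in>C. smul U (coord c d) (f c))"
    using d finite_basis by simp
qed

lemma expand: "v \<in> carrier V \<Longrightarrow> v = (\<Sum>c\<in>C. smul V (coord c v) c)"
  using linear_expand[OF vspace_axioms linear_on_id] .

lemma coord_sum:
  assumes "d \<in> C"
  shows "coord d (\<Sum>c\<in>C. smul V (r c) c) = r d"
proof -
  have "coord d (\<Sum>c\<in>C. smul V (r c) c) = (\<Sum>c\<in>C. r c * coord d c)"
    using assms by (simp add: linear_on_sum[OF vspace_axioms coord_linear] smul_closed basis_closed
        linear_on_smul[OF coord_linear])
  also have "\<dots> = (\<Sum>c\<in>C. if c = d then r d else 0)"
    using assms by (intro sum.cong) (auto simp: coord_basis)
  finally show ?thesis using assms finite_basis by simp
qed

end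

lemma (in vspace) obtain_basis:
  assumes "finite_dim V"
  obtains C where "based_vspace V C"
proof -
  obtain S where S: "finite S" "amb.span S = carrier V"
    using assms by (auto simp: finite_dim_def)
  obtain C where C: "C \<subseteq> S" "amb.independent C" "S \<subseteq> amb.span C"
    using amb.maximal_independent_subset[of S] by metis
  have "amb.span C = carrier V"
    using C S by (metis amb.span_mono amb.span_span subset_antisym)
  then have "based_vspace V C"
    using C S finite_subset by unfold_locales (auto simp: basis_of_def)
  then show thesis by (rule that)
qed

lemma finite_dimI:
  assumes "vspace V" and "finite I" and "\<And>i. i \<in> I \<Longrightarrow> g i \<in> carrier V"
    and "\<And>v. v \<in> carrier V \<Longrightarrow> \<exists>r. v = (\<Sum>i\<in>I. smul V (r i) (g i))"
  shows "finite_dim V"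
proof -
  interpret vspace V by fact
  have "v \<in> amb.span (g ` I)" if v: "v \<in> carrier V" for v
  proof -
    obtain r where "v = (\<Sum>i\<in>I. smul V (r i) (g i))"
      using assms(4)[OF v] by blast
    then show ?thesis
      by (simp only:, intro amb.span_sum amb.span_scale) (rule amb.span_base, rule imageI)
  qed
  moreover have "amb.span (g ` I) \<subseteq> carrier V"
    by (rule amb.span_minimal[OF _ subspace]) (use assms(3) in auto)
  ultimately have "amb.span (g ` I) = carrier V" by blast
  then show ?thesis using assms(2) by (auto simp: finite_dim_def)
qed

text \<open>
  With a constant at its head, the value \<open>\<langle>\<alpha>, h\<rangle>\<close> can be recognised by unification as a function of
  either argument, which a bare application \<open>\<alpha> h\<close> cannot.
\<close>

definition pairing :: "('a \<Rightarrow> 'f) \<Rightarrow> 'a \<Rightarrow> 'f" ("\<langle>_, _\<rangle>") where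
  "\<langle>\<alpha>, h\<rangle> = \<alpha> h"

lemma carrier_dual_hopf: "carrier (dual_hopf X) = dual_carrier X"
  and smul_dual_hopf [simp]: "smul (dual_hopf X) = fun_smul"
  by (simp_all add: dual_hopf_def dual_vs_def)

lemma dual_eqI:
  assumes "\<alpha> \<in> carrier (dual_hopf X)" and "\<beta> \<in> carrier (dual_hopf X)"
    and "\<And>h. h \<in> carrier X \<Longrightarrow> \<langle>\<alpha>, h\<rangle> = \<langle>\<beta>, h\<rangle>"
  shows "\<alpha> = \<beta>"
proof
  fix h
  show "\<alpha> h = \<beta> h"
    using assms by (cases "h \<in> carrier X") (auto simp: carrier_dual_hopf dual_carrier_def pairing_def)
qed

lemma dual_linear: "\<alpha> \<in> carrier (dual_hopf X) \<Longrightarrow> linear_on X field_vs (\<lambda>h. \<langle>\<alpha>, h\<rangle>)"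
  by (simp add: carrier_dual_hopf dual_carrier_def pairing_def)

lemma linear_on_dualI:
  assumes "\<And>z. z \<in> carrier Z \<Longrightarrow> F z \<in> carrier (dual_hopf X)"
    and "vspace Z"
    and lin: "\<And>h. h \<in> carrier X \<Longrightarrow> linear_on Z field_vs (\<lambda>z. \<langle>F z, h\<rangle>)"
  shows "linear_on Z (dual_hopf X) F"
proof -
  interpret Z: vspace Z by fact
  have zero: "F z h = 0" if "z \<in> carrier Z" "h \<notin> carrier X" for z h
    using assms(1)[OF that(1)] that(2) by (simp add: carrier_dual_hopf dual_carrier_def)
  show "linear_on Z (dual_hopf X) F"
  proof (rule linear_onI)
    fix x y assume x: "x \<in> carrier Z" and y: "y \<in> carrier Z"
    have "F (x + y) h = F x h + F y h" for h
      using linear_on_add[OF lin, of h x y] x y zero[of _ h] Z.add_closed[OF x y]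
      by (cases "h \<in> carrier X") (simp_all add: pairing_def)
    then show "F (x + y) = F x + F y" by (simp add: fun_eq_iff)
  next
    fix c x assume x: "x \<in> carrier Z"
    have "F (smul Z c x) h = c * F x h" for h
      using linear_on_smul[OF lin, of h x c] x zero[of _ h] Z.smul_closed[OF x]
      by (cases "h \<in> carrier X") (simp_all add: pairing_def)
    then show "F (smul Z c x) = smul (dual_hopf X) c (F x)" by (simp add: fun_eq_iff fun_smul_def)
  qed (rule assms(1))
qed

lemma vspace_dual:
  assumes "vspace X"
  shows "vspace (dual_hopf X)"
proof -
  interpret vspace X by fact
  interpret F: vector_space "fun_smul :: 'a \<Rightarrow> ('b \<Rightarrow> 'a) \<Rightarrow> 'b \<Rightarrow> 'a"
    by (rule vector_space_fun_smul)
  show ?thesis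
    by (auto simp: vspace_def vector_space_fun_smul carrier_dual_hopf dual_carrier_def F.subspace_def
        linear_on_def fun_smul_def algebra_simps)
qed

lemma linear_on_fun_smulL:
  "vspace U \<Longrightarrow> smul U = fun_smul \<Longrightarrow> linear_on Z field_vs f \<Longrightarrow> u \<in> carrier U \<Longrightarrow>
    linear_on Z U (\<lambda>z. fun_smul (f z) u)"
  using linear_on_scaleL[of U Z f u] by simp

lemma linear_on_fun_smulR:
  "vspace U \<Longrightarrow> smul U = fun_smul \<Longrightarrow> linear_on Z U f \<Longrightarrow> linear_on Z U (\<lambda>z. fun_smul c (f z))"
  using linear_on_scaleR[of U Z f c] by simp

lemma fun_smul_closed:
  "vspace U \<Longrightarrow> smul U = fun_smul \<Longrightarrow> u \<in> carrier U \<Longrightarrow> fun_smul c u \<in> carrier U"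
  using vspace.smul_closed[of U u c] by simp

lemma linear_on_pure_tensorL:
  "linear_on Z V f \<Longrightarrow> w \<in> carrier W \<Longrightarrow> linear_on Z (tensor_vs V W) (\<lambda>z. f z \<otimes>[V,W] w)"
  by (rule linear_on_compose[OF _ bilinear_on_left[OF bilinear_on_pure_tensor]])

lemma linear_on_pure_tensorR:
  "linear_on Z W f \<Longrightarrow> v \<in> carrier V \<Longrightarrow> linear_on Z (tensor_vs V W) (\<lambda>z. v \<otimes>[V,W] f z)"
  by (rule linear_on_compose[OF _ bilinear_on_right[OF bilinear_on_pure_tensor]])

lemma linear_on_sweedler:
  assumes "vspace V" and "vspace U" and "linear_on Z (tensor_vs V W) f"
    and "\<And>v. v \<in> carrier V \<Longrightarrow> linear_on W U (\<lambda>w. g v w)"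
    and "\<And>w. w \<in> carrier W \<Longrightarrow> linear_on V U (\<lambda>v. g v w)"
  shows "linear_on Z U (\<lambda>z. sweedler V W (f z) g)"
  by (rule linear_on_compose[OF assms(3) linear_on_sweedler_tensor[OF assms(1,2)]])
    (rule bilinear_onI[OF assms(4,5)])

text \<open>
  Most side conditions below say that an expression is linear in each of its variables; the
  following rules reduce them to closure properties.
\<close>

lemmas multilinear_intros =
  bilinear_onI linear_on_id linear_on_sum_fun linear_on_scaleL linear_on_scaleR
  linear_on_timesL linear_on_timesR
  linear_on_fun_smulL linear_on_fun_smulR fun_smul_closed
  linear_on_pure_tensorL linear_on_pure_tensorR pure_tensor_mem
  linear_on_sweedler linear_on_sweedler_body sweedler_mem
  vspace_field vspace_tensor vspace_dual smul_tensor_vs smul_dual_hopf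

section \<open>Matrix algebras\<close>

definition matrix_alg :: "'i set \<Rightarrow> ('f::field, 'i \<Rightarrow> 'i \<Rightarrow> 'f) alg" where
  "matrix_alg I =
     \<lparr>carrier = {m. \<forall>i j. i \<notin> I \<or> j \<notin> I \<longrightarrow> m i j = 0},
      smul = (\<lambda>c m i j. c * m i j),
      mult = (\<lambda>m n i j. \<Sum>k\<in>I. m i k * n k j),
      one = (\<lambda>i j. if i = j \<and> i \<in> I then 1 else 0)\<rparr>"

lemma matrix_alg_simps [simp]:
  "m \<in> carrier (matrix_alg I) \<longleftrightarrow> (\<forall>i j. i \<notin> I \<or> j \<notin> I \<longrightarrow> m i j = 0)"
  "smul (matrix_alg I) = (\<lambda>c m i j. c * m i j)"
  "mult (matrix_alg I) = (\<lambda>m n i j. \<Sum>k\<in>I. m i k * n k j)"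
  "one (matrix_alg I) = (\<lambda>i j. if i = j \<and> i \<in> I then 1 else 0)"
  by (simp_all add: matrix_alg_def)

lemma unital_algebra_matrix_alg:
  assumes I: "finite I"
  shows "unital_algebra (matrix_alg I :: ('f::field, 'i \<Rightarrow> 'i \<Rightarrow> 'f) alg)"
proof -
  let ?M = "matrix_alg I :: ('f, 'i \<Rightarrow> 'i \<Rightarrow> 'f) alg"
  have vs: "vector_space (smul ?M)"
    by unfold_locales (auto simp: fun_eq_iff algebra_simps)
  then interpret M: vector_space "smul ?M" .
  show ?thesis
  proof (unfold_locales, goal_cases)
    case 1
    show ?case
      unfolding M.subspace_def by auto
  next
    case 2
    show ?case
      by (auto simp: bilinear_on_def linear_on_def fun_eq_iff algebra_simps sum.distrib sum_distrib_left)
  next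
    case (4 a b c)
    show ?case
      by (auto simp: fun_eq_iff sum_distrib_left sum_distrib_right mult.assoc intro: sum.swap)
  next
    case (5 a)
    have *: "(\<Sum>k\<in>I. (if i = k \<and> i \<in> I then 1 else 0) * a k j) = a i j" for i j
    proof -
      have "(\<Sum>k\<in>I. (if i = k \<and> i \<in> I then 1 else 0) * a k j) = (\<Sum>k\<in>I. if i = k then a i j else 0)"
        by (intro sum.cong) auto
      then show ?thesis using 5 I by auto
    qed
    show ?case unfolding matrix_alg_simps by (intro ext) (rule *)
  next
    case (6 a)
    have *: "(\<Sum>k\<in>I. a i k * (if k = j \<and> k \<in> I then 1 else 0)) = a i j" for i j
    proof -
      have "(\<Sum>k\<in>I. a i k * (if k = j \<and> k \<in> I then 1 else 0)) = (\<Sum>k\<in>I. if k = j then a i j else 0)"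
        by (intro sum.cong) auto
      then show ?thesis using 6 I by auto
    qed
    show ?case unfolding matrix_alg_simps by (intro ext) (rule *)
  qed (auto simp: algebra_simps fun_eq_iff)
qed

lemma op_alg_simps [simp]:
  "carrier (op_alg A) = carrier A" "smul (op_alg A) = smul A"
  "mult (op_alg A) = (\<lambda>a b. mult A b a)" "one (op_alg A) = one A"
  by (simp_all add: op_alg_def)

lemma unital_algebra_op:
  assumes "unital_algebra A"
  shows "unital_algebra (op_alg A)"
proof -
  interpret unital_algebra A by fact
  have "vspace (op_alg A)"
    using vspace_axioms by (simp add: vspace_def)
  moreover have "bilinear_on (op_alg A) (op_alg A) (op_alg A) (\<lambda>a b. mult (op_alg A) a b)"
    using mult_bilinear by (simp add: bilinear_on_def linear_on_def)
  ultimately show ?thesis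
    by (simp add: unital_algebra_def unital_algebra_axioms_def mult_assoc one_left one_right one_closed)
qed

lemma alg_isomorphicE:
  assumes "alg_isomorphic A B"
  obtains f where "unital_algebra A" and "unital_algebra B" and "bij_betw f (carrier A) (carrier B)"
    and "linear_on A B f" and "\<forall>a\<in>carrier A. \<forall>b\<in>carrier A. f (mult A a b) = mult B (f a) (f b)"
    and "f (one A) = one B"
  using assms unfolding alg_isomorphic_def by blast

lemma alg_isomorphic_sym:
  assumes "alg_isomorphic A B"
  shows "alg_isomorphic B A"
proof -
  obtain f where A: "unital_algebra A" and B: "unital_algebra B"
    and bij: "bij_betw f (carrier A) (carrier B)" and lin: "linear_on A B f"
    and mult: "\<forall>a\<in>carrier A. \<forall>b\<in>carrier A. f (mult A a b) = mult B (f a) (f b)"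
    and one: "f (one A) = one B"
    using alg_isomorphicE[OF assms] .
  interpret A: unital_algebra A by fact
  interpret B: unital_algebra B by fact
  let ?g = "inv_into (carrier A) f"
  have g: "bij_betw ?g (carrier B) (carrier A)" using bij by (rule bij_betw_inv_into)
  have gA: "?g y \<in> carrier A" if "y \<in> carrier B" for y using g that by (rule bij_betwE[rule_format])
  have fg: "f (?g y) = y" if "y \<in> carrier B" for y using bij that by (rule bij_betw_inv_into_right)
  have gI: "?g y = x" if "x \<in> carrier A" "f x = y" for x y
    using bij_betw_inv_into_left[OF bij that(1)] that(2) by simp
  have "linear_on B A ?g"
    by (intro linear_onI gA gI)
      (simp_all add: gA fg A.add_closed A.smul_closed linear_on_add[OF lin] linear_on_smul[OF lin])
  moreover have "?g (mult B x y) = mult A (?g x) (?g y)" if "x \<in> carrier B" "y \<in> carrier B" for x y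
    using that by (intro gI) (simp_all add: mult gA fg bilinear_on_mem[OF A.mult_bilinear])
  moreover have "?g (one B) = one A" by (intro gI) (simp_all add: one A.one_closed)
  ultimately show ?thesis using A B g unfolding alg_isomorphic_def by blast
qed

lemma alg_isomorphic_trans:
  assumes "alg_isomorphic A B" and "alg_isomorphic B C"
  shows "alg_isomorphic A C"
proof -
  obtain f where A: "unital_algebra A" and "unital_algebra B"
    and f: "bij_betw f (carrier A) (carrier B)" "linear_on A B f"
      "\<forall>a\<in>carrier A. \<forall>b\<in>carrier A. f (mult A a b) = mult B (f a) (f b)"
      "f (one A) = one B"
    using alg_isomorphicE[OF assms(1)] .
  obtain g where "unital_algebra B" and C: "unital_algebra C"
    and g: "bij_betw g (carrier B) (carrier C)" "linear_on B C g"
      "\<forall>a\<in>carrier B. \<forall>b\<in>carrier B. g (mult B a b) = mult C (g a) (g b)"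
      "g (one B) = one C"
    using alg_isomorphicE[OF assms(2)] .
  have "bij_betw (\<lambda>x. g (f x)) (carrier A) (carrier C)"
    using bij_betw_trans[OF f(1) g(1)] by (simp add: comp_def)
  moreover have "linear_on A C (\<lambda>x. g (f x))" by (rule linear_on_compose[OF f(2) g(2)])
  ultimately show ?thesis
    unfolding alg_isomorphic_def
    using A C f(3,4) g(3,4) linear_on_mem[OF f(2)] by (intro conjI exI[of _ "\<lambda>x. g (f x)"]) auto
qed

lemma alg_isomorphic_op:
  assumes "alg_isomorphic A B"
  shows "alg_isomorphic (op_alg A) (op_alg B)"
proof -
  obtain f where A: "unital_algebra A" and B: "unital_algebra B"
    and f: "bij_betw f (carrier A) (carrier B)" "linear_on A B f"
      "\<forall>a\<in>carrier A. \<forall>b\<in>carrier A. f (mult A a b) = mult B (f a) (f b)"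
      "f (one A) = one B"
    using alg_isomorphicE[OF assms] .
  have "linear_on (op_alg A) (op_alg B) f" using f(2) by (simp add: linear_on_def)
  then show ?thesis
    unfolding alg_isomorphic_def using f
    by (intro conjI unital_algebra_op A B exI[of _ f]) simp_all
qed

text \<open>Transposition of matrices reverses products.\<close>

lemma matrix_alg_op:
  assumes "finite I"
  shows "alg_isomorphic (matrix_alg I :: ('f::field, 'i \<Rightarrow> 'i \<Rightarrow> 'f) alg) (op_alg (matrix_alg I))"
  unfolding alg_isomorphic_def
proof (intro conjI unital_algebra_op unital_algebra_matrix_alg assms exI[of _ "\<lambda>m i j. m j i"])
  let ?M = "matrix_alg I :: ('f, 'i \<Rightarrow> 'i \<Rightarrow> 'f) alg"
  show "bij_betw (\<lambda>m i j. m j i) (carrier ?M) (carrier (op_alg ?M))"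
    by (rule bij_betw_byWitness[where f'="\<lambda>m i j. m j i"]) auto
  show "linear_on ?M (op_alg ?M) (\<lambda>m i j. m j i)"
    by (auto simp: linear_on_def fun_eq_iff)
qed (auto simp: fun_eq_iff mult.commute)

lemma alg_isomorphic_transport:
  assumes A: "vspace A" and M: "unital_algebra M"
    and closed: "\<And>a b. a \<in> carrier A \<Longrightarrow> b \<in> carrier A \<Longrightarrow> mult A a b \<in> carrier A"
    and one_closed: "one A \<in> carrier A"
    and bij: "bij_betw f (carrier A) (carrier M)" and lin: "linear_on A M f"
    and mult: "\<And>a b. a \<in> carrier A \<Longrightarrow> b \<in> carrier A \<Longrightarrow> f (mult A a b) = mult M (f a) (f b)"
    and one: "f (one A) = one M"
  shows "alg_isomorphic A M"
proof -
  interpret A: vspace A by fact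
  interpret M: unital_algebra M by fact
  have inj: "x = y" if "f x = f y" "x \<in> carrier A" "y \<in> carrier A" for x y
    using bij that by (auto simp: bij_betw_def inj_on_def)
  note fM = linear_on_mem[OF lin]
  note f_simps = mult one linear_on_add[OF lin] linear_on_smul[OF lin] A.add_closed A.smul_closed
    closed one_closed fM M.mult_assoc M.one_left M.one_right
    linear_on_add[OF bilinear_on_left[OF M.mult_bilinear]] linear_on_add[OF bilinear_on_right[OF M.mult_bilinear]]
    linear_on_smul[OF bilinear_on_left[OF M.mult_bilinear]] linear_on_smul[OF bilinear_on_right[OF M.mult_bilinear]]
  have "unital_algebra A"
  proof (unfold_locales, goal_cases)
    case 1
    show ?case
      by (intro bilinear_onI linear_onI closed; (rule inj)?) (simp_all add: f_simps)
  qed (rule inj one_closed; simp add: f_simps)+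
  then show ?thesis
    unfolding alg_isomorphic_def using M bij lin mult one by blast
qed

text \<open>
  A faithful right action of an algebra on \<open>V\<close> through which every linear endomorphism of \<open>V\<close> acts
  identifies the algebra with a matrix algebra.  Associativity and the unit laws of the algebra
  come from composition of maps.
\<close>

lemma (in based_vspace) full_right_action_iso:
  assumes A: "vspace A"
    and closed: "\<And>a b. a \<in> carrier A \<Longrightarrow> b \<in> carrier A \<Longrightarrow> mult A a b \<in> carrier A"
    and one_closed: "one A \<in> carrier A"
    and act_linear: "\<And>a. a \<in> carrier A \<Longrightarrow> linear_on V V (act a)"
    and linear_act: "\<And>v. v \<in> carrier V \<Longrightarrow> linear_on A V (\<lambda>a. act a v)"
    and act_mult: "\<And>a b v. a \<in> carrier A \<Longrightarrow> b \<in> carrier A \<Longrightarrow> v \<in> carrier V \<Longrightarrow>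
      act (mult A a b) v = act b (act a v)"
    and act_one: "\<And>v. v \<in> carrier V \<Longrightarrow> act (one A) v = v"
    and faithful: "\<And>a. a \<in> carrier A \<Longrightarrow> (\<And>v. v \<in> carrier V \<Longrightarrow> act a v = 0) \<Longrightarrow> a = 0"
    and full: "\<And>T. linear_on V V T \<Longrightarrow> \<exists>a\<in>carrier A. \<forall>v\<in>carrier V. act a v = T v"
  shows "alg_isomorphic A (matrix_alg C)"
proof -
  interpret A: vspace A by fact
  define f where "f a i j = (if i \<in> C \<and> j \<in> C then coord j (act a i) else 0)" for a i j
  have act_closed: "act a v \<in> carrier V" if "a \<in> carrier A" "v \<in> carrier V" for a v
    using linear_on_mem[OF act_linear] that .
  have lin: "linear_on A (matrix_alg C) f"
    by (rule linear_onI)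
      (auto simp: f_def fun_eq_iff basis_closed act_closed linear_on_add[OF linear_act]
        linear_on_smul[OF linear_act] linear_on_add[OF coord_linear] linear_on_smul[OF coord_linear])
  have "inj_on f (carrier A)"
  proof (rule inj_onI)
    fix a b assume a: "a \<in> carrier A" and b: "b \<in> carrier A" and eq: "f a = f b"
    have ab: "a - b \<in> carrier A" using a b by (rule A.diff_closed)
    have "act a i = act b i" if i: "i \<in> C" for i
    proof -
      have "coord j (act a i) = coord j (act b i)" if "j \<in> C" for j
        using fun_cong[OF fun_cong[OF eq, of i], of j] i that by (simp add: f_def)
      then show ?thesis
        using expand[OF act_closed[OF a basis_closed[OF i]]] expand[OF act_closed[OF b basis_closed[OF i]]]
        by simp
    qed
    then have "act a v = act b v" if "v \<in> carrier V" for v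
      using dual_determined[OF act_linear[OF a] act_linear[OF b] _ that] by blast
    then have "a - b = 0"
      using linear_on_diff[OF A linear_act a b] by (intro faithful ab) simp
    then show "a = b" by simp
  qed
  moreover have "m \<in> f ` carrier A" if m: "m \<in> carrier (matrix_alg C)" for m
  proof -
    define T where "T v = (\<Sum>i\<in>C. smul V (coord i v) (\<Sum>j\<in>C. smul V (m i j) j))" for v
    have "linear_on V V T"
      unfolding T_def
      by (intro linear_on_sum_fun linear_on_scaleL vspace_axioms coord_linear sum_closed smul_closed basis_closed)
    then obtain a where a: "a \<in> carrier A" "\<And>v. v \<in> carrier V \<Longrightarrow> act a v = T v"
      using full by blast
    have "T k = (\<Sum>j\<in>C. smul V (m k j) j)" if k: "k \<in> C" for k
    proof -
      have "T k = (\<Sum>i\<in>C. if i = k then \<Sum>j\<in>C. smul V (m i j) j else 0)"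
        unfolding T_def using k by (intro sum.cong) (simp_all add: coord_basis)
      then show ?thesis using k finite_basis by simp
    qed
    then have "f a = m"
      using m by (auto simp: f_def fun_eq_iff a(2) basis_closed coord_sum)
    then show ?thesis using a(1) by blast
  qed
  ultimately have bij: "bij_betw f (carrier A) (carrier (matrix_alg C))"
    using linear_on_mem[OF lin] unfolding bij_betw_def by blast
  show ?thesis
  proof (rule alg_isomorphic_transport[OF A unital_algebra_matrix_alg[OF finite_basis] closed one_closed bij lin])
    fix a b assume a: "a \<in> carrier A" and b: "b \<in> carrier A"
    have "coord j (act b (act a i)) = (\<Sum>k\<in>C. coord k (act a i) * coord j (act b k))"
      if "i \<in> C" "j \<in> C" for i j
      using linear_expand[OF vspace_field linear_on_compose[OF act_linear[OF b] coord_linear[OF that(2)]]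
          act_closed[OF a basis_closed[OF that(1)]]] by simp
    then show "f (mult A a b) = mult (matrix_alg C) (f a) (f b)"
      by (auto simp: f_def fun_eq_iff act_mult a b basis_closed intro!: sum.cong)
  next
    show "f (one A) = one (matrix_alg C)"
      by (auto simp: f_def fun_eq_iff act_one basis_closed coord_basis)
  qed
qed

section \<open>Fitting's lemma\<close>

context vspace
begin

lemma linear_on_funpow: "linear_on V V f \<Longrightarrow> linear_on V V (f ^^ n)"
  by (induction n) (auto simp: linear_on_def)

lemma linear_extension:
  assumes "finite_dim V" and "linear_on V V f"
  obtains g where "Vector_Spaces.linear (smul V) (smul V) g" and "\<And>x. x \<in> carrier V \<Longrightarrow> g x = f x"
proof -
  obtain C where C: "based_vspace V C" using obtain_basis[OF assms(1)] .
  interpret based_vspace V C by fact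
  interpret VV: vector_space_pair "smul V" "smul V" by unfold_locales
  let ?g = "VV.construct C f"
  have lin: "Vector_Spaces.linear (smul V) (smul V) ?g"
    by (rule VV.linear_construct[OF independent])
  then interpret g: Vector_Spaces.linear "smul V" "smul V" ?g .
  show thesis
  proof (rule that[OF lin])
    fix x assume x: "x \<in> carrier V"
    have ext: "?g c = f c" if "c \<in> C" for c by (rule VV.construct_basis[OF independent that])
    have "linear_on V V ?g"
    proof (rule linear_onI)
      fix y assume "y \<in> carrier V"
      then show "?g y \<in> carrier V"
        using VV.construct_in_span[OF independent, of f y]
          amb.span_minimal[OF _ subspace, of "f ` C"] basis_closed linear_on_mem[OF assms(2)] by blast
    qed (simp_all add: g.add g.scale)
    then show "?g x = f x"
      by (rule dual_determined[OF _ assms(2) ext x])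
  qed
qed

text \<open>
  The power \<open>f\<^sup>n\<close> is one of least rank among the positive even powers.  Then \<open>f\<^sup>2\<^sup>n\<close> has no smaller rank, so
  \<open>f\<^sup>n\<close> carries a basis of its image to a linearly independent family of the same size, again inside
  the image.  Even powers are asked for because the antipode reverses products, and positive ones
  because nothing about \<open>f\<close> can be read off from \<open>f\<^sup>0\<close>.
\<close>

lemma fitting:
  assumes fin: "finite_dim V" and f: "linear_on V V f"
  obtains n where "even n" and "n > 0"
    and "(f ^^ n) ` ((f ^^ n) ` carrier V) = (f ^^ n) ` carrier V"
    and "\<And>x. x \<in> (f ^^ n) ` carrier V \<Longrightarrow> (f ^^ n) x = 0 \<Longrightarrow> x = 0"
proof -
  obtain C where C: "based_vspace V C" using obtain_basis[OF fin] .
  interpret based_vspace V C by fact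
  interpret VV: vector_space_pair "smul V" "smul V" by unfold_locales
  define rk where "rk n = amb.dim ((f ^^ n) ` carrier V)" for n
  obtain n where n: "even n" "n > 0" and min: "\<And>k. even k \<Longrightarrow> k > 0 \<Longrightarrow> rk n \<le> rk k"
    using ex_has_least_nat[of "\<lambda>n. even n \<and> n > 0" 2 rk] by auto
  define N where "N = f ^^ n"
  have N: "linear_on V V N" unfolding N_def by (rule linear_on_funpow[OF f])
  obtain g where lin: "Vector_Spaces.linear (smul V) (smul V) g"
    and g: "\<And>x. x \<in> carrier V \<Longrightarrow> g x = N x"
    using linear_extension[OF fin N] by blast
  interpret g: Vector_Spaces.linear "smul V" "smul V" g by (rule lin)
  let ?I = "N ` carrier V" and ?J = "N ` (N ` carrier V)"
  have I: "?I \<subseteq> carrier V" using linear_on_mem[OF N] by blast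
  have gI: "g ` carrier V = ?I" using g by (intro image_cong) auto
  have gJ: "g ` ?I = ?J" using g I by (intro image_cong) auto
  have subI: "amb.subspace ?I"
    using g.subspace_image[OF subspace] gI by simp
  have subJ: "amb.subspace ?J"
    using g.subspace_image[OF subI] gJ by simp
  have JI: "?J \<subseteq> ?I" using I by blast
  obtain D where D: "D \<subseteq> ?I" "amb.independent D" "?I \<subseteq> amb.span D" "card D = amb.dim ?I"
    using amb.basis_exists by blast
  have finD: "finite D"
    using amb.independent_span_bound[OF finite_basis D(2)] D(1) I span by auto
  have spanD: "amb.span D = ?I"
    using D(1,3) amb.span_minimal[OF _ subI] by blast
  have spanJ: "amb.span (g ` D) = ?J"
    using g.span_image[of D] spanD gJ by simp
  have dimJ: "card D \<le> amb.dim ?J"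
  proof -
    have "?J = (f ^^ (n + n)) ` carrier V"
      unfolding N_def by (auto simp: funpow_add image_image)
    then show ?thesis using min[of "n + n"] n D(4) by (simp add: rk_def N_def)
  qed
  have inj: "inj_on g D" and indep: "amb.independent (g ` D)"
  proof -
    have "card (g ` D) \<ge> card D"
      using dimJ amb.dim_le_card[of ?J "g ` D"] spanJ finD by auto
    then show "inj_on g D" using finD by (meson card_image_le eq_card_imp_inj_on le_antisym)
    then have card: "card (g ` D) = card D" by (rule card_image)
    show "amb.independent (g ` D)"
    proof
      assume "amb.dependent (g ` D)"
      then obtain a where a: "a \<in> g ` D" "a \<in> amb.span (g ` D - {a})"
        by (auto simp: amb.dependent_def)
      then have "?J \<subseteq> amb.span (g ` D - {a})"
        using amb.span_redundant[of a "g ` D - {a}"] spanJ by (simp add: insert_absorb)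
      then have "amb.dim ?J \<le> card (g ` D - {a})"
        using finD by (intro amb.dim_le_card) auto
      then show False
        using a(1) finD dimJ card by (metis card_Diff1_less finite_imageI leD order_trans)
    qed
  qed
  have "?I \<subseteq> ?J"
  proof (rule ccontr)
    assume "\<not> ?I \<subseteq> ?J"
    then obtain x where x: "x \<in> ?I" "x \<notin> amb.span (g ` D)" using spanJ by blast
    have "amb.independent (insert x (g ` D))"
      by (rule amb.independent_insertI[OF x(2) indep])
    moreover have "insert x (g ` D) \<subseteq> amb.span D"
      using x(1) JI spanD spanJ amb.span_superset[of "g ` D"] by auto
    ultimately have "card (insert x (g ` D)) \<le> card D"
      using amb.independent_span_bound[OF finD] by blast
    moreover have "x \<notin> g ` D" using x(2) amb.span_base by blast
    ultimately show False using finD card_image[OF inj] by simp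
  qed
  then have surj: "?J = ?I" using JI by blast
  have kern: "x = 0" if "x \<in> ?I" "N x = 0" for x
    using VV.linear_indep_image_lemma[OF lin finD indep inj, of x] that spanD g I by auto
  show thesis
    by (rule that[OF n]) (use surj kern in \<open>auto simp: N_def\<close>)
qed

end

section \<open>Multiplication and comultiplication on the dual\<close>

text \<open>
  Multiplication and comultiplication with no law relating them: \<open>H\<close>, its dual and the Drinfel'd
  double are all instances, and so is the dual of an instance.
\<close>

locale bialgebra_data = vspace X
  for X :: "('f::field, 'a::ab_group_add, 'm) hopf_scheme" (structure) +
  assumes mult_bilinear: "bilinear_on X X X (\<lambda>a b. a \<cdot> b)"
    and comult_linear: "linear_on X (tensor_vs X X) (comult X)"
    and finite_dim: "finite_dim X"
begin

abbreviation dual :: "('f, 'a \<Rightarrow> 'f) hopf" where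
  "dual \<equiv> dual_hopf X"

lemma mult_closed: "a \<in> carrier X \<Longrightarrow> b \<in> carrier X \<Longrightarrow> a \<cdot> b \<in> carrier X"
  by (rule bilinear_on_mem[OF mult_bilinear])

lemma comult_closed: "h \<in> carrier X \<Longrightarrow> comult X h \<in> carrier (tensor_vs X X)"
  by (rule linear_on_mem[OF comult_linear])

lemma linear_on_multL: "linear_on Z X f \<Longrightarrow> b \<in> carrier X \<Longrightarrow> linear_on Z X (\<lambda>z. f z \<cdot> b)"
  by (rule linear_on_compose[OF _ bilinear_on_left[OF mult_bilinear]])

lemma linear_on_multR: "linear_on Z X f \<Longrightarrow> a \<in> carrier X \<Longrightarrow> linear_on Z X (\<lambda>z. a \<cdot> f z)"
  by (rule linear_on_compose[OF _ bilinear_on_right[OF mult_bilinear]])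

lemma linear_on_comult: "linear_on Z X f \<Longrightarrow> linear_on Z (tensor_vs X X) (\<lambda>z. comult X (f z))"
  by (rule linear_on_compose[OF _ comult_linear])

lemma linear_on_sw2:
  assumes "vspace U" and "linear_on Z X f"
    and "\<And>v. v \<in> carrier X \<Longrightarrow> linear_on X U (\<lambda>w. g v w)"
    and "\<And>w. w \<in> carrier X \<Longrightarrow> linear_on X U (\<lambda>v. g v w)"
  shows "linear_on Z U (\<lambda>z. sw2 X (f z) g)"
  unfolding sw2_def
  by (rule linear_on_sweedler[OF vspace_axioms assms(1) linear_on_comult[OF assms(2)] assms(3,4)])

lemma linear_on_sw2_body:
  assumes "vspace U" and "vspace Z" and "h \<in> carrier X"
    and "\<And>z. z \<in> carrier Z \<Longrightarrow> bilinear_on X X U (f z)"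
    and "\<And>v w. v \<in> carrier X \<Longrightarrow> w \<in> carrier X \<Longrightarrow> linear_on Z U (\<lambda>z. f z v w)"
  shows "linear_on Z U (\<lambda>z. sw2 X h (f z))"
  unfolding sw2_def
  by (rule linear_on_sweedler_body[OF vspace_axioms assms(1,2) comult_closed[OF assms(3)] assms(4,5)])

lemma sw2_closed:
  assumes "vspace U" and "h \<in> carrier X" and "bilinear_on X X U f"
  shows "sw2 X h f \<in> carrier U"
  unfolding sw2_def by (rule sweedler_mem[OF vspace_axioms assms(1,3) comult_closed[OF assms(2)]])

lemma linear_on_pairing_form:
  "linear_on Z dual f \<Longrightarrow> h \<in> carrier X \<Longrightarrow> linear_on Z field_vs (\<lambda>z. \<langle>f z, h\<rangle>)"
  by (auto simp: linear_on_def pairing_def fun_smul_def)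

lemma linear_on_pairing_arg:
  "linear_on Z X f \<Longrightarrow> \<alpha> \<in> carrier dual \<Longrightarrow> linear_on Z field_vs (\<lambda>z. \<langle>\<alpha>, f z\<rangle>)"
  by (rule linear_on_compose[OF _ dual_linear])

lemmas structure_linear = smul_closed linear_on_pairing_form linear_on_pairing_arg mult_closed linear_on_multL linear_on_multR
  comult_closed linear_on_comult linear_on_sw2 linear_on_sw2_body sw2_closed vspace_axioms

lemmas multilinear = multilinear_intros structure_linear

lemma sw2_cong:
  "(\<And>v w. v \<in> carrier X \<Longrightarrow> w \<in> carrier X \<Longrightarrow> f v w = g v w) \<Longrightarrow> sw2 X h f = sw2 X h g"
  unfolding sw2_def by (rule sweedler_cong)

lemma linear_sw2:
  assumes "linear_on U Z \<phi>" and "vspace U" and "vspace Z" and "h \<in> carrier X" and "bilinear_on X X U f"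
  shows "\<phi> (sw2 X h f) = sw2 X h (\<lambda>v w. \<phi> (f v w))"
  unfolding sw2_def
  by (rule linear_sweedler[OF vspace_axioms assms(2,3,5,1) comult_closed[OF assms(4)]])

lemma sw2_mult_left:
  "a \<in> carrier X \<Longrightarrow> h \<in> carrier X \<Longrightarrow> bilinear_on X X X f \<Longrightarrow>
    a \<cdot> sw2 X h f = sw2 X h (\<lambda>v w. a \<cdot> f v w)"
  by (rule linear_sw2[OF linear_on_multR[OF linear_on_id] vspace_axioms vspace_axioms])

lemma sw2_mult_right:
  "b \<in> carrier X \<Longrightarrow> h \<in> carrier X \<Longrightarrow> bilinear_on X X X f \<Longrightarrow>
    sw2 X h f \<cdot> b = sw2 X h (\<lambda>v w. f v w \<cdot> b)"
  by (rule linear_sw2[OF linear_on_multL[OF linear_on_id] vspace_axioms vspace_axioms])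

lemma dual_mult_apply:
  "h \<in> carrier X \<Longrightarrow> \<langle>\<alpha> \<cdot>\<^bsub>dual\<^esub> \<beta>, h\<rangle> = sw2 X h (\<lambda>h1 h2. \<langle>\<alpha>, h1\<rangle> * \<langle>\<beta>, h2\<rangle>)"
  by (simp add: dual_hopf_def restrict0_def pairing_def)

lemma dual_mult_closed:
  assumes "\<alpha> \<in> carrier dual" and "\<beta> \<in> carrier dual"
  shows "\<alpha> \<cdot>\<^bsub>dual\<^esub> \<beta> \<in> carrier dual"
proof -
  have "linear_on X field_vs (\<lambda>h. sw2 X h (\<lambda>h1 h2. \<langle>\<alpha>, h1\<rangle> * \<langle>\<beta>, h2\<rangle>))"
    using assms by (intro multilinear)
  then have "linear_on X field_vs (\<lambda>h. \<langle>\<alpha> \<cdot>\<^bsub>dual\<^esub> \<beta>, h\<rangle>)"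
    by (rule linear_on_cong[OF vspace_axioms]) (simp add: dual_mult_apply)
  then show ?thesis
    by (simp add: carrier_dual_hopf dual_carrier_def pairing_def) (simp add: dual_hopf_def restrict0_def)
qed

lemma dual_mult_bilinear: "bilinear_on dual dual dual (\<lambda>\<alpha> \<beta>. \<alpha> \<cdot>\<^bsub>dual\<^esub> \<beta>)"
proof -
  have "vspace dual" by (rule vspace_dual) (rule vspace_axioms)
  then show ?thesis
    by (intro bilinear_onI linear_on_dualI dual_mult_closed)
      (simp_all only: dual_mult_apply, (intro multilinear; assumption)+)
qed

lemma vspace_dual': "vspace dual"
  by (rule vspace_dual) (rule vspace_axioms)

lemma bilinear_eval:
  "h \<in> carrier X \<Longrightarrow> k \<in> carrier X \<Longrightarrow>
    bilinear_on dual dual field_vs (\<lambda>\<alpha> \<beta>. \<langle>\<alpha>, h\<rangle> * \<langle>\<beta>, k\<rangle>)"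
  by (intro multilinear)

end

lemma sw2_sw2_swap:
  assumes X: "bialgebra_data X" and Y: "bialgebra_data Y" and U: "vspace U"
    and h: "h \<in> carrier X" and k: "k \<in> carrier Y"
    and f1: "\<And>v w. v \<in> carrier X \<Longrightarrow> w \<in> carrier X \<Longrightarrow> bilinear_on Y Y U (f v w)"
    and f2: "\<And>x y. x \<in> carrier Y \<Longrightarrow> y \<in> carrier Y \<Longrightarrow> bilinear_on X X U (\<lambda>v w. f v w x y)"
  shows "sw2 X h (\<lambda>v w. sw2 Y k (f v w)) = sw2 Y k (\<lambda>x y. sw2 X h (\<lambda>v w. f v w x y))"
proof -
  interpret X: bialgebra_data X by fact
  interpret Y: bialgebra_data Y by fact
  show ?thesis
    unfolding sw2_def
    by (rule sweedler_swap[OF X.vspace_axioms Y.vspace_axioms Y.vspace_axioms U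
          X.comult_closed[OF h] Y.comult_closed[OF k] f1 f2])
qed

lemma (in bialgebra_data) sw2_swap:
  assumes "vspace U" and "h \<in> carrier X" and "k \<in> carrier X"
    and "\<And>v w. v \<in> carrier X \<Longrightarrow> w \<in> carrier X \<Longrightarrow> bilinear_on X X U (f v w)"
    and "\<And>x y. x \<in> carrier X \<Longrightarrow> y \<in> carrier X \<Longrightarrow> bilinear_on X X U (\<lambda>v w. f v w x y)"
  shows "sw2 X h (\<lambda>v w. sw2 X k (f v w)) = sw2 X k (\<lambda>x y. sw2 X h (\<lambda>v w. f v w x y))"
  by (rule sw2_sw2_swap[OF bialgebra_data_axioms bialgebra_data_axioms assms])

locale based_bialgebra_data = bialgebra_data X + based_vspace X C
  for X :: "('f::field, 'a::ab_group_add, 'm) hopf_scheme" (structure) and C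
begin

lemma coord_closed: "c \<in> C \<Longrightarrow> coord c \<in> carrier dual"
  by (simp add: carrier_dual_hopf coord_dual)

lemma dual_expand:
  assumes "\<alpha> \<in> carrier dual"
  shows "\<alpha> = (\<Sum>c\<in>C. fun_smul \<langle>\<alpha>, c\<rangle> (coord c))"
proof (rule dual_eqI[OF assms])
  show "(\<Sum>c\<in>C. fun_smul \<langle>\<alpha>, c\<rangle> (coord c)) \<in> carrier dual"
    by (intro vspace.sum_closed[OF vspace_dual'] multilinear coord_closed)
  fix h assume h: "h \<in> carrier X"
  show "\<langle>\<alpha>, h\<rangle> = \<langle>\<Sum>c\<in>C. fun_smul \<langle>\<alpha>, c\<rangle> (coord c), h\<rangle>"
    using linear_expand[OF vspace_field dual_linear[OF assms] h]
    by (simp add: pairing_def fun_smul_def sum_fun_apply mult.commute)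
qed

lemma dual_pure_expand:
  assumes "\<alpha> \<in> carrier dual" and "w \<in> carrier W"
  shows "\<alpha> \<otimes>[dual,W] w = (\<Sum>c\<in>C. fun_smul \<langle>\<alpha>, c\<rangle> (coord c \<otimes>[dual,W] w))"
proof -
  have lin: "linear_on dual (tensor_vs dual W) (\<lambda>\<alpha>. \<alpha> \<otimes>[dual,W] w)"
    using assms(2) by (intro multilinear)
  show ?thesis
    using linear_on_lincomb[OF vspace_dual' lin, of C coord "\<lambda>c. \<langle>\<alpha>, c\<rangle>"] dual_expand[OF assms(1)]
    by (simp add: coord_closed)
qed

definition dual_coproduct :: "('a \<Rightarrow> 'f) \<Rightarrow> ('f, 'a \<Rightarrow> 'f, 'a \<Rightarrow> 'f) tensor" where
  "dual_coproduct \<alpha> = (\<Sum>c\<in>C. \<Sum>d\<in>C. fun_smul \<langle>\<alpha>, c \<cdot> d\<rangle> (coord c \<otimes>[dual, dual] coord d))"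

lemma dual_coproduct_linear:
  "linear_on dual (tensor_vs dual dual) dual_coproduct"
  unfolding dual_coproduct_def by (intro multilinear coord_closed basis_closed)

lemma dual_coproduct_pairing:
  assumes "\<alpha> \<in> carrier dual" and "h \<in> carrier X" and "k \<in> carrier X"
  shows "sweedler dual dual (dual_coproduct \<alpha>) (\<lambda>\<alpha>1 \<alpha>2. \<langle>\<alpha>1, h\<rangle> * \<langle>\<alpha>2, k\<rangle>) = \<langle>\<alpha>, h \<cdot> k\<rangle>"
proof -
  note lin = linear_on_sweedler_tensor[OF vspace_dual' vspace_field bilinear_eval[OF assms(2,3)]]
  have "sweedler dual dual (dual_coproduct \<alpha>) (\<lambda>\<alpha>1 \<alpha>2. \<langle>\<alpha>1, h\<rangle> * \<langle>\<alpha>2, k\<rangle>) =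
      (\<Sum>c\<in>C. \<Sum>d\<in>C. \<langle>\<alpha>, c \<cdot> d\<rangle> * (\<langle>coord c, h\<rangle> * \<langle>coord d, k\<rangle>))"
  proof -
    have "sweedler dual dual (\<Sum>d\<in>C. fun_smul \<langle>\<alpha>, c \<cdot> d\<rangle> (coord c \<otimes>[dual, dual] coord d))
          (\<lambda>\<alpha>1 \<alpha>2. \<langle>\<alpha>1, h\<rangle> * \<langle>\<alpha>2, k\<rangle>) =
        (\<Sum>d\<in>C. \<langle>\<alpha>, c \<cdot> d\<rangle> * (\<langle>coord c, h\<rangle> * \<langle>coord d, k\<rangle>))" if "c \<in> C" for c
      using linear_on_lincomb[OF vspace_tensor lin, of C "\<lambda>d. coord c \<otimes>[dual, dual] coord d"
          "\<lambda>d. \<langle>\<alpha>, c \<cdot> d\<rangle>"] that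
      by (simp add: sweedler_pure[OF vspace_field bilinear_eval[OF assms(2,3)]] coord_closed pure_tensor_mem)
    moreover have "(\<Sum>d\<in>C. fun_smul \<langle>\<alpha>, c \<cdot> d\<rangle> (coord c \<otimes>[dual, dual] coord d))
        \<in> carrier (tensor_vs dual dual)" if "c \<in> C" for c
      using that by (intro vspace.sum_closed[OF vspace_tensor] multilinear coord_closed)
    ultimately show ?thesis
      unfolding dual_coproduct_def by (simp add: linear_on_sum[OF vspace_tensor lin])
  qed
  also have "\<dots> = (\<Sum>c\<in>C. \<langle>coord c, h\<rangle> * (\<Sum>d\<in>C. \<langle>coord d, k\<rangle> * \<langle>\<alpha>, c \<cdot> d\<rangle>))"
    by (simp add: sum_distrib_left mult_ac)
  also have "\<dots> = (\<Sum>c\<in>C. \<langle>coord c, h\<rangle> * \<langle>\<alpha>, c \<cdot> k\<rangle>)"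
  proof (intro sum.cong refl arg_cong[where f="\<lambda>x. _ * x"])
    fix c assume c: "c \<in> C"
    have "linear_on X field_vs (\<lambda>k. \<langle>\<alpha>, c \<cdot> k\<rangle>)"
      using assms(1) basis_closed[OF c] by (intro multilinear)
    then show "(\<Sum>d\<in>C. \<langle>coord d, k\<rangle> * \<langle>\<alpha>, c \<cdot> d\<rangle>) = \<langle>\<alpha>, c \<cdot> k\<rangle>"
      using linear_expand[OF vspace_field _ assms(3), of "\<lambda>k. \<langle>\<alpha>, c \<cdot> k\<rangle>"]
      by (simp add: pairing_def)
  qed
  also have "\<dots> = \<langle>\<alpha>, h \<cdot> k\<rangle>"
  proof -
    have "linear_on X field_vs (\<lambda>h. \<langle>\<alpha>, h \<cdot> k\<rangle>)"
      using assms(1,3) by (intro multilinear)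
    then show ?thesis
      using linear_expand[OF vspace_field _ assms(2), of "\<lambda>h. \<langle>\<alpha>, h \<cdot> k\<rangle>"]
      by (simp add: pairing_def)
  qed
  finally show ?thesis .
qed

text \<open>
  An element of \<open>X\<^sup>* \<otimes> X\<^sup>*\<close> is determined by its values on pairs of basis vectors; this is the
  uniqueness behind the description of the coproduct of a form.
\<close>

lemma dual_tensor_expand:
  assumes t: "t \<in> carrier (tensor_vs dual dual)"
  shows "t = (\<Sum>c\<in>C. \<Sum>d\<in>C. fun_smul
    (sweedler dual dual t (\<lambda>\<alpha>1 \<alpha>2. \<langle>\<alpha>1, c\<rangle> * \<langle>\<alpha>2, d\<rangle>))
    (coord c \<otimes>[dual, dual] coord d))"
    (is "t = ?F t")
proof (rule linear_on_tensor_eq[OF vspace_dual' linear_on_id _ _ t])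
  show "linear_on (tensor_vs dual dual) (tensor_vs dual dual) ?F"
    by (intro multilinear coord_closed basis_closed)
  fix \<alpha> \<beta> assume \<alpha>: "\<alpha> \<in> carrier dual" and \<beta>: "\<beta> \<in> carrier dual"
  let ?T = "tensor_vs dual dual"
  have lin: "linear_on dual ?T (\<lambda>\<beta>. coord c \<otimes>[dual, dual] \<beta>)" if "c \<in> C" for c
    using that by (intro multilinear coord_closed)
  interpret T: vspace ?T by (rule vspace_tensor)
  have "\<alpha> \<otimes>[dual, dual] \<beta> =
      (\<Sum>c\<in>C. fun_smul \<langle>\<alpha>, c\<rangle> (coord c \<otimes>[dual, dual] \<beta>))"
    by (rule dual_pure_expand[OF \<alpha> \<beta>])
  also have "\<dots> = (\<Sum>c\<in>C. fun_smul \<langle>\<alpha>, c\<rangle>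
      (\<Sum>d\<in>C. fun_smul \<langle>\<beta>, d\<rangle> (coord c \<otimes>[dual, dual] coord d)))"
  proof (intro sum.cong refl arg_cong[where f="fun_smul _"])
    fix c assume c: "c \<in> C"
    have "coord c \<otimes>[dual, dual] \<beta> =
        coord c \<otimes>[dual, dual] (\<Sum>d\<in>C. fun_smul \<langle>\<beta>, d\<rangle> (coord d))"
      by (subst dual_expand[OF \<beta>]) simp
    then show "coord c \<otimes>[dual, dual] \<beta> =
        (\<Sum>d\<in>C. fun_smul \<langle>\<beta>, d\<rangle> (coord c \<otimes>[dual, dual] coord d))"
      using linear_on_lincomb[OF vspace_dual' lin[OF c], of C coord] by (simp add: coord_closed)
  qed
  also have "\<dots> = (\<Sum>c\<in>C. \<Sum>d\<in>C. fun_smul (\<langle>\<alpha>, c\<rangle> * \<langle>\<beta>, d\<rangle>) (coord c \<otimes>[dual, dual] coord d))"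
    using T.amb.scale_scale by (simp add: T.amb.scale_sum_right[simplified])
  also have "\<dots> = ?F (\<alpha> \<otimes>[dual, dual] \<beta>)"
    by (intro sum.cong refl) (simp add: sweedler_pure[OF vspace_field bilinear_eval \<alpha> \<beta>] basis_closed)
  finally show "\<alpha> \<otimes>[dual, dual] \<beta> = ?F (\<alpha> \<otimes>[dual, dual] \<beta>)" .
qed

lemma comult_dual:
  assumes \<alpha>: "\<alpha> \<in> carrier dual"
  shows "comult dual \<alpha> = dual_coproduct \<alpha>"
proof -
  have eq: "tensor_vs (dual_vs X) (dual_vs X) = tensor_vs dual dual"
    by (rule tensor_vs_cong) (simp_all add: dual_hopf_def)
  have eq': "sweedler (dual_vs X) (dual_vs X) = sweedler dual dual"
    by (rule sweedler_cong_vs) (simp_all add: dual_hopf_def)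
  have "comult dual \<alpha> = (THE t. t \<in> carrier (tensor_vs (dual_vs X) (dual_vs X)) \<and>
      (\<forall>h\<in>carrier X. \<forall>k\<in>carrier X.
         sweedler (dual_vs X) (dual_vs X) t (\<lambda>\<alpha>1 \<alpha>2. \<langle>\<alpha>1, h\<rangle> * \<langle>\<alpha>2, k\<rangle>) = \<langle>\<alpha>, h \<cdot> k\<rangle>))"
    by (simp add: dual_hopf_def pairing_def)
  also have "\<dots> = dual_coproduct \<alpha>"
    unfolding eq eq'
  proof (rule the_equality)
    show "dual_coproduct \<alpha> \<in> carrier (tensor_vs dual dual) \<and>
      (\<forall>h\<in>carrier X. \<forall>k\<in>carrier X. sweedler dual dual (dual_coproduct \<alpha>)
        (\<lambda>\<alpha>1 \<alpha>2. \<langle>\<alpha>1, h\<rangle> * \<langle>\<alpha>2, k\<rangle>) = \<langle>\<alpha>, h \<cdot> k\<rangle>)"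
      by (simp add: dual_coproduct_pairing \<alpha> linear_on_mem[OF dual_coproduct_linear])
  next
    fix t assume t: "t \<in> carrier (tensor_vs dual dual) \<and>
      (\<forall>h\<in>carrier X. \<forall>k\<in>carrier X. sweedler dual dual t
        (\<lambda>\<alpha>1 \<alpha>2. \<langle>\<alpha>1, h\<rangle> * \<langle>\<alpha>2, k\<rangle>) = \<langle>\<alpha>, h \<cdot> k\<rangle>)"
    then show "t = dual_coproduct \<alpha>"
      by (subst dual_tensor_expand) (auto simp: dual_coproduct_def basis_closed)
  qed
  finally show ?thesis .
qed

end

context bialgebra_data
begin

lemma obtain_based:
  obtains C where "based_bialgebra_data X C"
  using obtain_basis[OF finite_dim] bialgebra_data_axioms
  by (metis based_bialgebra_data.intro)

text \<open>The dual carries data of the same kind, so that everything above applies to it as well.\<close>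

lemma bialgebra_data_dual: "bialgebra_data dual"
proof -
  obtain C where "based_bialgebra_data X C" by (rule obtain_based)
  then interpret based_bialgebra_data X C .
  have "linear_on dual (tensor_vs dual dual) (comult dual)"
    by (rule linear_on_cong[OF vspace_dual' dual_coproduct_linear]) (rule comult_dual)
  moreover have "finite_dim dual"
  proof (rule finite_dimI[OF vspace_dual' finite_basis, of coord])
    show "\<exists>r. \<alpha> = (\<Sum>c\<in>C. smul dual (r c) (coord c))" if "\<alpha> \<in> carrier dual" for \<alpha>
      using dual_expand[OF that] by auto
  qed (rule coord_closed)
  ultimately show ?thesis
    using vspace_dual' dual_mult_bilinear
    by (simp add: bialgebra_data_def bialgebra_data_axioms_def)
qed

lemma dual_sw2:
  assumes "\<alpha> \<in> carrier dual" and "h \<in> carrier X" and "k \<in> carrier X"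
  shows "sw2 dual \<alpha> (\<lambda>\<alpha>1 \<alpha>2. \<langle>\<alpha>1, h\<rangle> * \<langle>\<alpha>2, k\<rangle>) = \<langle>\<alpha>, h \<cdot> k\<rangle>"
proof -
  obtain C where "based_bialgebra_data X C" by (rule obtain_based)
  then interpret based_bialgebra_data X C .
  show ?thesis
    using assms by (simp add: sw2_def comult_dual dual_coproduct_pairing)
qed

lemmas dual_sw2_swap = sw2_sw2_swap[OF bialgebra_data_dual bialgebra_data_axioms]

lemma dual_sw3:
  assumes "\<alpha> \<in> carrier dual" and "h \<in> carrier X" and "k \<in> carrier X" and "l \<in> carrier X"
  shows "sw3 dual \<alpha> (\<lambda>\<alpha>1 \<alpha>2 \<alpha>3. \<langle>\<alpha>1, h\<rangle> * \<langle>\<alpha>2, k\<rangle> * \<langle>\<alpha>3, l\<rangle>) = \<langle>\<alpha>, h \<cdot> k \<cdot> l\<rangle>"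
proof -
  interpret D: bialgebra_data "dual" by (rule bialgebra_data_dual)
  have "sw2 dual \<beta> (\<lambda>\<alpha>1 \<alpha>2. \<langle>\<alpha>1, h\<rangle> * \<langle>\<alpha>2, k\<rangle> * \<langle>\<alpha>3, l\<rangle>) = \<langle>\<beta>, h \<cdot> k\<rangle> * \<langle>\<alpha>3, l\<rangle>"
    if "\<beta> \<in> carrier dual" for \<beta> \<alpha>3
    using D.linear_sw2[OF linear_on_timesL[OF linear_on_id] vspace_field vspace_field that
        bilinear_eval[OF assms(2,3)], of "\<langle>\<alpha>3, l\<rangle>"] dual_sw2[OF that assms(2,3)] by simp
  then have "sw3 dual \<alpha> (\<lambda>\<alpha>1 \<alpha>2 \<alpha>3. \<langle>\<alpha>1, h\<rangle> * \<langle>\<alpha>2, k\<rangle> * \<langle>\<alpha>3, l\<rangle>) =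
      sw2 dual \<alpha> (\<lambda>\<beta> \<alpha>3. \<langle>\<beta>, h \<cdot> k\<rangle> * \<langle>\<alpha>3, l\<rangle>)"
    unfolding sw3_def by (subst (1 3) sw2_def) (rule sweedler_cong)
  then show ?thesis
    using dual_sw2[OF assms(1) mult_closed[OF assms(2,3)] assms(4)] by simp
qed

end

section \<open>Iterated coproducts\<close>

text \<open>
  Carries the sum over the basis in the \<open>R\<close>-matrix through Sweedler sums.
\<close>

lemma sweedler_sum:
  assumes "vspace V" and "vspace W" and "vspace U" and "\<And>i. i \<in> I \<Longrightarrow> bilinear_on V W U (f i)"
    and "t \<in> carrier (tensor_vs V W)"
  shows "sweedler V W t (\<lambda>v w. \<Sum>i\<in>I. f i v w) = (\<Sum>i\<in>I. sweedler V W t (f i))"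
proof (rule linear_on_tensor_eq[OF assms(1) _ _ _ assms(5)])
  have bil: "bilinear_on V W U (\<lambda>v w. \<Sum>i\<in>I. f i v w)"
    using assms(4) by (intro bilinear_onI linear_on_sum_fun assms(3)) (auto simp: bilinear_on_def)
  show "linear_on (tensor_vs V W) U (\<lambda>t. sweedler V W t (\<lambda>v w. \<Sum>i\<in>I. f i v w))"
    by (rule linear_on_sweedler_tensor[OF assms(1,3) bil])
  show "linear_on (tensor_vs V W) U (\<lambda>t. \<Sum>i\<in>I. sweedler V W t (f i))"
    by (intro linear_on_sum_fun linear_on_sweedler_tensor assms)
  show "sweedler V W (v \<otimes>[V,W] w) (\<lambda>v w. \<Sum>i\<in>I. f i v w) = (\<Sum>i\<in>I. sweedler V W (v \<otimes>[V,W] w) (f i))"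
    if "v \<in> carrier V" "w \<in> carrier W" for v w
    by (simp add: sweedler_pure[OF assms(3) bil that] sweedler_pure[OF assms(3,4) that])
qed

context bialgebra_data
begin

lemma sw2_sum:
  assumes "vspace U" and "h \<in> carrier X" and "\<And>i. i \<in> I \<Longrightarrow> bilinear_on X X U (f i)"
  shows "sw2 X h (\<lambda>v w. \<Sum>i\<in>I. f i v w) = (\<Sum>i\<in>I. sw2 X h (f i))"
  unfolding sw2_def
  by (rule sweedler_sum[OF vspace_axioms vspace_axioms assms(1,3) comult_closed[OF assms(2)]])

lemma sw3_cong:
  "(\<And>u v w. u \<in> carrier X \<Longrightarrow> v \<in> carrier X \<Longrightarrow> w \<in> carrier X \<Longrightarrow> f u v w = g u v w) \<Longrightarrow>
    sw3 X h f = sw3 X h g"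
  unfolding sw3_def by (intro sw2_cong)

definition trilinear_on :: "('f, 'b::ab_group_add, 'n) vs_scheme \<Rightarrow> ('a \<Rightarrow> 'a \<Rightarrow> 'a \<Rightarrow> 'b) \<Rightarrow> bool" where
  "trilinear_on U f \<longleftrightarrow> (\<forall>x\<in>carrier X. \<forall>y\<in>carrier X. linear_on X U (\<lambda>u. f u x y) \<and>
     linear_on X U (\<lambda>u. f x u y) \<and> linear_on X U (\<lambda>u. f x y u))"

lemma trilinear_onI:
  assumes "\<And>x y. x \<in> carrier X \<Longrightarrow> y \<in> carrier X \<Longrightarrow> linear_on X U (\<lambda>u. f u x y)"
    and "\<And>x y. x \<in> carrier X \<Longrightarrow> y \<in> carrier X \<Longrightarrow> linear_on X U (\<lambda>u. f x u y)"
    and "\<And>x y. x \<in> carrier X \<Longrightarrow> y \<in> carrier X \<Longrightarrow> linear_on X U (\<lambda>u. f x y u)"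
  shows "trilinear_on U f"
  using assms by (simp add: trilinear_on_def)

lemma trilinear_onD:
  assumes "trilinear_on U f" and "x \<in> carrier X" and "y \<in> carrier X"
  shows "linear_on X U (\<lambda>u. f u x y)" and "linear_on X U (\<lambda>u. f x u y)" and "linear_on X U (\<lambda>u. f x y u)"
  using assms by (simp_all add: trilinear_on_def)

lemma trilinear_on_compose:
  assumes "trilinear_on U f" and "linear_on U Z \<phi>"
  shows "trilinear_on Z (\<lambda>u v w. \<phi> (f u v w))"
  by (intro trilinear_onI linear_on_compose[OF _ assms(2)] trilinear_onD[OF assms(1)])

lemma bilinear_on_sw3:
  assumes "vspace U" and "trilinear_on U f"
  shows "bilinear_on X X U (\<lambda>k h3. sw2 X k (\<lambda>h1 h2. f h1 h2 h3))"
  by (intro multilinear assms(1) trilinear_onD[OF assms(2)])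

lemma bilinear_on_trilinear:
  assumes "trilinear_on U f" and "z \<in> carrier X"
  shows "bilinear_on X X U (\<lambda>x y. f x y z)"
  by (intro multilinear trilinear_onD[OF assms(1)] assms(2))

lemma linear_sw3:
  assumes "linear_on U Z \<phi>" and "vspace U" and "vspace Z" and "h \<in> carrier X" and "trilinear_on U f"
  shows "\<phi> (sw3 X h f) = sw3 X h (\<lambda>u v w. \<phi> (f u v w))"
proof -
  have "\<phi> (sw3 X h f) = sw2 X h (\<lambda>k h3. \<phi> (sw2 X k (\<lambda>h1 h2. f h1 h2 h3)))"
    unfolding sw3_def by (rule linear_sw2[OF assms(1-4) bilinear_on_sw3[OF assms(2,5)]])
  also have "\<dots> = sw3 X h (\<lambda>u v w. \<phi> (f u v w))"
    unfolding sw3_def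
    by (rule sw2_cong, rule linear_sw2[OF assms(1-3) _ bilinear_on_trilinear[OF assms(5)]])
  finally show ?thesis .
qed

lemma sw3_sum:
  assumes "vspace U" and "h \<in> carrier X" and "\<And>i. i \<in> I \<Longrightarrow> trilinear_on U (f i)"
  shows "sw3 X h (\<lambda>u v w. \<Sum>i\<in>I. f i u v w) = (\<Sum>i\<in>I. sw3 X h (f i))"
proof -
  have "sw3 X h (\<lambda>u v w. \<Sum>i\<in>I. f i u v w) = sw2 X h (\<lambda>k h3. \<Sum>i\<in>I. sw2 X k (\<lambda>h1 h2. f i h1 h2 h3))"
    unfolding sw3_def by (intro sw2_cong sw2_sum[OF assms(1)] bilinear_on_trilinear[OF assms(3)])
  also have "\<dots> = (\<Sum>i\<in>I. sw3 X h (f i))"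
    unfolding sw3_def by (intro sw2_sum[OF assms(1,2)] bilinear_on_sw3[OF assms(1,3)])
  finally show ?thesis .
qed

end

lemma sw3_sw3_swap:
  assumes X: "bialgebra_data X" and Y: "bialgebra_data Y" and U: "vspace U"
    and h: "h \<in> carrier X" and k: "k \<in> carrier Y"
    and f: "\<And>x y z. x \<in> carrier Y \<Longrightarrow> y \<in> carrier Y \<Longrightarrow> z \<in> carrier Y \<Longrightarrow>
      bialgebra_data.trilinear_on X U (\<lambda>u v w. f u v w x y z)"
    and g: "\<And>u v w. u \<in> carrier X \<Longrightarrow> v \<in> carrier X \<Longrightarrow> w \<in> carrier X \<Longrightarrow>
      bialgebra_data.trilinear_on Y U (f u v w)"
  shows "sw3 X h (\<lambda>u v w. sw3 Y k (f u v w)) = sw3 Y k (\<lambda>x y z. sw3 X h (\<lambda>u v w. f u v w x y z))"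
proof -
  interpret X: bialgebra_data X by fact
  interpret Y: bialgebra_data Y by fact
  note f' = X.trilinear_onD[OF f] and g' = Y.trilinear_onD[OF g]
  note rules = X.multilinear Y.structure_linear U
  have swap: "sw3 X h (\<lambda>u v w. sw2 Y k (F u v w)) = sw2 Y k (\<lambda>x y. sw3 X h (\<lambda>u v w. F u v w x y))"
    if k: "k \<in> carrier Y"
      and F: "\<And>x y. x \<in> carrier Y \<Longrightarrow> y \<in> carrier Y \<Longrightarrow> X.trilinear_on U (\<lambda>u v w. F u v w x y)"
      and G: "\<And>u v w. u \<in> carrier X \<Longrightarrow> v \<in> carrier X \<Longrightarrow> w \<in> carrier X \<Longrightarrow> bilinear_on Y Y U (F u v w)"
    for k and F
  proof -
    note F' = X.trilinear_onD[OF F]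
    note G' = bilinear_on_left[OF G] bilinear_on_right[OF G]
    have "sw3 X h (\<lambda>u v w. sw2 Y k (F u v w)) =
        sw2 X h (\<lambda>p w. sw2 Y k (\<lambda>x y. sw2 X p (\<lambda>u v. F u v w x y)))"
      unfolding sw3_def
      by (rule X.sw2_cong, rule sw2_sw2_swap[OF X Y U _ k])
        (assumption | (intro rules F' G'; assumption))+
    also have "\<dots> = sw2 Y k (\<lambda>x y. sw3 X h (\<lambda>u v w. F u v w x y))"
      unfolding sw3_def
      by (rule sw2_sw2_swap[OF X Y U h k])
        (assumption | (intro rules F' G'; assumption))+
    finally show ?thesis .
  qed
  have "sw3 X h (\<lambda>u v w. sw3 Y k (f u v w)) =
      sw2 Y k (\<lambda>p z. sw3 X h (\<lambda>u v w. sw2 Y p (\<lambda>x y. f u v w x y z)))"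
    unfolding sw3_def[of Y]
    by (rule swap[OF k])
      (assumption | (intro rules f' g' k X.trilinear_onI; assumption))+
  also have "\<dots> = sw2 Y k (\<lambda>p z. sw2 Y p (\<lambda>x y. sw3 X h (\<lambda>u v w. f u v w x y z)))"
    by (rule Y.sw2_cong, rule swap)
      (assumption | (intro rules f' g' k X.trilinear_onI; assumption))+
  finally show ?thesis
    unfolding sw3_def[of Y] .
qed

context bialgebra_data
begin

interpretation D: bialgebra_data "dual"
  by (rule bialgebra_data_dual)

section \<open>Translation of linear forms and twisted products\<close>

text \<open>
  The form \<open>z \<mapsto> \<langle>\<alpha>, x z y\<rangle>\<close>, cut off outside the carrier like every element of the dual.
\<close>

definition translate :: "'a \<Rightarrow> 'a \<Rightarrow> ('a \<Rightarrow> 'f) \<Rightarrow> 'a \<Rightarrow> 'f" where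
  "translate x y \<alpha> = restrict0 X (\<lambda>z. \<langle>\<alpha>, x \<cdot> z \<cdot> y\<rangle>)"

lemma translate_pairing: "z \<in> carrier X \<Longrightarrow> \<langle>translate x y \<alpha>, z\<rangle> = \<langle>\<alpha>, x \<cdot> z \<cdot> y\<rangle>"
  by (simp add: translate_def restrict0_def pairing_def)

lemma translate_closed:
  assumes "x \<in> carrier X" and "y \<in> carrier X" and "\<alpha> \<in> carrier dual"
  shows "translate x y \<alpha> \<in> carrier dual"
proof -
  have "linear_on X field_vs (\<lambda>z. \<langle>\<alpha>, x \<cdot> z \<cdot> y\<rangle>)"
    using assms by (intro multilinear)
  then have "linear_on X field_vs (\<lambda>z. \<langle>translate x y \<alpha>, z\<rangle>)"
    by (rule linear_on_cong[OF vspace_axioms]) (rule translate_pairing)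
  then show ?thesis
    by (simp add: carrier_dual_hopf dual_carrier_def pairing_def) (simp add: translate_def restrict0_def)
qed

lemma linear_on_translate_left:
  assumes "vspace Z" and "linear_on Z X f" and "y \<in> carrier X" and "\<alpha> \<in> carrier dual"
  shows "linear_on Z dual (\<lambda>z. translate (f z) y \<alpha>)"
proof (rule linear_on_dualI)
  fix h assume "h \<in> carrier X"
  then show "linear_on Z field_vs (\<lambda>z. \<langle>translate (f z) y \<alpha>, h\<rangle>)"
    using assms by (simp only: translate_pairing) (intro multilinear)
qed (use assms in \<open>auto intro: translate_closed linear_on_mem\<close>)

lemma linear_on_translate_right:
  assumes "vspace Z" and "linear_on Z X f" and "x \<in> carrier X" and "\<alpha> \<in> carrier dual"
  shows "linear_on Z dual (\<lambda>z. translate x (f z) \<alpha>)"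
proof (rule linear_on_dualI)
  fix h assume "h \<in> carrier X"
  then show "linear_on Z field_vs (\<lambda>z. \<langle>translate x (f z) \<alpha>, h\<rangle>)"
    using assms by (simp only: translate_pairing) (intro multilinear)
qed (use assms in \<open>auto intro: translate_closed linear_on_mem\<close>)

lemma linear_on_translate:
  assumes "vspace Z" and "linear_on Z dual g" and "x \<in> carrier X" and "y \<in> carrier X"
  shows "linear_on Z dual (\<lambda>z. translate x y (g z))"
proof (rule linear_on_dualI)
  fix h assume "h \<in> carrier X"
  then show "linear_on Z field_vs (\<lambda>z. \<langle>translate x y (g z), h\<rangle>)"
    using assms by (simp only: translate_pairing) (intro multilinear)
qed (use assms in \<open>auto intro: translate_closed linear_on_mem\<close>)

text \<open>
  Pairing the outer legs of \<open>\<alpha>\<^sub>1 \<otimes> \<alpha>\<^sub>2 \<otimes> \<alpha>\<^sub>3\<close> with \<open>x\<close> and \<open>y\<close> leaves the translate of \<open>\<alpha>\<close> in the middle.  The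
  product of the Drinfel'd double pairs exactly these two legs, so this rids it of the coproduct of a form.
\<close>

lemma dual_sw3_translate:
  assumes U: "vspace U" and G: "linear_on dual U G"
    and \<alpha>: "\<alpha> \<in> carrier dual" and x: "x \<in> carrier X" and y: "y \<in> carrier X"
  shows "sw3 dual \<alpha> (\<lambda>\<alpha>1 \<alpha>2 \<alpha>3. smul U (\<langle>\<alpha>3, y\<rangle> * \<langle>\<alpha>1, x\<rangle>) (G \<alpha>2)) = G (translate x y \<alpha>)"
proof -
  obtain C where "based_bialgebra_data X C" by (rule obtain_based)
  then interpret based_bialgebra_data X C .
  interpret U: vspace U by fact
  have G_expand: "G \<beta> = (\<Sum>c\<in>C. smul U \<langle>\<beta>, c\<rangle> (G (coord c)))" if "\<beta> \<in> carrier dual" for \<beta>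
    using linear_on_lincomb[OF vspace_dual' G, of C coord "\<lambda>c. \<langle>\<beta>, c\<rangle>"] dual_expand[OF that]
    by (simp add: coord_closed)
  have Gc: "G (coord c) \<in> carrier U" if "c \<in> C" for c
    by (rule linear_on_mem[OF G coord_closed[OF that]])
  have tri: "D.trilinear_on field_vs (\<lambda>\<alpha>1 \<alpha>2 \<alpha>3. \<langle>\<alpha>1, x\<rangle> * \<langle>\<alpha>2, c\<rangle> * \<langle>\<alpha>3, y\<rangle>)" if "c \<in> C" for c
    using x y basis_closed[OF that] by (intro multilinear D.trilinear_onI)
  have lin: "linear_on field_vs U (\<lambda>r. smul U r (G (coord c)))" if "c \<in> C" for c
    using that by (intro multilinear U Gc)
  have "sw3 dual \<alpha> (\<lambda>\<alpha>1 \<alpha>2 \<alpha>3. smul U (\<langle>\<alpha>3, y\<rangle> * \<langle>\<alpha>1, x\<rangle>) (G \<alpha>2)) =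
      sw3 dual \<alpha> (\<lambda>\<alpha>1 \<alpha>2 \<alpha>3. \<Sum>c\<in>C. smul U (\<langle>\<alpha>1, x\<rangle> * \<langle>\<alpha>2, c\<rangle> * \<langle>\<alpha>3, y\<rangle>) (G (coord c)))"
    by (rule D.sw3_cong) (subst G_expand, assumption, simp add: U.amb.scale_sum_right[simplified] mult_ac)
  also have "\<dots> = (\<Sum>c\<in>C. sw3 dual \<alpha> (\<lambda>\<alpha>1 \<alpha>2 \<alpha>3. smul U (\<langle>\<alpha>1, x\<rangle> * \<langle>\<alpha>2, c\<rangle> * \<langle>\<alpha>3, y\<rangle>) (G (coord c))))"
    by (rule D.sw3_sum[OF U \<alpha>]) (rule D.trilinear_on_compose[OF tri lin])
  also have "\<dots> = (\<Sum>c\<in>C. smul U (sw3 dual \<alpha> (\<lambda>\<alpha>1 \<alpha>2 \<alpha>3. \<langle>\<alpha>1, x\<rangle> * \<langle>\<alpha>2, c\<rangle> * \<langle>\<alpha>3, y\<rangle>)) (G (coord c)))"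
    by (intro sum.cong refl D.linear_sw3[OF lin vspace_field U \<alpha> tri, symmetric])
  also have "\<dots> = (\<Sum>c\<in>C. smul U \<langle>translate x y \<alpha>, c\<rangle> (G (coord c)))"
    by (simp add: dual_sw3 \<alpha> x y basis_closed translate_pairing)
  also have "\<dots> = G (translate x y \<alpha>)"
    by (rule G_expand[symmetric]) (rule translate_closed[OF x y \<alpha>])
  finally show ?thesis .
qed

lemma twisted_dual_simps [simp]:
  "carrier (twisted_dual X R) = carrier dual"
  "smul (twisted_dual X R) = fun_smul"
  "one (twisted_dual X R) = \<one>\<^bsub>dual\<^esub>"
  by (simp_all add: twisted_dual_def)

context
  fixes I :: "'i set" and r r' :: "'i \<Rightarrow> 'a" and R
  assumes r: "\<And>i. i \<in> I \<Longrightarrow> r i \<in> carrier X" and r': "\<And>i. i \<in> I \<Longrightarrow> r' i \<in> carrier X"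
    and R: "R = (\<Sum>i\<in>I. r i \<otimes>[X,X] r' i)"
begin

lemma pair2_sum:
  assumes "\<alpha> \<in> carrier dual" and "\<beta> \<in> carrier dual"
  shows "pair2 X \<alpha> \<beta> R = (\<Sum>i\<in>I. \<langle>\<alpha>, r i\<rangle> * \<langle>\<beta>, r' i\<rangle>)"
proof -
  have bil: "bilinear_on X X field_vs (\<lambda>x y. \<langle>\<alpha>, x\<rangle> * \<langle>\<beta>, y\<rangle>)"
    using assms by (intro multilinear)
  have "pair2 X \<alpha> \<beta> R = sweedler X X R (\<lambda>x y. \<langle>\<alpha>, x\<rangle> * \<langle>\<beta>, y\<rangle>)"
    by (simp add: pair2_def pairing_def)
  also have "\<dots> = (\<Sum>i\<in>I. sweedler X X (r i \<otimes>[X,X] r' i) (\<lambda>x y. \<langle>\<alpha>, x\<rangle> * \<langle>\<beta>, y\<rangle>))"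
    unfolding R
    by (rule linear_on_sum[OF vspace_tensor linear_on_sweedler_tensor[OF vspace_axioms vspace_field bil]])
      (intro multilinear r r')
  also have "\<dots> = (\<Sum>i\<in>I. \<langle>\<alpha>, r i\<rangle> * \<langle>\<beta>, r' i\<rangle>)"
    by (intro sum.cong refl sweedler_pure[OF vspace_field bil] r r')
  finally show ?thesis .
qed

lemma twisted_mult:
  assumes "\<alpha> \<in> carrier dual" and "\<beta> \<in> carrier dual"
  shows "mult (twisted_dual X R) \<beta> \<alpha> = sw2 dual \<alpha> (\<lambda>\<alpha>1 \<alpha>2. sw2 dual \<beta> (\<lambda>\<beta>1 \<beta>2.
      fun_smul (\<Sum>i\<in>I. \<langle>\<alpha>1, r i\<rangle> * \<langle>\<beta>1, r' i\<rangle>) (\<alpha>2 \<cdot>\<^bsub>dual\<^esub> \<beta>2)))"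
proof -
  have "mult (twisted_dual X R) \<beta> \<alpha> = sw2 dual \<alpha> (\<lambda>\<alpha>1 \<alpha>2. sw2 dual \<beta> (\<lambda>\<beta>1 \<beta>2.
      fun_smul (pair2 X \<alpha>1 \<beta>1 R) (\<alpha>2 \<cdot>\<^bsub>dual\<^esub> \<beta>2)))"
    by (simp add: twisted_dual_def)
  then show ?thesis
    by (simp add: pair2_sum cong: D.sw2_cong)
qed

lemma twisted_mult_closed:
  assumes "\<alpha> \<in> carrier dual" and "\<beta> \<in> carrier dual"
  shows "mult (twisted_dual X R) \<beta> \<alpha> \<in> carrier dual"
  unfolding twisted_mult[OF assms]
  using assms by (intro multilinear D.structure_linear r r')

text \<open>
  The coproducts of \<open>\<alpha>\<close> and \<open>\<beta>\<close> are dual to the product of \<open>X\<close>, so the value at \<open>k\<close> is that of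
  \<open>\<alpha> \<otimes> \<beta>\<close> at \<open>R \<Delta>(k)\<close>.
\<close>

lemma twisted_mult_pairing:
  assumes \<alpha>: "\<alpha> \<in> carrier dual" and \<beta>: "\<beta> \<in> carrier dual" and k: "k \<in> carrier X"
  shows "\<langle>mult (twisted_dual X R) \<beta> \<alpha>, k\<rangle> = (\<Sum>i\<in>I. sw2 X k (\<lambda>k1 k2. \<langle>\<alpha>, r i \<cdot> k1\<rangle> * \<langle>\<beta>, r' i \<cdot> k2\<rangle>))"
proof -
  let ?D = "dual"
  let ?q = "\<lambda>\<alpha>1 \<beta>1. \<Sum>i\<in>I. \<langle>\<alpha>1, r i\<rangle> * \<langle>\<beta>1, r' i\<rangle>"
  let ?G = "\<lambda>\<alpha>1 \<alpha>2 \<beta>1 \<beta>2 k1 k2. ?q \<alpha>1 \<beta>1 * (\<langle>\<alpha>2, k1\<rangle> * \<langle>\<beta>2, k2\<rangle>)"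
  note rules = multilinear D.structure_linear r r' k \<alpha> \<beta>
  have ev: "linear_on ?D field_vs (\<lambda>\<gamma>. \<langle>\<gamma>, k\<rangle>)" by (intro rules)
  have "\<langle>mult (twisted_dual X R) \<beta> \<alpha>, k\<rangle> =
      sw2 ?D \<alpha> (\<lambda>\<alpha>1 \<alpha>2. \<langle>sw2 ?D \<beta> (\<lambda>\<beta>1 \<beta>2. fun_smul (?q \<alpha>1 \<beta>1) (\<alpha>2 \<cdot>\<^bsub>?D\<^esub> \<beta>2)), k\<rangle>)"
    unfolding twisted_mult[OF \<alpha> \<beta>]
    by (rule D.linear_sw2[OF ev vspace_dual' vspace_field \<alpha>])
      (assumption | (intro rules; assumption))+
  also have "\<dots> = sw2 ?D \<alpha> (\<lambda>\<alpha>1 \<alpha>2. sw2 ?D \<beta> (\<lambda>\<beta>1 \<beta>2. \<langle>fun_smul (?q \<alpha>1 \<beta>1) (\<alpha>2 \<cdot>\<^bsub>?D\<^esub> \<beta>2), k\<rangle>))"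
    by (rule D.sw2_cong, rule D.linear_sw2[OF ev vspace_dual' vspace_field \<beta>])
      (assumption | (intro rules; assumption))+
  also have "\<dots> = sw2 ?D \<alpha> (\<lambda>\<alpha>1 \<alpha>2. sw2 ?D \<beta> (\<lambda>\<beta>1 \<beta>2. ?q \<alpha>1 \<beta>1 * sw2 X k (\<lambda>k1 k2. \<langle>\<alpha>2, k1\<rangle> * \<langle>\<beta>2, k2\<rangle>)))"
    by (intro D.sw2_cong) (simp add: dual_mult_apply[OF k, symmetric] linear_on_smul[OF ev, simplified] dual_mult_closed)
  also have "\<dots> = sw2 ?D \<alpha> (\<lambda>\<alpha>1 \<alpha>2. sw2 ?D \<beta> (\<lambda>\<beta>1 \<beta>2. sw2 X k (\<lambda>k1 k2. ?G \<alpha>1 \<alpha>2 \<beta>1 \<beta>2 k1 k2)))"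
    by (intro D.sw2_cong linear_sw2[OF linear_on_timesR[OF linear_on_id] vspace_field vspace_field k])
      (assumption | (intro rules; assumption))+
  also have "\<dots> = sw2 ?D \<alpha> (\<lambda>\<alpha>1 \<alpha>2. sw2 X k (\<lambda>k1 k2. sw2 ?D \<beta> (\<lambda>\<beta>1 \<beta>2. ?G \<alpha>1 \<alpha>2 \<beta>1 \<beta>2 k1 k2)))"
    by (rule D.sw2_cong, rule dual_sw2_swap[OF vspace_field \<beta> k])
      (assumption | (intro rules; assumption))+
  also have "\<dots> = sw2 X k (\<lambda>k1 k2. sw2 ?D \<alpha> (\<lambda>\<alpha>1 \<alpha>2. sw2 ?D \<beta> (\<lambda>\<beta>1 \<beta>2. ?G \<alpha>1 \<alpha>2 \<beta>1 \<beta>2 k1 k2)))"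
    by (rule dual_sw2_swap[OF vspace_field \<alpha> k])
      (assumption | (intro rules; assumption))+
  also have "\<dots> = sw2 X k (\<lambda>k1 k2. \<Sum>i\<in>I. \<langle>\<alpha>, r i \<cdot> k1\<rangle> * \<langle>\<beta>, r' i \<cdot> k2\<rangle>)"
  proof (rule sw2_cong)
    fix k1 k2 assume k1: "k1 \<in> carrier X" and k2: "k2 \<in> carrier X"
    have "sw2 ?D \<beta> (\<lambda>\<beta>1 \<beta>2. ?G \<alpha>1 \<alpha>2 \<beta>1 \<beta>2 k1 k2) =
        (\<Sum>i\<in>I. \<langle>\<alpha>1, r i\<rangle> * \<langle>\<alpha>2, k1\<rangle> * \<langle>\<beta>, r' i \<cdot> k2\<rangle>)" for \<alpha>1 \<alpha>2
    proof -
      have "sw2 ?D \<beta> (\<lambda>\<beta>1 \<beta>2. ?G \<alpha>1 \<alpha>2 \<beta>1 \<beta>2 k1 k2) =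
          sw2 ?D \<beta> (\<lambda>\<beta>1 \<beta>2. \<Sum>i\<in>I. \<langle>\<alpha>1, r i\<rangle> * \<langle>\<alpha>2, k1\<rangle> * (\<langle>\<beta>1, r' i\<rangle> * \<langle>\<beta>2, k2\<rangle>))"
        by (simp add: sum_distrib_right sum_distrib_left mult_ac)
      also have "\<dots> = (\<Sum>i\<in>I. sw2 ?D \<beta> (\<lambda>\<beta>1 \<beta>2. \<langle>\<alpha>1, r i\<rangle> * \<langle>\<alpha>2, k1\<rangle> * (\<langle>\<beta>1, r' i\<rangle> * \<langle>\<beta>2, k2\<rangle>)))"
        using k2 by (intro D.sw2_sum[OF vspace_field] rules)
      also have "\<dots> = (\<Sum>i\<in>I. \<langle>\<alpha>1, r i\<rangle> * \<langle>\<alpha>2, k1\<rangle> * sw2 ?D \<beta> (\<lambda>\<beta>1 \<beta>2. \<langle>\<beta>1, r' i\<rangle> * \<langle>\<beta>2, k2\<rangle>))"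
        using k2 by (intro sum.cong refl
            D.linear_sw2[OF linear_on_timesR[OF linear_on_id] vspace_field vspace_field \<beta>, symmetric] rules)
      finally show ?thesis using k2 by (simp add: dual_sw2 \<beta> r')
    qed
    then have "sw2 ?D \<alpha> (\<lambda>\<alpha>1 \<alpha>2. sw2 ?D \<beta> (\<lambda>\<beta>1 \<beta>2. ?G \<alpha>1 \<alpha>2 \<beta>1 \<beta>2 k1 k2)) =
        sw2 ?D \<alpha> (\<lambda>\<alpha>1 \<alpha>2. \<Sum>i\<in>I. \<langle>\<alpha>1, r i\<rangle> * \<langle>\<alpha>2, k1\<rangle> * \<langle>\<beta>, r' i \<cdot> k2\<rangle>)" by simp
    also have "\<dots> = (\<Sum>i\<in>I. sw2 ?D \<alpha> (\<lambda>\<alpha>1 \<alpha>2. \<langle>\<alpha>1, r i\<rangle> * \<langle>\<alpha>2, k1\<rangle> * \<langle>\<beta>, r' i \<cdot> k2\<rangle>))"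
      using k1 by (intro D.sw2_sum[OF vspace_field] rules)
    also have "\<dots> = (\<Sum>i\<in>I. sw2 ?D \<alpha> (\<lambda>\<alpha>1 \<alpha>2. \<langle>\<alpha>1, r i\<rangle> * \<langle>\<alpha>2, k1\<rangle>) * \<langle>\<beta>, r' i \<cdot> k2\<rangle>)"
      using k1 by (intro sum.cong refl
          D.linear_sw2[OF linear_on_timesL[OF linear_on_id] vspace_field vspace_field \<alpha>, symmetric] rules)
    finally show "sw2 ?D \<alpha> (\<lambda>\<alpha>1 \<alpha>2. sw2 ?D \<beta> (\<lambda>\<beta>1 \<beta>2. ?G \<alpha>1 \<alpha>2 \<beta>1 \<beta>2 k1 k2)) =
        (\<Sum>i\<in>I. \<langle>\<alpha>, r i \<cdot> k1\<rangle> * \<langle>\<beta>, r' i \<cdot> k2\<rangle>)"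
      using k1 by (simp add: dual_sw2 \<alpha> r)
  qed
  also have "\<dots> = (\<Sum>i\<in>I. sw2 X k (\<lambda>k1 k2. \<langle>\<alpha>, r i \<cdot> k1\<rangle> * \<langle>\<beta>, r' i \<cdot> k2\<rangle>))"
    by (intro sw2_sum[OF vspace_field] rules)
  finally show ?thesis .
qed

end

end

section \<open>The convolution algebra\<close>

locale findim_hopf = hopf_algebra H
  for H :: "('f::field, 'a::ab_group_add, 'm) hopf_scheme" (structure) +
  assumes findim: "finite_dim H"

sublocale findim_hopf \<subseteq> bialgebra_data H
  by unfold_locales (rule mult_bilinear comult_linear findim)+

context findim_hopf
begin

text \<open>
  The axiom is an equation in \<open>H \<otimes> (H \<otimes> H)\<close>; a trilinear \<open>f\<close> extends to a linear map \<open>L\<close> on that space,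
  and applying \<open>L\<close> to both sides gives the claim.
\<close>

lemma sw2_coassoc:
  assumes U: "vspace U" and h: "h \<in> carrier H"
    and 1: "\<And>x y. x \<in> carrier H \<Longrightarrow> y \<in> carrier H \<Longrightarrow> linear_on H U (\<lambda>v. f v x y)"
    and 2: "\<And>x y. x \<in> carrier H \<Longrightarrow> y \<in> carrier H \<Longrightarrow> linear_on H U (\<lambda>v. f x v y)"
    and 3: "\<And>x y. x \<in> carrier H \<Longrightarrow> y \<in> carrier H \<Longrightarrow> linear_on H U (\<lambda>v. f x y v)"
  shows "sw2 H h (\<lambda>k h3. sw2 H k (\<lambda>h1 h2. f h1 h2 h3)) = sw2 H h (\<lambda>h1 k. sw2 H k (\<lambda>h2 h3. f h1 h2 h3))"
proof -
  let ?T = "tensor_vs H H" and ?TT = "tensor_vs H (tensor_vs H H)"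
  define L where "L t = sweedler H ?T t (\<lambda>h1 s. sweedler H H s (\<lambda>h2 h3. f h1 h2 h3))" for t
  have bil: "bilinear_on H ?T U (\<lambda>h1 s. sweedler H H s (\<lambda>h2 h3. f h1 h2 h3))"
    by (intro multilinear U 1 2 3)
  have L: "linear_on ?TT U L"
    unfolding L_def by (rule linear_on_sweedler_tensor[OF vspace_axioms U bil])
  have L1: "L (h1 \<otimes>[H, ?T] s) = sweedler H H s (\<lambda>h2 h3. f h1 h2 h3)"
    if "h1 \<in> carrier H" "s \<in> carrier ?T" for h1 s
    unfolding L_def by (rule sweedler_pure[OF U bil that])
  have L2: "L (h1 \<otimes>[H, ?T] (h2 \<otimes>[H,H] h3)) = f h1 h2 h3"
    if "h1 \<in> carrier H" "h2 \<in> carrier H" "h3 \<in> carrier H" for h1 h2 h3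
    using that by (simp add: L1 pure_tensor_mem) (rule sweedler_pure[OF U], intro multilinear 2 3)
  have "L (sw3 H h (\<lambda>h1 h2 h3. h1 \<otimes>[H, ?T] (h2 \<otimes>[H,H] h3))) =
      sw2 H h (\<lambda>k h3. L (sw2 H k (\<lambda>h1 h2. h1 \<otimes>[H, ?T] (h2 \<otimes>[H,H] h3))))"
    unfolding sw3_def
    by (rule linear_sw2[OF L vspace_tensor U h]) (intro multilinear)
  also have "\<dots> = sw2 H h (\<lambda>k h3. sw2 H k (\<lambda>h1 h2. f h1 h2 h3))"
  proof (rule sw2_cong)
    fix k h3 assume k: "k \<in> carrier H" and h3: "h3 \<in> carrier H"
    have "L (sw2 H k (\<lambda>h1 h2. h1 \<otimes>[H, ?T] (h2 \<otimes>[H,H] h3))) =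
        sw2 H k (\<lambda>h1 h2. L (h1 \<otimes>[H, ?T] (h2 \<otimes>[H,H] h3)))"
      using h3 by (intro linear_sw2[OF L vspace_tensor U k] multilinear)
    also have "\<dots> = sw2 H k (\<lambda>h1 h2. f h1 h2 h3)"
      by (rule sw2_cong) (simp add: L2 h3)
    finally show "L (sw2 H k (\<lambda>h1 h2. h1 \<otimes>[H, ?T] (h2 \<otimes>[H,H] h3))) = sw2 H k (\<lambda>h1 h2. f h1 h2 h3)" .
  qed
  finally have left: "L (sw3 H h (\<lambda>h1 h2 h3. h1 \<otimes>[H, ?T] (h2 \<otimes>[H,H] h3))) =
      sw2 H h (\<lambda>k h3. sw2 H k (\<lambda>h1 h2. f h1 h2 h3))" .
  have "L (sw2 H h (\<lambda>h1 k. h1 \<otimes>[H, ?T] comult H k)) = sw2 H h (\<lambda>h1 k. L (h1 \<otimes>[H, ?T] comult H k))"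
    by (rule linear_sw2[OF L vspace_tensor U h]) (intro multilinear)
  also have "\<dots> = sw2 H h (\<lambda>h1 k. sw2 H k (\<lambda>h2 h3. f h1 h2 h3))"
    by (rule sw2_cong) (simp add: L1 comult_closed sw2_def[of H _ "\<lambda>h2. f _ h2"])
  finally show ?thesis
    using left coassoc[OF h] by simp
qed

lemma sw2_counit_left:
  assumes "vspace U" and "linear_on H U g" and "h \<in> carrier H"
  shows "sw2 H h (\<lambda>h1 h2. smul U (counit H h1) (g h2)) = g h"
proof -
  have "g (sw2 H h (\<lambda>h1 h2. smul H (counit H h1) h2)) = sw2 H h (\<lambda>h1 h2. g (smul H (counit H h1) h2))"
    by (intro linear_sw2[OF assms(2) vspace_axioms assms(1,3)] multilinear counit_linear)
  also have "\<dots> = sw2 H h (\<lambda>h1 h2. smul U (counit H h1) (g h2))"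
    by (rule sw2_cong) (rule linear_on_smul[OF assms(2)])
  finally show ?thesis using counit_left[OF assms(3)] by simp
qed

lemma sw2_counit_right:
  assumes "vspace U" and "linear_on H U g" and "h \<in> carrier H"
  shows "sw2 H h (\<lambda>h1 h2. smul U (counit H h2) (g h1)) = g h"
proof -
  have "g (sw2 H h (\<lambda>h1 h2. smul H (counit H h2) h1)) = sw2 H h (\<lambda>h1 h2. g (smul H (counit H h2) h1))"
    by (intro linear_sw2[OF assms(2) vspace_axioms assms(1,3)] multilinear counit_linear)
  also have "\<dots> = sw2 H h (\<lambda>h1 h2. smul U (counit H h2) (g h1))"
    by (rule sw2_cong) (rule linear_on_smul[OF assms(2)])
  finally show ?thesis using counit_right[OF assms(3)] by simp
qed

end

text \<open>
  The linear endomorphisms of \<open>H\<close> under convolution.  The product \<open>\<diamondop>\<close> on the target will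
  be that of \<open>H\<close> or its opposite.
\<close>

locale convolution = findim_hopf H
  for H :: "('f::field, 'a::ab_group_add, 'm) hopf_scheme" (structure) +
  fixes m :: "'a \<Rightarrow> 'a \<Rightarrow> 'a" (infixl "\<diamondop>" 70)
  assumes m_bilinear: "bilinear_on H H H (\<lambda>a b. a \<diamondop> b)"
    and m_assoc: "a \<in> carrier H \<Longrightarrow> b \<in> carrier H \<Longrightarrow> c \<in> carrier H \<Longrightarrow> (a \<diamondop> b) \<diamondop> c = a \<diamondop> (b \<diamondop> c)"
    and m_one_left: "a \<in> carrier H \<Longrightarrow> \<one> \<diamondop> a = a"
    and m_one_right: "a \<in> carrier H \<Longrightarrow> a \<diamondop> \<one> = a"
begin

definition conv :: "('a \<Rightarrow> 'a) \<Rightarrow> ('a \<Rightarrow> 'a) \<Rightarrow> 'a \<Rightarrow> 'a" (infixl "\<star>" 70) where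
  "f \<star> g = (\<lambda>h. sw2 H h (\<lambda>h1 h2. f h1 \<diamondop> g h2))"

definition conv_inverse :: "('a \<Rightarrow> 'a) \<Rightarrow> ('a \<Rightarrow> 'a) \<Rightarrow> bool" where
  "conv_inverse p q \<longleftrightarrow> linear_on H H p \<and> linear_on H H q \<and>
     (\<forall>h\<in>carrier H. (p \<star> q) h = smul H (counit H h) \<one>)"

lemma m_closed: "a \<in> carrier H \<Longrightarrow> b \<in> carrier H \<Longrightarrow> a \<diamondop> b \<in> carrier H"
  by (rule bilinear_on_mem[OF m_bilinear])

lemma linear_on_mL: "linear_on Z H f \<Longrightarrow> b \<in> carrier H \<Longrightarrow> linear_on Z H (\<lambda>z. f z \<diamondop> b)"
  by (rule linear_on_compose[OF _ bilinear_on_left[OF m_bilinear]])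

lemma linear_on_mR: "linear_on Z H f \<Longrightarrow> a \<in> carrier H \<Longrightarrow> linear_on Z H (\<lambda>z. a \<diamondop> f z)"
  by (rule linear_on_compose[OF _ bilinear_on_right[OF m_bilinear]])

lemmas m_multilinear = multilinear m_closed linear_on_mL linear_on_mR

lemma conv_linear:
  assumes "linear_on H H f" and "linear_on H H g"
  shows "linear_on H H (f \<star> g)"
  unfolding conv_def
  by (intro m_multilinear assms linear_on_mem[OF assms(1)] linear_on_mem[OF assms(2)])

lemma conv_assoc:
  assumes f: "linear_on H H f" and g: "linear_on H H g" and k: "linear_on H H k" and h: "h \<in> carrier H"
  shows "((f \<star> g) \<star> k) h = (f \<star> (g \<star> k)) h"
proof -
  note mem = linear_on_mem[OF f] linear_on_mem[OF g] linear_on_mem[OF k]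
  have "((f \<star> g) \<star> k) h = sw2 H h (\<lambda>x h3. sw2 H x (\<lambda>h1 h2. (f h1 \<diamondop> g h2) \<diamondop> k h3))"
    unfolding conv_def
    by (rule sw2_cong, rule linear_sw2[OF linear_on_mL[OF linear_on_id]])
      (assumption | (intro m_multilinear mem f g k; assumption))+
  also have "\<dots> = sw2 H h (\<lambda>h1 x. sw2 H x (\<lambda>h2 h3. (f h1 \<diamondop> g h2) \<diamondop> k h3))"
    by (rule sw2_coassoc[where U=H]) (assumption | (intro m_multilinear mem f g k h; assumption))+
  also have "\<dots> = sw2 H h (\<lambda>h1 x. sw2 H x (\<lambda>h2 h3. f h1 \<diamondop> (g h2 \<diamondop> k h3)))"
    by (intro sw2_cong m_assoc mem)
  also have "\<dots> = (f \<star> (g \<star> k)) h"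
    unfolding conv_def
    by (rule sw2_cong, rule linear_sw2[OF linear_on_mR[OF linear_on_id], symmetric])
      (assumption | (intro m_multilinear mem f g k; assumption))+
  finally show ?thesis .
qed

lemma conv_cong:
  assumes "\<And>x. x \<in> carrier H \<Longrightarrow> f x = f' x" and "\<And>x. x \<in> carrier H \<Longrightarrow> g x = g' x"
  shows "(f \<star> g) h = (f' \<star> g') h"
  unfolding conv_def by (intro sw2_cong) (simp add: assms)

lemma conv_zero:
  assumes "linear_on H H g" and "h \<in> carrier H" and "\<And>x. x \<in> carrier H \<Longrightarrow> f x = 0"
  shows "(f \<star> g) h = 0" and "(g \<star> f) h = 0"
proof -
  have zero: "linear_on H H (\<lambda>x. 0)" by (simp add: linear_on_def zero_closed)
  have "0 \<diamondop> x = 0" "x \<diamondop> 0 = 0" if "x \<in> carrier H" for x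
    using linear_on_zero[OF vspace_axioms bilinear_on_left[OF m_bilinear that]]
      linear_on_zero[OF vspace_axioms bilinear_on_right[OF m_bilinear that]] by simp_all
  then have "(f \<star> g) h = sw2 H h (\<lambda>_ _. 0)" "(g \<star> f) h = sw2 H h (\<lambda>_ _. 0)"
    unfolding conv_def by (auto intro!: sw2_cong simp: assms(3) linear_on_mem[OF assms(1)])
  moreover have "sw2 H h (\<lambda>_ _. 0) = (0 :: 'a)"
    using linear_sw2[OF zero vspace_axioms vspace_axioms assms(2) mult_bilinear] by simp
  ultimately show "(f \<star> g) h = 0" "(g \<star> f) h = 0" by simp_all
qed

lemma conv_counit_left:
  assumes "linear_on H H g" and "h \<in> carrier H"
  shows "((\<lambda>x. smul H (counit H x) \<one>) \<star> g) h = g h"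
proof -
  have "((\<lambda>x. smul H (counit H x) \<one>) \<star> g) h = sw2 H h (\<lambda>h1 h2. smul H (counit H h1) (g h2))"
    unfolding conv_def
    by (intro sw2_cong) (simp add: linear_on_smul[OF bilinear_on_left[OF m_bilinear]]
        linear_on_mem[OF assms(1)] one_closed m_one_left)
  then show ?thesis using sw2_counit_left[OF vspace_axioms assms] by simp
qed

lemma conv_counit_right:
  assumes "linear_on H H g" and "h \<in> carrier H"
  shows "(g \<star> (\<lambda>x. smul H (counit H x) \<one>)) h = g h"
proof -
  have "(g \<star> (\<lambda>x. smul H (counit H x) \<one>)) h = sw2 H h (\<lambda>h1 h2. smul H (counit H h2) (g h1))"
    unfolding conv_def
    by (intro sw2_cong) (simp add: linear_on_smul[OF bilinear_on_right[OF m_bilinear]]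
        linear_on_mem[OF assms(1)] one_closed m_one_right)
  then show ?thesis using sw2_counit_right[OF vspace_axioms assms] by simp
qed

lemma conv_cancel_right:
  assumes "conv_inverse p q" and "linear_on H H g" and "h \<in> carrier H"
  shows "((g \<star> p) \<star> q) h = g h"
proof -
  have "((g \<star> p) \<star> q) h = (g \<star> (p \<star> q)) h"
    using assms by (intro conv_assoc) (auto simp: conv_inverse_def)
  also have "\<dots> = (g \<star> (\<lambda>x. smul H (counit H x) \<one>)) h"
    using assms(1) by (intro conv_cong) (auto simp: conv_inverse_def)
  finally show ?thesis using conv_counit_right[OF assms(2,3)] by simp
qed

lemma conv_cancel_left:
  assumes "conv_inverse p q" and "linear_on H H g" and "h \<in> carrier H"
  shows "(p \<star> (q \<star> g)) h = g h"
proof -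
  have "(p \<star> (q \<star> g)) h = ((p \<star> q) \<star> g) h"
    using assms by (intro conv_assoc[symmetric]) (auto simp: conv_inverse_def)
  also have "\<dots> = ((\<lambda>x. smul H (counit H x) \<one>) \<star> g) h"
    using assms(1) by (intro conv_cong) (auto simp: conv_inverse_def)
  finally show ?thesis using conv_counit_left[OF assms(2,3)] by simp
qed

end

context convolution
begin

text \<open>
  If \<open>g\<close> is multiplicative from \<open>H\<close> to the product \<open>\<diamondop>\<close>, then \<open>g \<circ> S\<close> is the convolution inverse of
  \<open>g\<close>.  When \<open>p\<close> fixes \<open>g \<circ> S\<close>, both \<open>g\<close> and \<open>p \<circ> g\<close> are inverse to it, so \<open>p\<close> fixes \<open>g\<close>.
\<close>

lemma fix_antipode_descent:
  assumes g: "linear_on H H g" and g_one: "g \<one> = \<one>"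
    and g_mult: "\<And>x y. x \<in> carrier H \<Longrightarrow> y \<in> carrier H \<Longrightarrow> g (x \<cdot> y) = g x \<diamondop> g y"
    and p: "linear_on H H p" and p_one: "p \<one> = \<one>"
    and p_mult: "\<And>x y. x \<in> carrier H \<Longrightarrow> y \<in> carrier H \<Longrightarrow> p (x \<diamondop> y) = p x \<diamondop> p y"
    and fix_S: "\<And>h. h \<in> carrier H \<Longrightarrow> p (g (antipode H h)) = g (antipode H h)"
    and h: "h \<in> carrier H"
  shows "p (g h) = g h"
proof -
  let ?gS = "\<lambda>x. g (antipode H x)"
  note S = antipode_linear
  have gS: "linear_on H H ?gS" and pg: "linear_on H H (\<lambda>x. p (g x))"
    by (rule linear_on_compose[OF S g] linear_on_compose[OF g p])+
  have g_eta: "g (smul H c \<one>) = smul H c \<one>" and p_eta: "p (smul H c \<one>) = smul H c \<one>" for c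
    using linear_on_smul[OF g one_closed, of c] linear_on_smul[OF p one_closed, of c] g_one p_one by simp_all
  note mem = linear_on_mem[OF S] linear_on_mem[OF g] linear_on_mem[OF p]
  have 1: "(g \<star> ?gS) x = smul H (counit H x) \<one>" if x: "x \<in> carrier H" for x
  proof -
    have "(g \<star> ?gS) x = sw2 H x (\<lambda>x1 x2. g (x1 \<cdot> antipode H x2))"
      unfolding conv_def by (rule sw2_cong) (simp add: g_mult mem)
    also have "\<dots> = g (sw2 H x (\<lambda>x1 x2. x1 \<cdot> antipode H x2))"
      by (rule linear_sw2[OF g vspace_axioms vspace_axioms x, symmetric]) (intro multilinear S mem)
    finally show ?thesis using x by (simp add: antipode_right g_eta)
  qed
  have 2: "(?gS \<star> (\<lambda>x. p (g x))) x = smul H (counit H x) \<one>" if x: "x \<in> carrier H" for x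
  proof -
    have "(?gS \<star> (\<lambda>x. p (g x))) x = sw2 H x (\<lambda>x1 x2. p (g (antipode H x1 \<cdot> x2)))"
      unfolding conv_def by (rule sw2_cong) (simp add: g_mult p_mult fix_S mem)
    also have "\<dots> = p (g (sw2 H x (\<lambda>x1 x2. antipode H x1 \<cdot> x2)))"
      by (rule linear_sw2[OF pg vspace_axioms vspace_axioms x, symmetric]) (intro multilinear S mem)
    finally show ?thesis using x by (simp add: antipode_left g_eta p_eta)
  qed
  have "p (g h) = (g \<star> (?gS \<star> (\<lambda>x. p (g x)))) h"
    by (rule conv_cancel_left[symmetric]) (use g gS pg h 1 in \<open>auto simp: conv_inverse_def\<close>)
  also have "\<dots> = (g \<star> (\<lambda>x. smul H (counit H x) \<one>)) h"
    by (rule conv_cong) (simp_all add: 2)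
  finally show ?thesis using conv_counit_right[OF g h] by simp
qed

end

section \<open>The antipode is bijective\<close>

context findim_hopf
begin

interpretation mul: convolution H "\<lambda>a b. a \<cdot> b"
  by unfold_locales (use mult_bilinear mult_assoc one_left one_right in auto)

interpretation opp: convolution H "\<lambda>a b. b \<cdot> a"
  by unfold_locales (use mult_bilinear mult_assoc one_left one_right in \<open>auto simp: bilinear_on_def\<close>)

abbreviation S :: "'a \<Rightarrow> 'a" where "S \<equiv> antipode H"

lemmas S_closed = linear_on_mem[OF antipode_linear]

lemma sw2_one:
  assumes "vspace U" and "bilinear_on H H U f"
  shows "sw2 H \<one> f = f \<one> \<one>"
  by (simp add: sw2_def comult_one sweedler_pure[OF assms one_closed one_closed])

text \<open>
  Multiplicativity of the coproduct, with the bilinear \<open>f\<close> extended to a linear map \<open>L\<close> on \<open>H \<otimes> H\<close>.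
\<close>

lemma sw2_mult:
  assumes U: "vspace U" and f: "bilinear_on H H U f" and a: "a \<in> carrier H" and b: "b \<in> carrier H"
  shows "sw2 H (a \<cdot> b) f = sw2 H a (\<lambda>a1 a2. sw2 H b (\<lambda>b1 b2. f (a1 \<cdot> b1) (a2 \<cdot> b2)))"
proof -
  define L where "L t = sweedler H H t f" for t
  have L: "linear_on (tensor_vs H H) U L"
    unfolding L_def by (rule linear_on_sweedler_tensor[OF vspace_axioms U f])
  have "sw2 H (a \<cdot> b) f = L (sw2 H a (\<lambda>a1 a2. sw2 H b (\<lambda>b1 b2. (a1 \<cdot> b1) \<otimes>[H,H] (a2 \<cdot> b2))))"
    by (simp add: L_def sw2_def[of H "a \<cdot> b"] comult_mult[OF a b])
  also have "\<dots> = sw2 H a (\<lambda>a1 a2. L (sw2 H b (\<lambda>b1 b2. (a1 \<cdot> b1) \<otimes>[H,H] (a2 \<cdot> b2))))"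
    using b by (intro linear_sw2[OF L vspace_tensor U a] multilinear)
  also have "\<dots> = sw2 H a (\<lambda>a1 a2. sw2 H b (\<lambda>b1 b2. L ((a1 \<cdot> b1) \<otimes>[H,H] (a2 \<cdot> b2))))"
    by (rule sw2_cong, rule linear_sw2[OF L vspace_tensor U b]) (intro multilinear)
  also have "\<dots> = sw2 H a (\<lambda>a1 a2. sw2 H b (\<lambda>b1 b2. f (a1 \<cdot> b1) (a2 \<cdot> b2)))"
    unfolding L_def by (intro sw2_cong sweedler_pure[OF U f] mult_closed)
  finally show ?thesis .
qed

lemma antipode_one: "S \<one> = \<one>"
proof -
  have "S \<one> \<cdot> \<one> = sw2 H \<one> (\<lambda>h1 h2. S h1 \<cdot> h2)"
    by (rule sw2_one[OF vspace_axioms, symmetric]) (intro multilinear antipode_linear S_closed)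
  then show ?thesis
    using antipode_left[OF one_closed] by (simp add: one_right S_closed one_closed counit_one)
qed

lemma conv_inverse_antipode: "mul.conv_inverse (\<lambda>x. x) S"
  by (simp add: mul.conv_inverse_def mul.conv_def linear_on_id antipode_linear antipode_right)

text \<open>
  Uniqueness of convolution inverses, used once in each variable.  Put \<open>G a b = S(a\<^sub>1 b) a\<^sub>2\<close>.  The axiom
  for \<open>S\<close> at \<open>a b\<close> says that \<open>G a\<close> convolved with the identity is \<open>\<epsilon>(a)\<close> times the unit, so
  \<open>G a b = \<epsilon>(a) S(b)\<close>.  This in turn says that \<open>x \<mapsto> S(x b)\<close> convolved with the identity is
  \<open>x \<mapsto> \<epsilon>(x) S(b)\<close>.
\<close>

lemma antipode_mult:
  assumes a: "a \<in> carrier H" and b: "b \<in> carrier H"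
  shows "S (a \<cdot> b) = S b \<cdot> S a"
proof -
  note S = antipode_linear
  have SS: "linear_on Z H f \<Longrightarrow> linear_on Z H (\<lambda>x. S (f x))" for Z :: "('f, 'a, 'm) hopf_scheme" and f
    by (rule linear_on_compose[OF _ S])
  define G where "G a b = sw2 H a (\<lambda>a1 a2. S (a1 \<cdot> b) \<cdot> a2)" for a b
  have G_linear: "linear_on H H (G a)" if "a \<in> carrier H" for a
    using that unfolding G_def by (intro multilinear SS S_closed)
  have smul_mult: "smul H c x \<cdot> y = smul H c (x \<cdot> y)" if "x \<in> carrier H" "y \<in> carrier H" for c x y
    using linear_on_smul[OF bilinear_on_left[OF mult_bilinear]] that by auto
  have G_id: "mul.conv (G a) (\<lambda>x. x) b = smul H (counit H a) (smul H (counit H b) \<one>)"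
    if a: "a \<in> carrier H" and b: "b \<in> carrier H" for a b
  proof -
    have "mul.conv (G a) (\<lambda>x. x) b = sw2 H b (\<lambda>b1 b2. sw2 H a (\<lambda>a1 a2. S (a1 \<cdot> b1) \<cdot> a2 \<cdot> b2))"
      unfolding mul.conv_def G_def
      by (rule sw2_cong, rule sw2_mult_right)
        (assumption | (intro multilinear SS S_closed a; assumption))+
    also have "\<dots> = sw2 H a (\<lambda>a1 a2. sw2 H b (\<lambda>b1 b2. S (a1 \<cdot> b1) \<cdot> a2 \<cdot> b2))"
      by (rule sw2_swap[OF vspace_axioms b a]) (intro multilinear SS S_closed; assumption)+
    also have "\<dots> = sw2 H a (\<lambda>a1 a2. sw2 H b (\<lambda>b1 b2. S (a1 \<cdot> b1) \<cdot> (a2 \<cdot> b2)))"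
      by (intro sw2_cong mult_assoc S_closed mult_closed)
    also have "\<dots> = sw2 H (a \<cdot> b) (\<lambda>x y. S x \<cdot> y)"
      by (rule sw2_mult[OF vspace_axioms _ a b, symmetric]) (intro multilinear SS S_closed)
    also have "\<dots> = smul H (counit H a) (smul H (counit H b) \<one>)"
      using a b by (simp add: antipode_left mult_closed counit_mult)
    finally show ?thesis .
  qed
  have G: "G a b = smul H (counit H a) (S b)" if a: "a \<in> carrier H" and b: "b \<in> carrier H" for a b
  proof -
    have "G a b = mul.conv (mul.conv (G a) (\<lambda>x. x)) S b"
      by (rule mul.conv_cancel_right[OF conv_inverse_antipode G_linear[OF a] b, symmetric])
    also have "\<dots> = mul.conv (\<lambda>x. smul H (counit H a) (smul H (counit H x) \<one>)) S b"
      by (intro mul.conv_cong G_id a refl)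
    also have "\<dots> = sw2 H b (\<lambda>b1 b2. smul H (counit H b1) (smul H (counit H a) (S b2)))"
      unfolding mul.conv_def
      by (rule sw2_cong) (simp add: smul_mult smul_closed one_closed S_closed one_left mult.commute)
    also have "\<dots> = smul H (counit H a) (S b)"
      by (rule sw2_counit_left[OF vspace_axioms _ b]) (intro multilinear S)
    finally show ?thesis .
  qed
  have lin: "linear_on H H (\<lambda>x. S (x \<cdot> b))"
    using b by (intro multilinear SS)
  have "S (a \<cdot> b) = mul.conv (mul.conv (\<lambda>x. S (x \<cdot> b)) (\<lambda>x. x)) S a"
    by (rule mul.conv_cancel_right[OF conv_inverse_antipode lin a, symmetric])
  also have "\<dots> = mul.conv (\<lambda>x. smul H (counit H x) (S b)) S a"
    by (intro mul.conv_cong refl) (simp add: mul.conv_def flip: G_def G[OF _ b])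
  also have "\<dots> = sw2 H a (\<lambda>a1 a2. smul H (counit H a1) (S b \<cdot> S a2))"
    unfolding mul.conv_def by (rule sw2_cong) (simp add: smul_mult S_closed b)
  also have "\<dots> = S b \<cdot> S a"
    by (rule sw2_counit_left[OF vspace_axioms _ a]) (intro multilinear S S_closed b)
  finally show ?thesis .
qed

lemma antipode_pow_closed: "x \<in> carrier H \<Longrightarrow> (S ^^ k) x \<in> carrier H"
  by (rule linear_on_mem[OF linear_on_funpow[OF antipode_linear]])

lemma antipode_pow_one: "(S ^^ k) \<one> = \<one>"
  by (induction k) (simp_all add: antipode_one)

lemma antipode_pow_mult:
  assumes "x \<in> carrier H" and "y \<in> carrier H"
  shows "(S ^^ k) (x \<cdot> y) =
    (if even k then (S ^^ k) x \<cdot> (S ^^ k) y else (S ^^ k) y \<cdot> (S ^^ k) x)"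
  using assms by (induction k) (auto simp: antipode_mult antipode_pow_closed)

text \<open>
  On the image \<open>I\<close> of \<open>N = S\<^sup>n\<close> the map \<open>N\<close> is a bijection, and \<open>p\<close> sends \<open>x\<close> to the element of \<open>I\<close> with
  the same value under \<open>N\<close>.  As \<open>n\<close> is even, \<open>N\<close> and therefore \<open>p\<close> are multiplicative.  The map \<open>p\<close>
  fixes all values of \<open>S\<^sup>n\<close>, and by descent all values of \<open>S\<^sup>0\<close>; so \<open>H = I\<close>.
\<close>

lemma antipode_bij: "bij_betw S (carrier H) (carrier H)"
proof -
  obtain n where n: "even n" "n > 0"
    and surj: "(S ^^ n) ` ((S ^^ n) ` carrier H) = (S ^^ n) ` carrier H"
    and kern: "\<And>x. x \<in> (S ^^ n) ` carrier H \<Longrightarrow> (S ^^ n) x = 0 \<Longrightarrow> x = 0"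
    using fitting[OF finite_dim antipode_linear] by blast
  define N where "N = S ^^ n"
  define I where "I = N ` carrier H"
  have N: "linear_on H H N" unfolding N_def by (rule linear_on_funpow[OF antipode_linear])
  note N_closed = linear_on_mem[OF N]
  have I: "I \<subseteq> carrier H" using N_closed by (auto simp: I_def)
  have N_mult: "N (x \<cdot> y) = N x \<cdot> N y" if "x \<in> carrier H" "y \<in> carrier H" for x y
    using antipode_pow_mult[OF that, of n] n(1) by (simp add: N_def)
  have N_one: "N \<one> = \<one>" by (simp add: N_def antipode_pow_one)
  have I_add: "x + y \<in> I" if "x \<in> I" "y \<in> I" for x y
    using that linear_on_add[OF N] add_closed unfolding I_def by (metis (no_types, lifting) image_iff)
  have I_smul: "smul H c x \<in> I" if "x \<in> I" for c x
    using that linear_on_smul[OF N] smul_closed unfolding I_def by (metis (no_types, lifting) image_iff)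
  have I_mult: "x \<cdot> y \<in> I" if "x \<in> I" "y \<in> I" for x y
    using that N_mult mult_closed unfolding I_def by (metis (no_types, lifting) image_iff)
  have I_one: "\<one> \<in> I" using N_one one_closed unfolding I_def by (metis image_eqI)
  have inj: "x = y" if "x \<in> I" "y \<in> I" "N x = N y" for x y
  proof -
    have "x - y \<in> I"
      using I_add[OF that(1) I_smul[OF that(2), of "- 1"]] by simp
    moreover have "N (x - y) = 0"
      using linear_on_diff[OF vspace_axioms N, of x y] subsetD[OF I that(1)] subsetD[OF I that(2)] that(3)
      by simp
    ultimately have "x - y = 0"
      unfolding I_def N_def by (rule kern)
    then show ?thesis by simp
  qed
  have "\<exists>e. e \<in> I \<and> N e = N x" if "x \<in> carrier H" for x
  proof -
    have "N x \<in> N ` I" using surj that by (simp add: I_def N_def)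
    then show ?thesis by auto
  qed
  then obtain p where p: "\<And>x. x \<in> carrier H \<Longrightarrow> p x \<in> I \<and> N (p x) = N x"
    by metis
  have pI: "p x \<in> I" and pH: "p x \<in> carrier H" and Np: "N (p x) = N x" if "x \<in> carrier H" for x
    using p[OF that] I by auto
  have p_eqI: "p x = e" if "x \<in> carrier H" "e \<in> I" "N e = N x" for x e
    by (rule inj) (use that pI Np in auto)
  have p_linear: "linear_on H H p"
  proof (rule linear_onI)
    fix x y assume xy: "x \<in> carrier H" "y \<in> carrier H"
    then show "p (x + y) = p x + p y"
      by (intro p_eqI) (simp_all add: add_closed I_add pI pH Np linear_on_add[OF N])
  next
    fix c x assume "x \<in> carrier H"
    then show "p (smul H c x) = smul H c (p x)"
      by (intro p_eqI) (simp_all add: smul_closed I_smul pI pH Np linear_on_smul[OF N])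
  qed (rule pH)
  have p_mult: "p (x \<cdot> y) = p x \<cdot> p y" if "x \<in> carrier H" "y \<in> carrier H" for x y
    using that by (intro p_eqI) (simp_all add: mult_closed I_mult pI pH Np N_mult)
  have p_one: "p \<one> = \<one>"
    by (rule p_eqI) (simp_all add: one_closed I_one)
  have fixed: "\<forall>x\<in>carrier H. p ((S ^^ k) x) = (S ^^ k) x" if "k \<le> n" for k
    using that
  proof (induction rule: inc_induct)
    case base
    show ?case
      using N_closed by (auto simp: I_def simp flip: N_def intro!: p_eqI)
  next
    case (step k)
    have g: "linear_on H H (S ^^ k)" by (rule linear_on_funpow[OF antipode_linear])
    have fix_S: "p ((S ^^ k) (S x)) = (S ^^ k) (S x)" if "x \<in> carrier H" for x
      using step.IH that by (simp add: funpow_swap1)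
    \<comment> \<open>\<open>S\<^sup>k\<close> preserves or reverses products according to the parity of \<open>k\<close>, and so lands in one of
      the two convolution algebras.\<close>
    show ?case
    proof (cases "even k")
      case True
      then show ?thesis
        using mul.fix_antipode_descent[OF g antipode_pow_one _ p_linear p_one p_mult fix_S]
        by (auto simp: antipode_pow_mult)
    next
      case False
      then show ?thesis
        using opp.fix_antipode_descent[OF g antipode_pow_one _ p_linear p_one p_mult fix_S]
        by (auto simp: antipode_pow_mult)
    qed
  qed
  then have "x \<in> I" if "x \<in> carrier H" for x
    using fixed[of 0] pI[OF that] that by simp
  then have I_eq: "I = carrier H" using I by blast
  obtain k where k: "n = Suc k" using n(2) gr0_implies_Suc by blast
  have N_eq: "N x = (S ^^ k) (S x)" for x
    unfolding N_def k funpow.simps(2) comp_apply by (rule funpow_swap1)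
  have "inj_on S (carrier H)"
  proof (rule inj_onI)
    fix x y assume xy: "x \<in> carrier H" "y \<in> carrier H" and "S x = S y"
    then have "N x = N y" by (simp only: N_eq)
    with xy show "x = y" using inj[of x y] I_eq by blast
  qed
  moreover have "S ` carrier H = carrier H"
  proof
    show "carrier H \<subseteq> S ` carrier H"
    proof
      fix x assume "x \<in> carrier H"
      then obtain y where "y \<in> carrier H" "x = N y" using I_eq by (auto simp: I_def)
      then show "x \<in> S ` carrier H"
        using antipode_pow_closed[of y k] by (simp add: N_def k)
    qed
  qed (use S_closed in blast)
  ultimately show ?thesis by (simp add: bij_betw_def)
qed

abbreviation S' :: "'a \<Rightarrow> 'a" where "S' \<equiv> antipode_inv H"

lemma S'_closed: "x \<in> carrier H \<Longrightarrow> S' x \<in> carrier H"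
  and S_S': "x \<in> carrier H \<Longrightarrow> S (S' x) = x"
  and S'_S: "x \<in> carrier H \<Longrightarrow> S' (S x) = x"
  using antipode_bij bij_betw_imp_surj_on[OF antipode_bij]
  by (auto simp: antipode_inv_def inv_into_into f_inv_into_f bij_betw_def)

lemma S'_linear: "linear_on H H S'"
proof (rule linear_onI)
  fix x y assume xy: "x \<in> carrier H" "y \<in> carrier H"
  have "S' (x + y) = S' (S (S' x) + S (S' y))" using xy by (simp add: S_S')
  also have "\<dots> = S' (S (S' x + S' y))" using xy by (simp add: linear_on_add[OF antipode_linear] S'_closed)
  finally show "S' (x + y) = S' x + S' y" using xy by (simp add: S'_S S'_closed add_closed)
next
  fix c x assume x: "x \<in> carrier H"
  have "S' (smul H c x) = S' (smul H c (S (S' x)))" using x by (simp add: S_S')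
  also have "\<dots> = S' (S (smul H c (S' x)))" using x by (simp add: linear_on_smul[OF antipode_linear] S'_closed)
  finally show "S' (smul H c x) = smul H c (S' x)" using x by (simp add: S'_S S'_closed smul_closed)
qed (rule S'_closed)

lemma S'_one: "S' \<one> = \<one>"
  using S'_S[OF one_closed] antipode_one by simp

text \<open>
  Apply the anti-multiplicative map \<open>S\<inverse>\<close> to the two axioms for the antipode.
\<close>

lemma conv_inverse_S': "opp.conv_inverse (\<lambda>x. x) S'" and conv_inverse_S'_id: "opp.conv_inverse S' (\<lambda>x. x)"
proof -
  have eta: "S' (smul H c \<one>) = smul H c \<one>" for c
    using linear_on_smul[OF S'_linear one_closed] S'_one by simp
  have 1: "sw2 H h (\<lambda>h1 h2. S' h2 \<cdot> h1) = smul H (counit H h) \<one>" if h: "h \<in> carrier H" for h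
  proof -
    have "S' (sw2 H h (\<lambda>h1 h2. S h1 \<cdot> h2)) = sw2 H h (\<lambda>h1 h2. S' (S h1 \<cdot> h2))"
      by (intro linear_sw2[OF S'_linear vspace_axioms vspace_axioms h] multilinear antipode_linear S_closed)
    also have "\<dots> = sw2 H h (\<lambda>h1 h2. S' h2 \<cdot> h1)"
    proof (rule sw2_cong)
      fix v w assume v: "v \<in> carrier H" and w: "w \<in> carrier H"
      have "S v \<cdot> w = S (S' w \<cdot> v)" using v w by (simp add: antipode_mult S'_closed S_S')
      then show "S' (S v \<cdot> w) = S' w \<cdot> v" using v w by (simp add: S'_S S'_closed mult_closed)
    qed
    finally show ?thesis using h by (simp add: antipode_left eta)
  qed
  have 2: "sw2 H h (\<lambda>h1 h2. h2 \<cdot> S' h1) = smul H (counit H h) \<one>" if h: "h \<in> carrier H" for h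
  proof -
    have "S' (sw2 H h (\<lambda>h1 h2. h1 \<cdot> S h2)) = sw2 H h (\<lambda>h1 h2. S' (h1 \<cdot> S h2))"
      by (intro linear_sw2[OF S'_linear vspace_axioms vspace_axioms h] multilinear antipode_linear S_closed)
    also have "\<dots> = sw2 H h (\<lambda>h1 h2. h2 \<cdot> S' h1)"
    proof (rule sw2_cong)
      fix v w assume v: "v \<in> carrier H" and w: "w \<in> carrier H"
      have "v \<cdot> S w = S (w \<cdot> S' v)" using v w by (simp add: antipode_mult S'_closed S_S')
      then show "S' (v \<cdot> S w) = w \<cdot> S' v" using v w by (simp add: S'_S S'_closed mult_closed)
    qed
    finally show ?thesis using h by (simp add: antipode_right eta)
  qed
  show "opp.conv_inverse (\<lambda>x. x) S'" "opp.conv_inverse S' (\<lambda>x. x)"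
    by (simp_all add: opp.conv_inverse_def opp.conv_def linear_on_id S'_linear 1 2)
qed

section \<open>The Heisenberg double acts on \<open>H\<close>\<close>

interpretation D: bialgebra_data "dual"
  by (rule bialgebra_data_dual)

lemmas all_multilinear = multilinear D.structure_linear

text \<open>Elements of \<open>H\<^sup>* \<otimes> H\<close> as linear endomorphisms of \<open>H\<close>.\<close>

definition contraction :: "('f, 'a \<Rightarrow> 'f, 'a) tensor \<Rightarrow> 'a \<Rightarrow> 'a" where
  "contraction t k = sweedler dual H t (\<lambda>\<alpha> h. smul H \<langle>\<alpha>, k\<rangle> h)"

lemma contraction_linear:
  assumes "t \<in> carrier (dspace H)"
  shows "linear_on H H (contraction t)"
  unfolding contraction_def using assms by (intro all_multilinear)

lemma linear_contraction:
  assumes "k \<in> carrier H"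
  shows "linear_on (dspace H) H (\<lambda>t. contraction t k)"
  unfolding contraction_def using assms by (intro all_multilinear)

lemma contraction_pure:
  assumes "\<alpha> \<in> carrier dual" and "h \<in> carrier H" and "k \<in> carrier H"
  shows "contraction (dtensor H \<alpha> h) k = smul H \<langle>\<alpha>, k\<rangle> h"
  unfolding contraction_def
  by (rule sweedler_pure[OF vspace_axioms _ assms(1,2)]) (intro all_multilinear assms(3))

text \<open>
  Together with \<open>contraction_surj\<close>, this identifies \<open>H\<^sup>* \<otimes> H\<close> with the linear endomorphisms of \<open>H\<close>.
\<close>

lemma contraction_expand:
  assumes C: "based_vspace H C" and t: "t \<in> carrier (dspace H)"
  shows "t = (\<Sum>c\<in>C. dtensor H (dual_basis H C c) (contraction t c))"
proof -
  interpret based_vspace H C by fact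
  interpret based_bialgebra_data H C by unfold_locales
  note contraction_mem = linear_on_mem[OF linear_contraction]
  show ?thesis
  proof (rule linear_on_tensor_eq[OF vspace_dual' linear_on_id _ _ t])
    show "linear_on (dspace H) (dspace H) (\<lambda>t. \<Sum>c\<in>C. dtensor H (coord c) (contraction t c))"
      by (intro all_multilinear linear_contraction basis_closed coord_closed)
    fix \<alpha> h assume \<alpha>: "\<alpha> \<in> carrier dual" and h: "h \<in> carrier H"
    have lin: "linear_on H (dspace H) (\<lambda>h. dtensor H (coord c) h)" if "c \<in> C" for c
      using that by (intro all_multilinear coord_closed)
    have "dtensor H \<alpha> h = (\<Sum>c\<in>C. fun_smul \<langle>\<alpha>, c\<rangle> (dtensor H (coord c) h))"
      by (rule dual_pure_expand[OF \<alpha> h])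
    also have "\<dots> = (\<Sum>c\<in>C. dtensor H (coord c) (contraction (dtensor H \<alpha> h) c))"
    proof (intro sum.cong refl)
      fix c assume c: "c \<in> C"
      show "fun_smul \<langle>\<alpha>, c\<rangle> (dtensor H (coord c) h) = dtensor H (coord c) (contraction (dtensor H \<alpha> h) c)"
        using linear_on_smul[OF lin[OF c] h] by (simp add: contraction_pure \<alpha> h basis_closed c)
    qed
    finally show "dtensor H \<alpha> h = (\<Sum>c\<in>C. dtensor H (coord c) (contraction (dtensor H \<alpha> h) c))" .
  qed
qed

lemma contraction_surj:
  assumes R: "linear_on H H R"
  shows "\<exists>t\<in>carrier (dspace H). \<forall>k\<in>carrier H. contraction t k = R k"
proof -
  obtain C where "based_vspace H C" using obtain_basis[OF finite_dim] .
  then interpret based_vspace H C .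
  interpret based_bialgebra_data H C by unfold_locales
  let ?t = "\<Sum>c\<in>C. dtensor H (coord c) (R c)"
  have Rc: "R c \<in> carrier H" if "c \<in> C" for c using linear_on_mem[OF R basis_closed[OF that]] .
  have mem: "dtensor H (coord c) (R c) \<in> carrier (dspace H)" if "c \<in> C" for c
    using that by (intro all_multilinear coord_closed Rc)
  have "contraction ?t k = R k" if k: "k \<in> carrier H" for k
  proof -
    have "contraction ?t k = (\<Sum>c\<in>C. contraction (dtensor H (coord c) (R c)) k)"
      by (rule linear_on_sum[OF vspace_tensor linear_contraction[OF k] mem])
    also have "\<dots> = (\<Sum>c\<in>C. smul H \<langle>coord c, k\<rangle> (R c))"
      using k by (intro sum.cong refl contraction_pure coord_closed Rc)
    also have "\<dots> = R k"
      using linear_expand[OF vspace_axioms R k] by (simp add: pairing_def)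
    finally show ?thesis .
  qed
  moreover have "?t \<in> carrier (dspace H)"
    by (rule vspace.sum_closed[OF vspace_tensor mem])
  ultimately show ?thesis by blast
qed

lemma contraction_inj:
  assumes "t \<in> carrier (dspace H)" and "\<And>k. k \<in> carrier H \<Longrightarrow> contraction t k = 0"
  shows "t = 0"
proof -
  obtain C where C: "based_vspace H C" using obtain_basis[OF finite_dim] .
  then interpret based_vspace H C .
  interpret based_bialgebra_data H C by unfold_locales
  have "dtensor H (coord c) 0 = 0" if "c \<in> C" for c
    by (rule linear_on_zero[OF vspace_axioms, of "dspace H"])
      (use that in \<open>intro all_multilinear coord_closed\<close>)
  then show ?thesis
    by (subst contraction_expand[OF C assms(1)]) (simp add: assms(2) basis_closed)
qed

lemma dual_one_closed: "\<one>\<^bsub>dual\<^esub> \<in> carrier dual"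
proof -
  have "restrict0 H (counit H) \<in> dual_carrier H"
    using linear_on_cong[OF vspace_axioms counit_linear, of "restrict0 H (counit H)"]
    by (simp add: dual_carrier_def restrict0_def)
  then show ?thesis by (simp add: dual_hopf_def dual_vs_def)
qed

lemma dual_one_pairing: "h \<in> carrier H \<Longrightarrow> \<langle>\<one>\<^bsub>dual\<^esub>, h\<rangle> = counit H h"
  by (simp add: dual_hopf_def restrict0_def pairing_def)

abbreviation heis :: "('f, ('f, 'a \<Rightarrow> 'f, 'a) tensor) alg" where
  "heis \<equiv> heisenberg_double_left H"

lemma heisenberg_simps [simp]:
  "carrier heis = carrier (dspace H)"
  "smul heis = fun_smul"
  "one heis = dtensor H \<one>\<^bsub>dual\<^esub> \<one>"
  by (simp_all add: heisenberg_double_left_def)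

lemma heisenberg_mult:
  "mult heis s t =
    sweedler dual H s (\<lambda>\<alpha> h. sweedler dual H t (\<lambda>\<alpha>' h'.
      sw2 dual \<alpha>' (\<lambda>\<alpha>'1 \<alpha>'2. sw2 H h (\<lambda>h1 h2.
        fun_smul \<langle>\<alpha>'2, h1\<rangle> (dtensor H (\<alpha> \<cdot>\<^bsub>dual\<^esub> \<alpha>'1) (h2 \<cdot> h'))))))"
  by (simp add: heisenberg_double_left_def pairing_def)

lemma heisenberg_bilinear:
  "bilinear_on (dspace H) (dspace H) (dspace H) (\<lambda>s t. mult heis s t)"
  unfolding heisenberg_mult by (intro all_multilinear)

lemma heisenberg_mult_pure:
  assumes "\<alpha> \<in> carrier dual" and "h \<in> carrier H" and "\<alpha>' \<in> carrier dual" and "h' \<in> carrier H"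
  shows "mult heis (dtensor H \<alpha> h) (dtensor H \<alpha>' h') =
    sw2 dual \<alpha>' (\<lambda>\<alpha>'1 \<alpha>'2. sw2 H h (\<lambda>h1 h2.
      fun_smul \<langle>\<alpha>'2, h1\<rangle> (dtensor H (\<alpha> \<cdot>\<^bsub>dual\<^esub> \<alpha>'1) (h2 \<cdot> h'))))"
proof -
  let ?M = "\<lambda>\<alpha> h \<alpha>' h'. sw2 dual \<alpha>' (\<lambda>\<alpha>'1 \<alpha>'2. sw2 H h (\<lambda>h1 h2.
      fun_smul \<langle>\<alpha>'2, h1\<rangle> (dtensor H (\<alpha> \<cdot>\<^bsub>dual\<^esub> \<alpha>'1) (h2 \<cdot> h'))))"
  have 1: "bilinear_on dual H (dspace H) (\<lambda>\<alpha> h. sweedler dual H (dtensor H \<alpha>' h') (?M \<alpha> h))"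
    using assms(3,4) by (intro all_multilinear)
  have 2: "bilinear_on dual H (dspace H) (?M \<alpha> h)"
    using assms(1,2) by (intro all_multilinear)
  show ?thesis
    unfolding heisenberg_mult sweedler_pure[OF vspace_tensor 1 assms(1,2)]
      sweedler_pure[OF vspace_tensor 2 assms(3,4)] ..
qed

text \<open>
  Moving the coproduct of \<open>\<alpha>'\<close> innermost turns its two legs, evaluated at \<open>k\<^sub>2\<close> and \<open>h\<^sub>1\<close>, into
  \<open>\<langle>\<alpha>', k\<^sub>2 h\<^sub>1\<rangle>\<close>.
\<close>

lemma contraction_heisenberg_pure:
  assumes "\<alpha> \<in> carrier dual" and "h \<in> carrier H" and "\<alpha>' \<in> carrier dual" and "h' \<in> carrier H"
    and k: "k \<in> carrier H"
  shows "contraction (mult heis (dtensor H \<alpha> h) (dtensor H \<alpha>' h')) k =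
    sw2 H h (\<lambda>h1 h2. sw2 H k (\<lambda>k1 k2. smul H (\<langle>\<alpha>, k1\<rangle> * \<langle>\<alpha>', k2 \<cdot> h1\<rangle>) (h2 \<cdot> h')))"
proof -
  let ?t = "\<lambda>\<alpha>'1 \<alpha>'2 h1 h2. fun_smul \<langle>\<alpha>'2, h1\<rangle> (dtensor H (\<alpha> \<cdot>\<^bsub>dual\<^esub> \<alpha>'1) (h2 \<cdot> h'))"
  let ?g = "\<lambda>\<alpha>'1 \<alpha>'2 h1 h2 k1 k2. smul H \<langle>\<alpha>'2, h1\<rangle> (smul H (\<langle>\<alpha>, k1\<rangle> * \<langle>\<alpha>'1, k2\<rangle>) (h2 \<cdot> h'))"
  note lin = linear_contraction[OF k]
  have "contraction (mult heis (dtensor H \<alpha> h) (dtensor H \<alpha>' h')) k =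
      sw2 dual \<alpha>' (\<lambda>\<alpha>'1 \<alpha>'2. contraction (sw2 H h (\<lambda>h1 h2. ?t \<alpha>'1 \<alpha>'2 h1 h2)) k)"
    unfolding heisenberg_mult_pure[OF assms(1-4)]
    by (rule D.linear_sw2[OF lin vspace_tensor vspace_axioms assms(3)])
      (assumption | (intro all_multilinear assms; assumption))+
  also have "\<dots> = sw2 dual \<alpha>' (\<lambda>\<alpha>'1 \<alpha>'2. sw2 H h (\<lambda>h1 h2. contraction (?t \<alpha>'1 \<alpha>'2 h1 h2) k))"
    by (rule D.sw2_cong, rule linear_sw2[OF lin vspace_tensor vspace_axioms assms(2)])
      (assumption | (intro all_multilinear assms; assumption))+
  also have "\<dots> = sw2 dual \<alpha>' (\<lambda>\<alpha>'1 \<alpha>'2. sw2 H h (\<lambda>h1 h2.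
        smul H \<langle>\<alpha>'2, h1\<rangle> (smul H (sw2 H k (\<lambda>k1 k2. \<langle>\<alpha>, k1\<rangle> * \<langle>\<alpha>'1, k2\<rangle>)) (h2 \<cdot> h'))))"
    using assms
    by (intro D.sw2_cong sw2_cong)
      (simp add: linear_on_smul[OF lin, unfolded smul_tensor_vs] pure_tensor_mem dual_mult_closed
        mult_closed contraction_pure dual_mult_apply)
  also have "\<dots> = sw2 dual \<alpha>' (\<lambda>\<alpha>'1 \<alpha>'2. sw2 H h (\<lambda>h1 h2. sw2 H k (\<lambda>k1 k2.
        ?g \<alpha>'1 \<alpha>'2 h1 h2 k1 k2)))"
    by (intro D.sw2_cong sw2_cong linear_sw2[OF _ vspace_field vspace_axioms k])
      (assumption | (intro all_multilinear assms; assumption))+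
  also have "\<dots> = sw2 H h (\<lambda>h1 h2. sw2 dual \<alpha>' (\<lambda>\<alpha>'1 \<alpha>'2. sw2 H k (\<lambda>k1 k2.
        ?g \<alpha>'1 \<alpha>'2 h1 h2 k1 k2)))"
    by (rule dual_sw2_swap[OF vspace_axioms assms(3,2)])
      (assumption | (intro all_multilinear assms; assumption))+
  also have "\<dots> = sw2 H h (\<lambda>h1 h2. sw2 H k (\<lambda>k1 k2. sw2 dual \<alpha>' (\<lambda>\<alpha>'1 \<alpha>'2.
        ?g \<alpha>'1 \<alpha>'2 h1 h2 k1 k2)))"
    by (rule sw2_cong, rule dual_sw2_swap[OF vspace_axioms assms(3) k])
      (assumption | (intro all_multilinear assms; assumption))+
  also have "\<dots> = sw2 H h (\<lambda>h1 h2. sw2 H k (\<lambda>k1 k2. smul H (\<langle>\<alpha>, k1\<rangle> * \<langle>\<alpha>', k2 \<cdot> h1\<rangle>) (h2 \<cdot> h')))"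
  proof (intro sw2_cong)
    fix h1 h2 k1 k2
    assume mem: "h1 \<in> carrier H" "h2 \<in> carrier H" "k1 \<in> carrier H" "k2 \<in> carrier H"
    let ?L = "\<lambda>c. smul H (\<langle>\<alpha>, k1\<rangle> * c) (h2 \<cdot> h')"
    have "sw2 dual \<alpha>' (\<lambda>\<alpha>'1 \<alpha>'2. ?g \<alpha>'1 \<alpha>'2 h1 h2 k1 k2) =
        sw2 dual \<alpha>' (\<lambda>\<alpha>'1 \<alpha>'2. ?L (\<langle>\<alpha>'1, k2\<rangle> * \<langle>\<alpha>'2, h1\<rangle>))"
      by (intro D.sw2_cong) (simp add: mult_ac)
    also have "\<dots> = ?L (sw2 dual \<alpha>' (\<lambda>\<alpha>'1 \<alpha>'2. \<langle>\<alpha>'1, k2\<rangle> * \<langle>\<alpha>'2, h1\<rangle>))"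
      by (rule D.linear_sw2[OF _ vspace_field vspace_axioms assms(3), symmetric])
        (assumption | (intro all_multilinear assms mem; assumption))+
    also have "\<dots> = ?L \<langle>\<alpha>', k2 \<cdot> h1\<rangle>"
      by (simp add: dual_sw2 assms(3) mem)
    finally show "sw2 dual \<alpha>' (\<lambda>\<alpha>'1 \<alpha>'2. ?g \<alpha>'1 \<alpha>'2 h1 h2 k1 k2) =
        ?L \<langle>\<alpha>', k2 \<cdot> h1\<rangle>" .
  qed
  finally show ?thesis .
qed

definition heisenberg_action :: "('f, 'a \<Rightarrow> 'f, 'a) tensor \<Rightarrow> 'a \<Rightarrow> 'a" where
  "heisenberg_action t k = sw2 H k (\<lambda>k1 k2. k2 \<cdot> contraction t k1)"

lemma heisenberg_action_conv: "heisenberg_action t = opp.conv (contraction t) (\<lambda>x. x)"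
  by (simp add: fun_eq_iff heisenberg_action_def opp.conv_def)

lemma heisenberg_action_linear:
  assumes "t \<in> carrier (dspace H)"
  shows "linear_on H H (heisenberg_action t)"
  unfolding heisenberg_action_conv by (intro opp.conv_linear contraction_linear assms linear_on_id)

lemma linear_heisenberg_action:
  assumes "k \<in> carrier H"
  shows "linear_on (dspace H) H (\<lambda>t. heisenberg_action t k)"
  unfolding heisenberg_action_def
  using assms
  by (intro multilinear linear_contraction linear_on_mem[OF linear_contraction]
      linear_on_mem[OF contraction_linear] contraction_linear)

lemma heisenberg_action_pure:
  assumes "\<alpha> \<in> carrier dual" and "h \<in> carrier H"
  shows "heisenberg_action (dtensor H \<alpha> h) k = sw2 H k (\<lambda>k1 k2. smul H \<langle>\<alpha>, k1\<rangle> (k2 \<cdot> h))"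
  unfolding heisenberg_action_def
  using assms by (intro sw2_cong) (simp add: contraction_pure linear_on_smul[OF bilinear_on_right[OF mult_bilinear]])

text \<open>
  Both sides are \<open>\<langle>\<alpha>, k\<^sub>1\<rangle> \<langle>\<alpha>', k\<^sub>2 h\<^sub>1\<rangle> k\<^sub>3 h\<^sub>2 h'\<close>: the left side by coassociativity, the right side by
  multiplicativity of the coproduct at \<open>k\<^sub>2 h\<close>.
\<close>

lemma heisenberg_action_mult_pure:
  assumes "\<alpha> \<in> carrier dual" and "h \<in> carrier H" and "\<alpha>' \<in> carrier dual" and "h' \<in> carrier H"
    and k: "k \<in> carrier H"
  shows "heisenberg_action (mult heis (dtensor H \<alpha> h) (dtensor H \<alpha>' h')) k =
    heisenberg_action (dtensor H \<alpha>' h') (heisenberg_action (dtensor H \<alpha> h) k)"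
proof -
  let ?act = "heisenberg_action (dtensor H \<alpha>' h')"
  let ?c = "\<lambda>k1 k2 h1. \<langle>\<alpha>, k1\<rangle> * \<langle>\<alpha>', k2 \<cdot> h1\<rangle>"
  have act: "linear_on H H ?act"
    using assms by (intro heisenberg_action_linear pure_tensor_mem)
  have "heisenberg_action (mult heis (dtensor H \<alpha> h) (dtensor H \<alpha>' h')) k =
      sw2 H k (\<lambda>x k3. k3 \<cdot> sw2 H h (\<lambda>h1 h2. sw2 H x (\<lambda>k1 k2. smul H (?c k1 k2 h1) (h2 \<cdot> h'))))"
    unfolding heisenberg_action_def
    by (rule sw2_cong) (simp add: contraction_heisenberg_pure assms)
  also have "\<dots> = sw2 H k (\<lambda>x k3. sw2 H h (\<lambda>h1 h2. k3 \<cdot> sw2 H x (\<lambda>k1 k2. smul H (?c k1 k2 h1) (h2 \<cdot> h'))))"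
    by (rule sw2_cong, rule sw2_mult_left[OF _ assms(2)])
      (assumption | (intro multilinear assms; assumption))+
  also have "\<dots> = sw2 H k (\<lambda>x k3. sw2 H h (\<lambda>h1 h2. sw2 H x (\<lambda>k1 k2. k3 \<cdot> smul H (?c k1 k2 h1) (h2 \<cdot> h'))))"
    by (intro sw2_cong, rule sw2_mult_left)
      (assumption | (intro multilinear assms; assumption))+
  also have "\<dots> = sw2 H k (\<lambda>x k3. sw2 H x (\<lambda>k1 k2. sw2 H h (\<lambda>h1 h2. k3 \<cdot> smul H (?c k1 k2 h1) (h2 \<cdot> h'))))"
    by (intro sw2_cong, rule sw2_swap[OF vspace_axioms assms(2)])
      (assumption | (intro multilinear assms; assumption))+
  also have "\<dots> = sw2 H k (\<lambda>k1 x. sw2 H x (\<lambda>k2 k3. sw2 H h (\<lambda>h1 h2. k3 \<cdot> smul H (?c k1 k2 h1) (h2 \<cdot> h'))))"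
    by (rule sw2_coassoc[OF vspace_axioms k])
      (assumption | (intro multilinear assms; assumption))+
  also have "\<dots> = sw2 H k (\<lambda>k1 x. ?act (smul H \<langle>\<alpha>, k1\<rangle> (x \<cdot> h)))"
  proof (rule sw2_cong)
    fix k1 x assume k1: "k1 \<in> carrier H" and x: "x \<in> carrier H"
    have "?act (smul H \<langle>\<alpha>, k1\<rangle> (x \<cdot> h)) = smul H \<langle>\<alpha>, k1\<rangle> (?act (x \<cdot> h))"
      by (rule linear_on_smul[OF act mult_closed[OF x assms(2)]])
    also have "\<dots> = smul H \<langle>\<alpha>, k1\<rangle> (sw2 H x (\<lambda>k2 k3. sw2 H h (\<lambda>h1 h2. smul H \<langle>\<alpha>', k2 \<cdot> h1\<rangle> (k3 \<cdot> h2 \<cdot> h'))))"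
      unfolding heisenberg_action_pure[OF assms(3,4)]
      by (subst sw2_mult[OF vspace_axioms _ x assms(2)])
        (assumption | (intro multilinear assms; assumption) | rule refl)+
    also have "\<dots> = sw2 H x (\<lambda>k2 k3. smul H \<langle>\<alpha>, k1\<rangle> (sw2 H h (\<lambda>h1 h2. smul H \<langle>\<alpha>', k2 \<cdot> h1\<rangle> (k3 \<cdot> h2 \<cdot> h'))))"
      by (rule linear_sw2[OF linear_on_scaleR[OF vspace_axioms linear_on_id] vspace_axioms vspace_axioms x])
        (assumption | (intro multilinear assms; assumption))+
    also have "\<dots> = sw2 H x (\<lambda>k2 k3. sw2 H h (\<lambda>h1 h2. smul H \<langle>\<alpha>, k1\<rangle> (smul H \<langle>\<alpha>', k2 \<cdot> h1\<rangle> (k3 \<cdot> h2 \<cdot> h'))))"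
      by (rule sw2_cong, rule linear_sw2[OF linear_on_scaleR[OF vspace_axioms linear_on_id] vspace_axioms vspace_axioms assms(2)])
        (assumption | (intro multilinear assms; assumption))+
    also have "\<dots> = sw2 H x (\<lambda>k2 k3. sw2 H h (\<lambda>h1 h2. k3 \<cdot> smul H (?c k1 k2 h1) (h2 \<cdot> h')))"
      by (intro sw2_cong) (simp add: assms mult_closed mult_assoc linear_on_smul[OF bilinear_on_right[OF mult_bilinear]])
    finally show "sw2 H x (\<lambda>k2 k3. sw2 H h (\<lambda>h1 h2. k3 \<cdot> smul H (?c k1 k2 h1) (h2 \<cdot> h'))) =
        ?act (smul H \<langle>\<alpha>, k1\<rangle> (x \<cdot> h))" by (rule sym)
  qed
  also have "\<dots> = ?act (heisenberg_action (dtensor H \<alpha> h) k)"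
    unfolding heisenberg_action_pure[OF assms(1,2), of k]
    by (rule linear_sw2[OF act vspace_axioms vspace_axioms k, symmetric])
      (assumption | (intro multilinear assms; assumption))+
  finally show ?thesis .
qed

lemma heisenberg_action_mult:
  assumes s: "s \<in> carrier (dspace H)" and t: "t \<in> carrier (dspace H)" and k: "k \<in> carrier H"
  shows "heisenberg_action (mult heis s t) k = heisenberg_action t (heisenberg_action s k)"
proof -
  note mem = linear_on_mem[OF linear_heisenberg_action]
  note bil = heisenberg_bilinear
  have "heisenberg_action (mult heis (dtensor H \<alpha> h) t) k =
      heisenberg_action t (heisenberg_action (dtensor H \<alpha> h) k)"
    if "\<alpha> \<in> carrier dual" "h \<in> carrier H" for \<alpha> h
    using t
    by (rule linear_on_tensor_eq[OF vspace_dual'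
          linear_on_compose[OF bilinear_on_right[OF bil] linear_heisenberg_action]
          linear_heisenberg_action, rotated -1])
      (intro pure_tensor_mem that k mem heisenberg_action_mult_pure; assumption)+
  then show ?thesis
    by (rule linear_on_tensor_eq[OF vspace_dual'
          linear_on_compose[OF bilinear_on_left[OF bil t] linear_heisenberg_action[OF k]]
          linear_on_compose[OF linear_heisenberg_action[OF k] heisenberg_action_linear[OF t]] _ s])
qed

theorem heisenberg_matrix_alg:
  assumes C: "based_vspace H C"
  shows "alg_isomorphic heis (matrix_alg C)"
proof -
  interpret based_vspace H C by fact
  note action_conv = heisenberg_action_conv
  show ?thesis
  proof (rule full_right_action_iso[where act = heisenberg_action])
    show "vspace heis"
      using vspace_tensor[of "dual" H] by (simp add: vspace_def)
    show "mult heis a b \<in> carrier heis"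
      if "a \<in> carrier heis" "b \<in> carrier heis" for a b
      using that bilinear_on_mem[OF heisenberg_bilinear] by simp
    show "one heis \<in> carrier heis"
      by (simp add: pure_tensor_mem dual_one_closed one_closed)
    show "linear_on heis H (\<lambda>a. heisenberg_action a v)" if "v \<in> carrier H" for v
      using linear_heisenberg_action[OF that] by (simp add: linear_on_def)
    show "heisenberg_action (one heis) v = v" if "v \<in> carrier H" for v
    proof -
      have "heisenberg_action (dtensor H \<one>\<^bsub>dual\<^esub> \<one>) v = sw2 H v (\<lambda>k1 k2. smul H (counit H k1) k2)"
        unfolding heisenberg_action_pure[OF dual_one_closed one_closed]
        by (rule sw2_cong) (simp add: dual_one_pairing one_right)
      then show ?thesis using that by (simp add: counit_left)
    qed
    show "t = 0" if t: "t \<in> carrier heis"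
      and zero: "\<And>v. v \<in> carrier H \<Longrightarrow> heisenberg_action t v = 0" for t
    proof (rule contraction_inj)
      fix k assume k: "k \<in> carrier H"
      have "contraction t k = opp.conv (heisenberg_action t) S' k"
        using t k unfolding action_conv
        by (intro opp.conv_cancel_right[OF conv_inverse_S', symmetric] contraction_linear) simp_all
      then show "contraction t k = 0"
        using opp.conv_zero(1)[OF S'_linear k zero] by simp
    qed (use t in simp)
    show "\<exists>t\<in>carrier heis. \<forall>v\<in>carrier H. heisenberg_action t v = T v"
      if T: "linear_on H H T" for T
    proof -
      obtain t where t: "t \<in> carrier (dspace H)"
        and eq: "\<And>k. k \<in> carrier H \<Longrightarrow> contraction t k = opp.conv T S' k"
        using contraction_surj[OF opp.conv_linear[OF T S'_linear]] by blast
      have "heisenberg_action t v = T v" if v: "v \<in> carrier H" for v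
      proof -
        have "heisenberg_action t v = opp.conv (opp.conv T S') (\<lambda>x. x) v"
          unfolding action_conv by (rule opp.conv_cong) (simp_all add: eq)
        then show ?thesis using opp.conv_cancel_right[OF conv_inverse_S'_id T v] by simp
      qed
      then show ?thesis using t by auto
    qed
  qed (simp_all add: heisenberg_action_linear heisenberg_action_mult)
qed

section \<open>The Drinfel'd double\<close>

abbreviation K :: "('f, ('f, 'a \<Rightarrow> 'f, 'a) tensor) hopf" where
  "K \<equiv> drinfeld_double H"

lemma linear_on_S': "linear_on Z H f \<Longrightarrow> linear_on Z H (\<lambda>z. S' (f z))"
  by (rule linear_on_compose[OF _ S'_linear])

lemmas double_multilinear = all_multilinear linear_on_S' S'_closed
  translate_closed linear_on_translate_left linear_on_translate_right linear_on_translate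

lemma sw3_one:
  assumes "vspace U" and "trilinear_on U f"
  shows "sw3 H \<one> f = f \<one> \<one> \<one>"
  unfolding sw3_def sw2_one[OF assms(1) bilinear_on_sw3[OF assms]]
  by (rule sw2_one[OF assms(1) bilinear_on_trilinear[OF assms(2) one_closed]])

lemma double_mult_pairing:
  "double_mult H s t =
     sweedler dual H s (\<lambda>\<alpha> h. sweedler dual H t (\<lambda>\<alpha>' h'.
       sw3 dual \<alpha>' (\<lambda>\<alpha>'1 \<alpha>'2 \<alpha>'3. sw3 H h (\<lambda>h1 h2 h3.
         fun_smul (\<langle>\<alpha>'3, h1\<rangle> * \<langle>\<alpha>'1, S' h3\<rangle>) (dtensor H (\<alpha> \<cdot>\<^bsub>dual\<^esub> \<alpha>'2) (h2 \<cdot> h'))))))"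
  by (simp add: double_mult_def pairing_def)

lemma double_mult_bilinear: "bilinear_on (dspace H) (dspace H) (dspace H) (\<lambda>s t. double_mult H s t)"
  unfolding double_mult_pairing sw3_def by (intro double_multilinear)

lemma double_mult_pure:
  assumes "\<alpha> \<in> carrier dual" and "h \<in> carrier H" and "\<alpha>' \<in> carrier dual" and "h' \<in> carrier H"
  shows "double_mult H (dtensor H \<alpha> h) (dtensor H \<alpha>' h') =
    sw3 H h (\<lambda>h1 h2 h3. dtensor H (\<alpha> \<cdot>\<^bsub>dual\<^esub> translate (S' h3) h1 \<alpha>') (h2 \<cdot> h'))"
proof -
  let ?F = "\<lambda>\<alpha> h' \<alpha>'1 \<alpha>'2 \<alpha>'3 h1 h2 h3.
      fun_smul (\<langle>\<alpha>'3, h1\<rangle> * \<langle>\<alpha>'1, S' h3\<rangle>) (dtensor H (\<alpha> \<cdot>\<^bsub>dual\<^esub> \<alpha>'2) (h2 \<cdot> h'))"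
  let ?M = "\<lambda>\<alpha> h \<alpha>' h'. sw3 dual \<alpha>' (\<lambda>\<alpha>'1 \<alpha>'2 \<alpha>'3. sw3 H h (?F \<alpha> h' \<alpha>'1 \<alpha>'2 \<alpha>'3))"
  have 1: "bilinear_on dual H (dspace H) (\<lambda>\<alpha> h. sweedler dual H (dtensor H \<alpha>' h') (?M \<alpha> h))"
    using assms(3,4) unfolding sw3_def by (intro double_multilinear)
  have 2: "bilinear_on dual H (dspace H) (?M \<alpha> h)"
    using assms(1,2) unfolding sw3_def by (intro double_multilinear)
  have "double_mult H (dtensor H \<alpha> h) (dtensor H \<alpha>' h') = ?M \<alpha> h \<alpha>' h'"
    unfolding double_mult_pairing sweedler_pure[OF vspace_tensor 1 assms(1,2)]
      sweedler_pure[OF vspace_tensor 2 assms(3,4)] ..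
  also have "\<dots> = sw3 H h (\<lambda>h1 h2 h3. sw3 dual \<alpha>' (\<lambda>\<alpha>'1 \<alpha>'2 \<alpha>'3. ?F \<alpha> h' \<alpha>'1 \<alpha>'2 \<alpha>'3 h1 h2 h3))"
    by (rule sw3_sw3_swap[OF D.bialgebra_data_axioms bialgebra_data_axioms vspace_tensor[of "dual" H] assms(3,2)])
      (assumption | (intro double_multilinear D.trilinear_onI trilinear_onI assms; assumption))+
  also have "\<dots> = sw3 H h (\<lambda>h1 h2 h3. dtensor H (\<alpha> \<cdot>\<^bsub>dual\<^esub> translate (S' h3) h1 \<alpha>') (h2 \<cdot> h'))"
  proof (rule sw3_cong)
    fix h1 h2 h3 assume mem: "h1 \<in> carrier H" "h2 \<in> carrier H" "h3 \<in> carrier H"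
    have lin: "linear_on dual (dspace H) (\<lambda>\<beta>. dtensor H (\<alpha> \<cdot>\<^bsub>dual\<^esub> \<beta>) (h2 \<cdot> h'))"
      by (intro double_multilinear assms mem)
    show "sw3 dual \<alpha>' (\<lambda>\<alpha>'1 \<alpha>'2 \<alpha>'3. ?F \<alpha> h' \<alpha>'1 \<alpha>'2 \<alpha>'3 h1 h2 h3) =
        dtensor H (\<alpha> \<cdot>\<^bsub>dual\<^esub> translate (S' h3) h1 \<alpha>') (h2 \<cdot> h')"
      using dual_sw3_translate[OF vspace_tensor lin assms(3) S'_closed[OF mem(3)] mem(1)] by simp
  qed
  finally show ?thesis .
qed

lemma drinfeld_simps [simp]:
  "carrier K = carrier (dspace H)" "smul K = fun_smul" "mult K = double_mult H"
  by (simp_all add: drinfeld_double_def)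

lemma tensor_K:
  "tensor_vs K K = tensor_vs (dspace H) (dspace H)"
  "sweedler K K = sweedler (dspace H) (dspace H)"
  "s \<otimes>[K,K] t = s \<otimes>[dspace H,dspace H] t"
  by (rule tensor_vs_cong sweedler_cong_vs pure_tensor_cong; simp)+

lemma linear_on_K: "linear_on K U f \<longleftrightarrow> linear_on (dspace H) U f"
  by (simp add: linear_on_def)

lemma bialgebra_data_K: "bialgebra_data K"
proof -
  have vs: "vspace K"
    using vspace_tensor[of "dual" H] by (simp add: vspace_def)
  have comult_K: "comult K = (\<lambda>t. sweedler dual H t (\<lambda>\<alpha> h.
      sw2 dual \<alpha> (\<lambda>\<alpha>1 \<alpha>2. sw2 H h (\<lambda>h1 h2.
        dtensor H \<alpha>2 h1 \<otimes>[dspace H, dspace H] dtensor H \<alpha>1 h2))))"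
    by (simp add: drinfeld_double_def)
  have "linear_on K (tensor_vs K K) (comult K)"
    unfolding tensor_K(1) comult_K by (intro linear_on_K[THEN iffD2] double_multilinear)
  moreover have "bilinear_on K K K (\<lambda>a b. mult K a b)"
    using double_mult_bilinear by (simp add: bilinear_on_def linear_on_def)
  moreover have "finite_dim K"
  proof -
    obtain C where C: "based_vspace H C" using obtain_basis[OF finite_dim] .
    then interpret based_vspace H C .
    interpret based_bialgebra_data H C by unfold_locales
    let ?g = "\<lambda>(c, d). dtensor H (coord c) d"
    show ?thesis
    proof (rule finite_dimI[OF vs, of "C \<times> C" ?g])
      show "\<exists>r. t = (\<Sum>i\<in>C \<times> C. smul K (r i) (?g i))" if t: "t \<in> carrier K" for t
      proof (intro exI)
        have lin: "linear_on H (dspace H) (\<lambda>h. dtensor H (coord c) h)" if "c \<in> C" for c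
          using that by (intro double_multilinear coord_closed)
        have "t = (\<Sum>c\<in>C. dtensor H (coord c) (contraction t c))"
          using contraction_expand[OF C] t by simp
        also have "\<dots> = (\<Sum>c\<in>C. \<Sum>d\<in>C. fun_smul (coord d (contraction t c)) (dtensor H (coord c) d))"
          using t linear_expand[OF vspace_tensor lin] linear_on_mem[OF contraction_linear]
          by (intro sum.cong refl) (simp add: basis_closed)
        also have "\<dots> = (\<Sum>i\<in>C \<times> C. smul K ((\<lambda>(c, d). coord d (contraction t c)) i) (?g i))"
          by (simp add: sum.cartesian_product case_prod_unfold)
        finally show "t = (\<Sum>i\<in>C \<times> C. smul K ((\<lambda>(c, d). coord d (contraction t c)) i) (?g i))" .
      qed
    qed (use finite_basis in \<open>auto intro: pure_tensor_mem coord_closed basis_closed\<close>)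
  qed
  ultimately show ?thesis
    using vs by (simp add: bialgebra_data_def bialgebra_data_axioms_def)
qed

interpretation K: bialgebra_data K
  by (rule bialgebra_data_K)

lemma sw2_K_pure:
  assumes "vspace U" and g: "bilinear_on K K U g"
    and \<alpha>: "\<alpha> \<in> carrier dual" and h: "h \<in> carrier H"
  shows "sw2 K (dtensor H \<alpha> h) g =
    sw2 dual \<alpha> (\<lambda>\<alpha>1 \<alpha>2. sw2 H h (\<lambda>h1 h2. g (dtensor H \<alpha>2 h1) (dtensor H \<alpha>1 h2)))"
proof -
  let ?T = "tensor_vs (dspace H) (dspace H)"
  let ?t = "\<lambda>\<alpha>1 \<alpha>2 h1 h2. dtensor H \<alpha>2 h1 \<otimes>[dspace H, dspace H] dtensor H \<alpha>1 h2"
  define L where "L t = sweedler K K t g" for t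
  have L: "linear_on ?T U L"
    unfolding L_def tensor_K(1)[symmetric] by (rule linear_on_sweedler_tensor[OF K.vspace_axioms assms(1,2)])
  have "bilinear_on dual H ?T (\<lambda>\<alpha> h. sw2 dual \<alpha> (\<lambda>\<alpha>1 \<alpha>2. sw2 H h (?t \<alpha>1 \<alpha>2)))"
    by (intro double_multilinear)
  from sweedler_pure[OF vspace_tensor this \<alpha> h]
  have "comult K (dtensor H \<alpha> h) = sw2 dual \<alpha> (\<lambda>\<alpha>1 \<alpha>2. sw2 H h (?t \<alpha>1 \<alpha>2))"
    by (simp add: drinfeld_double_def)
  then have "sw2 K (dtensor H \<alpha> h) g = L (sw2 dual \<alpha> (\<lambda>\<alpha>1 \<alpha>2. sw2 H h (?t \<alpha>1 \<alpha>2)))"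
    by (simp add: sw2_def[of K] L_def)
  also have "\<dots> = sw2 dual \<alpha> (\<lambda>\<alpha>1 \<alpha>2. L (sw2 H h (?t \<alpha>1 \<alpha>2)))"
    by (rule D.linear_sw2[OF L vspace_tensor assms(1) \<alpha>])
      (assumption | (intro double_multilinear h; assumption))+
  also have "\<dots> = sw2 dual \<alpha> (\<lambda>\<alpha>1 \<alpha>2. sw2 H h (\<lambda>h1 h2. L (?t \<alpha>1 \<alpha>2 h1 h2)))"
    by (rule D.sw2_cong, rule linear_sw2[OF L vspace_tensor assms(1) h])
      (assumption | (intro double_multilinear h; assumption))+
  also have "\<dots> = sw2 dual \<alpha> (\<lambda>\<alpha>1 \<alpha>2. sw2 H h (\<lambda>h1 h2. g (dtensor H \<alpha>2 h1) (dtensor H \<alpha>1 h2)))"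
  proof (intro D.sw2_cong sw2_cong)
    fix \<alpha>1 \<alpha>2 h1 h2
    assume "\<alpha>1 \<in> carrier dual" "\<alpha>2 \<in> carrier dual" "h1 \<in> carrier H" "h2 \<in> carrier H"
    then show "L (?t \<alpha>1 \<alpha>2 h1 h2) = g (dtensor H \<alpha>2 h1) (dtensor H \<alpha>1 h2)"
      unfolding L_def tensor_K(3)[symmetric]
      by (intro sweedler_pure[OF assms(1,2)]) (simp_all add: pure_tensor_mem)
  qed
  finally show ?thesis .
qed

lemma dual_mult_one_left:
  assumes "\<alpha> \<in> carrier dual"
  shows "\<one>\<^bsub>dual\<^esub> \<cdot>\<^bsub>dual\<^esub> \<alpha> = \<alpha>"
proof (rule dual_eqI)
  fix h assume h: "h \<in> carrier H"
  have "\<langle>\<one>\<^bsub>dual\<^esub> \<cdot>\<^bsub>dual\<^esub> \<alpha>, h\<rangle> = sw2 H h (\<lambda>h1 h2. smul field_vs (counit H h1) \<langle>\<alpha>, h2\<rangle>)"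
    unfolding dual_mult_apply[OF h] by (rule sw2_cong) (simp add: dual_one_pairing)
  also have "\<dots> = \<langle>\<alpha>, h\<rangle>"
    by (rule sw2_counit_left[OF vspace_field dual_linear[OF assms] h])
  finally show "\<langle>\<one>\<^bsub>dual\<^esub> \<cdot>\<^bsub>dual\<^esub> \<alpha>, h\<rangle> = \<langle>\<alpha>, h\<rangle>" .
qed (intro dual_mult_closed dual_one_closed assms)+

lemma translate_one:
  assumes "\<alpha> \<in> carrier dual"
  shows "translate \<one> \<one> \<alpha> = \<alpha>"
  by (rule dual_eqI[where X=H])
    (simp_all add: translate_closed one_closed assms translate_pairing one_left one_right)

text \<open>
  The elements \<open>1 \<otimes> x\<close> and \<open>\<alpha> \<otimes> 1\<close> are the factors of the \<open>R\<close>-matrix; multiplication by them from the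
  left is all that the twisted product uses.
\<close>

lemma double_mult_form_pure:
  assumes "\<alpha> \<in> carrier dual" and "\<alpha>' \<in> carrier dual" and "h' \<in> carrier H"
  shows "double_mult H (dtensor H \<alpha> \<one>) (dtensor H \<alpha>' h') = dtensor H (\<alpha> \<cdot>\<^bsub>dual\<^esub> \<alpha>') h'"
proof -
  have tri: "trilinear_on (dspace H) (\<lambda>h1 h2 h3. dtensor H (\<alpha> \<cdot>\<^bsub>dual\<^esub> translate (S' h3) h1 \<alpha>') (h2 \<cdot> h'))"
    by (rule trilinear_onI) (intro double_multilinear assms; assumption)+
  show ?thesis
    unfolding double_mult_pure[OF assms(1) one_closed assms(2,3)] sw3_one[OF vspace_tensor tri]
      S'_one translate_one[OF assms(2)] one_left[OF assms(3)] ..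
qed

lemma double_mult_element_pure:
  assumes "h \<in> carrier H" and "\<alpha>' \<in> carrier dual" and "h' \<in> carrier H"
  shows "double_mult H (dtensor H \<one>\<^bsub>dual\<^esub> h) (dtensor H \<alpha>' h') =
    sw3 H h (\<lambda>h1 h2 h3. dtensor H (translate (S' h3) h1 \<alpha>') (h2 \<cdot> h'))"
  unfolding double_mult_pure[OF dual_one_closed assms]
  by (rule sw3_cong) (simp add: dual_mult_one_left translate_closed S'_closed assms)

section \<open>The twisted dual acts on \<open>H\<close>\<close>

abbreviation K_dual :: "(('f, 'a \<Rightarrow> 'f, 'a) tensor \<Rightarrow> 'f) set" where
  "K_dual \<equiv> carrier (dual_hopf K)"

lemma pure_K: "\<alpha> \<in> carrier dual \<Longrightarrow> h \<in> carrier H \<Longrightarrow> dtensor H \<alpha> h \<in> carrier K"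
  by (simp add: pure_tensor_mem)

lemma functional_on_dspace: "u \<in> K_dual \<Longrightarrow> linear_on (dspace H) field_vs (\<lambda>t. \<langle>u, t\<rangle>)"
  by (rule linear_on_K[THEN iffD1, OF dual_linear])

lemma linear_on_functional:
  "linear_on Z (dspace H) f \<Longrightarrow> u \<in> K_dual \<Longrightarrow> linear_on Z field_vs (\<lambda>z. \<langle>u, f z\<rangle>)"
  by (rule linear_on_compose[OF _ functional_on_dspace])

lemma functional_eq_zero:
  assumes u: "u \<in> K_dual"
    and zero: "\<And>\<alpha> h. \<alpha> \<in> carrier dual \<Longrightarrow> h \<in> carrier H \<Longrightarrow> \<langle>u, dtensor H \<alpha> h\<rangle> = 0"
  shows "u = 0"
proof (rule dual_eqI[OF u vspace.zero_closed[OF K.vspace_dual']])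
  fix t assume t: "t \<in> carrier K"
  have "linear_on (dspace H) field_vs (\<lambda>t. \<langle>0, t\<rangle>)"
    by (rule functional_on_dspace[OF vspace.zero_closed[OF K.vspace_dual']])
  then show "\<langle>u, t\<rangle> = \<langle>0, t\<rangle>"
    by (rule linear_on_tensor_eq[OF vspace_dual' functional_on_dspace[OF u]])
      (use t zero in \<open>simp_all add: pairing_def\<close>)
qed

end

locale findim_hopf_basis = findim_hopf H + based_vspace H C
  for H :: "('f::field, 'a::ab_group_add, 'm) hopf_scheme" (structure) and C
begin

interpretation opp: convolution H "\<lambda>a b. b \<cdot> a"
  by unfold_locales (use mult_bilinear mult_assoc one_left one_right in \<open>auto simp: bilinear_on_def\<close>)

interpretation D: bialgebra_data "dual"
  by (rule bialgebra_data_dual)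

interpretation K: bialgebra_data K
  by (rule bialgebra_data_K)

interpretation based_bialgebra_data H C
  by unfold_locales

text \<open>
  The endomorphism \<open>U\<close> of \<open>H\<close> with \<open>\<langle>\<alpha>, U h\<rangle> = \<langle>u, \<alpha> \<otimes> h\<rangle>\<close> for all \<open>\<alpha>\<close>, written in coordinates; see
  \<open>pairing_endo\<close>.
\<close>

definition endo :: "(('f, 'a \<Rightarrow> 'f, 'a) tensor \<Rightarrow> 'f) \<Rightarrow> 'a \<Rightarrow> 'a" where
  "endo u h = (\<Sum>c\<in>C. smul H \<langle>u, dtensor H (coord c) h\<rangle> c)"

lemma endo_linear:
  assumes "u \<in> K_dual"
  shows "linear_on H H (endo u)"
  unfolding endo_def
  by (intro double_multilinear linear_on_functional assms coord_closed basis_closed)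

lemma linear_endo:
  assumes "h \<in> carrier H"
  shows "linear_on (dual_hopf K) H (\<lambda>u. endo u h)"
  unfolding endo_def
  by (intro double_multilinear K.structure_linear pure_K assms coord_closed basis_closed)

lemma endo_closed: "u \<in> K_dual \<Longrightarrow> h \<in> carrier H \<Longrightarrow> endo u h \<in> carrier H"
  by (rule linear_on_mem[OF endo_linear])

lemma pairing_endo:
  assumes u: "u \<in> K_dual" and \<alpha>: "\<alpha> \<in> carrier dual" and h: "h \<in> carrier H"
  shows "\<langle>\<alpha>, endo u h\<rangle> = \<langle>u, dtensor H \<alpha> h\<rangle>"
proof -
  have lin: "linear_on dual field_vs (\<lambda>\<alpha>. \<langle>u, dtensor H \<alpha> h\<rangle>)"
    using h by (intro double_multilinear linear_on_functional u)
  have "\<langle>\<alpha>, endo u h\<rangle> = (\<Sum>c\<in>C. \<langle>u, dtensor H (coord c) h\<rangle> * \<langle>\<alpha>, c\<rangle>)"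
    unfolding endo_def using linear_on_lincomb[OF vspace_axioms dual_linear[OF \<alpha>], of C "\<lambda>c. c"]
    by (simp add: basis_closed)
  also have "\<dots> = \<langle>u, dtensor H (\<Sum>c\<in>C. fun_smul \<langle>\<alpha>, c\<rangle> (coord c)) h\<rangle>"
    using linear_on_lincomb[OF vspace_dual' lin, of C coord] by (simp add: coord_closed mult.commute)
  also have "\<dots> = \<langle>u, dtensor H \<alpha> h\<rangle>"
    using dual_expand[OF \<alpha>] by simp
  finally show ?thesis .
qed

lemma dual_separates:
  assumes "x \<in> carrier H" and "y \<in> carrier H"
    and "\<And>\<alpha>. \<alpha> \<in> carrier dual \<Longrightarrow> \<langle>\<alpha>, x\<rangle> = \<langle>\<alpha>, y\<rangle>"
  shows "x = y"
proof -
  have "coord c x = coord c y" if "c \<in> C" for c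
    using assms(3)[OF coord_closed[OF that]] by (simp add: pairing_def)
  then show ?thesis
    using expand[OF assms(1)] expand[OF assms(2)] by simp
qed

lemma endo_inj:
  assumes u: "u \<in> K_dual" and zero: "\<And>h. h \<in> carrier H \<Longrightarrow> endo u h = 0"
  shows "u = 0"
proof (rule functional_eq_zero[OF u])
  fix \<alpha> h assume \<alpha>: "\<alpha> \<in> carrier dual" and h: "h \<in> carrier H"
  show "\<langle>u, dtensor H \<alpha> h\<rangle> = 0"
    using pairing_endo[OF u \<alpha> h] zero[OF h] linear_on_zero[OF vspace_axioms dual_linear[OF \<alpha>]] by simp
qed

lemma endo_surj:
  assumes T: "linear_on H H T"
  shows "\<exists>u\<in>K_dual. \<forall>h\<in>carrier H. endo u h = T h"
proof
  let ?u = "restrict0 K (\<lambda>t. sweedler dual H t (\<lambda>\<alpha> h. \<langle>\<alpha>, T h\<rangle>))"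
  have bil: "bilinear_on dual H field_vs (\<lambda>\<alpha> h. \<langle>\<alpha>, T h\<rangle>)"
    by (intro double_multilinear T linear_on_mem[OF T])
  have "linear_on K field_vs (\<lambda>t. sweedler dual H t (\<lambda>\<alpha> h. \<langle>\<alpha>, T h\<rangle>))"
    by (rule linear_on_K[THEN iffD2, OF linear_on_sweedler_tensor[OF vspace_dual' vspace_field bil]])
  then have "linear_on K field_vs ?u"
    by (rule linear_on_cong[OF K.vspace_axioms]) (simp add: restrict0_def)
  then show u: "?u \<in> K_dual"
    by (simp add: carrier_dual_hopf dual_carrier_def restrict0_def)
  show "\<forall>h\<in>carrier H. endo ?u h = T h"
  proof
    fix h assume h: "h \<in> carrier H"
    have "\<langle>?u, dtensor H \<alpha> h\<rangle> = \<langle>\<alpha>, T h\<rangle>" if "\<alpha> \<in> carrier dual" for \<alpha>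
      using sweedler_pure[OF vspace_field bil that h] pure_K[OF that h]
      by (simp add: restrict0_def pairing_def[of "\<lambda>x. _ x"])
    then show "endo ?u h = T h"
      by (intro dual_separates endo_closed[OF u h] linear_on_mem[OF T h]) (simp add: pairing_endo[OF u _ h])
  qed
qed

abbreviation twisted :: "('f, ('f, 'a \<Rightarrow> 'f, 'a) tensor \<Rightarrow> 'f) alg" where
  "twisted \<equiv> twisted_dual K (R_matrix H C)"

lemma R_matrix_terms:
  "R_matrix H C = (\<Sum>c\<in>C. dtensor H \<one>\<^bsub>dual\<^esub> c \<otimes>[K,K] dtensor H (coord c) \<one>)"
  "c \<in> C \<Longrightarrow> dtensor H \<one>\<^bsub>dual\<^esub> c \<in> carrier K"
  "c \<in> C \<Longrightarrow> dtensor H (coord c) \<one> \<in> carrier K"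
  by (simp_all only: R_matrix_def pure_K dual_one_closed basis_closed coord_closed one_closed)

lemma pairing_element_mult:
  assumes v: "v \<in> K_dual" and b: "b \<in> carrier H"
    and \<alpha>: "\<alpha> \<in> carrier dual" and h: "h \<in> carrier H"
  shows "\<langle>v, double_mult H (dtensor H \<one>\<^bsub>dual\<^esub> b) (dtensor H \<alpha> h)\<rangle> =
    \<langle>\<alpha>, sw3 H b (\<lambda>b1 b2 b3. S' b3 \<cdot> endo v (b2 \<cdot> h) \<cdot> b1)\<rangle>"
proof -
  note rules = double_multilinear v \<alpha> h b trilinear_onI linear_on_compose[OF _ endo_linear[OF v]] endo_closed
  have "\<langle>v, double_mult H (dtensor H \<one>\<^bsub>dual\<^esub> b) (dtensor H \<alpha> h)\<rangle> =
      sw3 H b (\<lambda>b1 b2 b3. \<langle>v, dtensor H (translate (S' b3) b1 \<alpha>) (b2 \<cdot> h)\<rangle>)"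
    unfolding double_mult_element_pure[OF b \<alpha> h]
    by (rule linear_sw3[OF functional_on_dspace[OF v] vspace_tensor vspace_field b])
      (assumption | (intro rules; assumption))+
  also have "\<dots> = sw3 H b (\<lambda>b1 b2 b3. \<langle>\<alpha>, S' b3 \<cdot> endo v (b2 \<cdot> h) \<cdot> b1\<rangle>)"
  proof (rule sw3_cong)
    fix b1 b2 b3 assume "b1 \<in> carrier H" "b2 \<in> carrier H" "b3 \<in> carrier H"
    then show "\<langle>v, dtensor H (translate (S' b3) b1 \<alpha>) (b2 \<cdot> h)\<rangle> = \<langle>\<alpha>, S' b3 \<cdot> endo v (b2 \<cdot> h) \<cdot> b1\<rangle>"
      by (simp add: pairing_endo[symmetric] translate_pairing translate_closed endo_closed mult_closed S'_closed v \<alpha> h)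
  qed
  also have "\<dots> = \<langle>\<alpha>, sw3 H b (\<lambda>b1 b2 b3. S' b3 \<cdot> endo v (b2 \<cdot> h) \<cdot> b1)\<rangle>"
    by (rule linear_sw3[OF dual_linear[OF \<alpha>] vspace_axioms vspace_field b, symmetric])
      (assumption | (intro rules; assumption))+
  finally show ?thesis .
qed

lemma pairing_form_mult:
  assumes u: "u \<in> K_dual" and \<beta>: "\<beta> \<in> carrier dual"
    and \<alpha>: "\<alpha> \<in> carrier dual" and h: "h \<in> carrier H"
  shows "\<langle>u, double_mult H (dtensor H \<beta> \<one>) (dtensor H \<alpha> h)\<rangle> =
    \<langle>\<alpha>, sw2 H (endo u h) (\<lambda>z1 z2. smul H \<langle>\<beta>, z1\<rangle> z2)\<rangle>"
proof -
  have z: "endo u h \<in> carrier H" by (rule endo_closed[OF u h])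
  have "\<langle>u, double_mult H (dtensor H \<beta> \<one>) (dtensor H \<alpha> h)\<rangle> = sw2 H (endo u h) (\<lambda>z1 z2. \<langle>\<beta>, z1\<rangle> * \<langle>\<alpha>, z2\<rangle>)"
    by (simp add: double_mult_form_pure \<alpha> \<beta> h pairing_endo[OF u, symmetric] dual_mult_closed dual_mult_apply z)
  also have "\<dots> = sw2 H (endo u h) (\<lambda>z1 z2. \<langle>\<alpha>, smul H \<langle>\<beta>, z1\<rangle> z2\<rangle>)"
    by (rule sw2_cong) (simp add: linear_on_smul[OF dual_linear[OF \<alpha>], simplified])
  also have "\<dots> = \<langle>\<alpha>, sw2 H (endo u h) (\<lambda>z1 z2. smul H \<langle>\<beta>, z1\<rangle> z2)\<rangle>"
    by (rule linear_sw2[OF dual_linear[OF \<alpha>] vspace_axioms vspace_field z, symmetric])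
      (intro double_multilinear \<beta>)
  finally show ?thesis .
qed

text \<open>
  Evaluate \<open>u \<cdot>' v\<close> at \<open>\<alpha> \<otimes> h\<close>.  For a basis vector \<open>c\<close>, the two factors of \<open>R\<close> contribute
  \<open>\<langle>\<alpha>\<^sub>2, P c h\<^sub>1\<rangle>\<close> with \<open>P c h\<^sub>1 = S\<inverse>(c\<^sub>3) V(c\<^sub>2 h\<^sub>1) c\<^sub>1\<close> and \<open>\<langle>\<alpha>\<^sub>1, Q c h\<^sub>2\<rangle>\<close> with \<open>Q c h\<^sub>2 = \<langle>c\<^sup>*, z\<^sub>1\<rangle> z\<^sub>2\<close>, where
  \<open>z = U(h\<^sub>2)\<close>.  Summing over \<open>c\<close> replaces \<open>c\<close> by \<open>z\<^sub>1\<close> and gives \<open>z\<^sub>2 P(z\<^sub>1, h\<^sub>1)\<close>.  With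
  \<open>W h\<^sub>1 k = V(k\<^sub>2 h\<^sub>1) k\<^sub>1\<close>, the map \<open>P\<close> is the convolution of \<open>W h\<^sub>1\<close> with \<open>S\<inverse>\<close>, so convolving once more
  with the identity leaves \<open>W h\<^sub>1 z\<close>.
\<close>

lemma endo_twisted_mult:
  assumes u: "u \<in> K_dual" and v: "v \<in> K_dual" and h: "h \<in> carrier H"
  shows "endo (mult twisted u v) h =
    sw2 H h (\<lambda>h1 h2. sw2 H (endo u h2) (\<lambda>z1 z2. endo v (z2 \<cdot> h1) \<cdot> z1))"
proof -
  let ?g = "\<lambda>c k1 k2. \<langle>v, double_mult H (dtensor H \<one>\<^bsub>dual\<^esub> c) k1\<rangle> *
    \<langle>u, double_mult H (dtensor H (coord c) \<one>) k2\<rangle>"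
  define P where "P b h1 = sw3 H b (\<lambda>b1 b2 b3. S' b3 \<cdot> endo v (b2 \<cdot> h1) \<cdot> b1)" for b h1
  define Q where "Q c h2 = sw2 H (endo u h2) (\<lambda>z1 z2. smul H \<langle>coord c, z1\<rangle> z2)" for c h2
  define W where "W h1 k = sw2 H k (\<lambda>k1 k2. endo v (k2 \<cdot> h1) \<cdot> k1)" for h1 k
  note endo_rules = linear_on_compose[OF _ endo_linear[OF u]] linear_on_compose[OF _ endo_linear[OF v]]
    endo_closed[OF u] endo_closed[OF v]
  have W_linear: "linear_on H H (W h1)" if "h1 \<in> carrier H" for h1
    using that unfolding W_def by (intro double_multilinear endo_rules)
  have P_linear1: "linear_on H H (\<lambda>b. P b h1)" if "h1 \<in> carrier H" for h1
    using that unfolding P_def sw3_def by (intro double_multilinear endo_rules)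
  have P_linear2: "linear_on H H (P b)" if "b \<in> carrier H" for b
    using that unfolding P_def sw3_def by (intro double_multilinear endo_rules)
  have Q_linear: "linear_on H H (Q c)" if "c \<in> C" for c
    unfolding Q_def by (intro double_multilinear endo_rules coord_closed that)
  note PQ_rules = P_linear2 Q_linear linear_on_compose[OF _ P_linear2] linear_on_compose[OF _ Q_linear]
    linear_on_mem[OF P_linear2] linear_on_mem[OF Q_linear]
  have P_conv: "P b h1 = opp.conv (W h1) S' b" if b: "b \<in> carrier H" and h1: "h1 \<in> carrier H" for b h1
  proof -
    have "P b h1 = sw3 H b (\<lambda>b1 b2 b3. S' b3 \<cdot> (endo v (b2 \<cdot> h1) \<cdot> b1))"
      unfolding P_def using h1 by (intro sw3_cong mult_assoc endo_closed[OF v] S'_closed mult_closed)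
    also have "\<dots> = opp.conv (W h1) S' b"
      unfolding sw3_def opp.conv_def W_def
      by (rule sw2_cong, rule sw2_mult_left[symmetric])
        (assumption | (intro double_multilinear endo_rules h1; assumption))+
    finally show ?thesis .
  qed
  have summand: "sw2 K (dtensor H \<alpha> h) (?g c) =
      \<langle>\<alpha>, sw2 H h (\<lambda>h1 h2. Q c h2 \<cdot> P c h1)\<rangle>"
    if \<alpha>: "\<alpha> \<in> carrier dual" and c: "c \<in> C" for \<alpha> c
  proof -
    have cH: "c \<in> carrier H" by (rule basis_closed[OF c])
    have bil: "bilinear_on K K field_vs (?g c)"
      using K.linear_on_multR[unfolded drinfeld_simps] R_matrix_terms(2,3)[OF c]
      by (intro bilinear_onI linear_on_timesL linear_on_timesR K.linear_on_pairing_arg u v)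
        (auto intro: linear_on_id)
    have "sw2 K (dtensor H \<alpha> h) (?g c) =
      sw2 dual \<alpha> (\<lambda>\<alpha>1 \<alpha>2. sw2 H h (\<lambda>h1 h2. \<langle>\<alpha>2, P c h1\<rangle> * \<langle>\<alpha>1, Q c h2\<rangle>))"
      unfolding sw2_K_pure[OF vspace_field bil \<alpha> h] P_def Q_def
      by (intro D.sw2_cong sw2_cong)
        (simp add: pairing_element_mult[OF v cH] pairing_form_mult[OF u coord_closed[OF c]])
    also have "\<dots> = sw2 H h (\<lambda>h1 h2. sw2 dual \<alpha> (\<lambda>\<alpha>1 \<alpha>2. \<langle>\<alpha>2, P c h1\<rangle> * \<langle>\<alpha>1, Q c h2\<rangle>))"
      by (rule dual_sw2_swap[OF vspace_field \<alpha> h])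
        (assumption | (intro double_multilinear PQ_rules c cH; assumption))+
    also have "\<dots> = sw2 H h (\<lambda>h1 h2. \<langle>\<alpha>, Q c h2 \<cdot> P c h1\<rangle>)"
      by (rule sw2_cong)
        (subst mult.commute, rule dual_sw2[OF \<alpha> linear_on_mem[OF Q_linear[OF c]] linear_on_mem[OF P_linear2[OF cH]]])
    also have "\<dots> = \<langle>\<alpha>, sw2 H h (\<lambda>h1 h2. Q c h2 \<cdot> P c h1)\<rangle>"
      by (rule linear_sw2[OF dual_linear[OF \<alpha>] vspace_axioms vspace_field h, symmetric])
        (assumption | (intro double_multilinear PQ_rules c cH; assumption))+
    finally show ?thesis .
  qed
  have sum_QP: "(\<Sum>c\<in>C. Q c h2 \<cdot> P c h1) = W h1 (endo u h2)" if h1: "h1 \<in> carrier H" and h2: "h2 \<in> carrier H" for h1 h2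
  proof -
    have z: "endo u h2 \<in> carrier H" by (rule endo_closed[OF u h2])
    have PH: "P c h1 \<in> carrier H" if "c \<in> C" for c
      by (rule linear_on_mem[OF P_linear2[OF basis_closed[OF that]] h1])
    have "(\<Sum>c\<in>C. Q c h2 \<cdot> P c h1) =
        (\<Sum>c\<in>C. sw2 H (endo u h2) (\<lambda>z1 z2. smul H \<langle>coord c, z1\<rangle> z2 \<cdot> P c h1))"
      unfolding Q_def
      by (intro sum.cong refl sw2_mult_right[OF _ z])
        (assumption | (intro double_multilinear PH coord_closed; assumption))+
    also have "\<dots> = sw2 H (endo u h2) (\<lambda>z1 z2. \<Sum>c\<in>C. smul H \<langle>coord c, z1\<rangle> z2 \<cdot> P c h1)"
      by (rule sw2_sum[OF vspace_axioms z, symmetric])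
        (assumption | (intro double_multilinear PH coord_closed; assumption))+
    also have "\<dots> = sw2 H (endo u h2) (\<lambda>z1 z2. z2 \<cdot> P z1 h1)"
    proof (rule sw2_cong)
      fix z1 z2 assume z1: "z1 \<in> carrier H" and z2: "z2 \<in> carrier H"
      have "linear_on H H (\<lambda>b. z2 \<cdot> P b h1)"
        by (rule linear_on_multR[OF P_linear1[OF h1] z2])
      from linear_expand[OF vspace_axioms this z1]
      show "(\<Sum>c\<in>C. smul H \<langle>coord c, z1\<rangle> z2 \<cdot> P c h1) = z2 \<cdot> P z1 h1"
        by (simp add: pairing_def linear_on_smul[OF bilinear_on_left[OF mult_bilinear]] PH z2)
    qed
    also have "\<dots> = opp.conv (opp.conv (W h1) S') (\<lambda>x. x) (endo u h2)"
      unfolding opp.conv_def[of "opp.conv (W h1) S'"]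
      by (rule sw2_cong) (simp add: P_conv h1)
    also have "\<dots> = W h1 (endo u h2)"
      by (rule opp.conv_cancel_right[OF conv_inverse_S'_id W_linear[OF h1] z])
    finally show ?thesis .
  qed
  have QP_bilinear: "bilinear_on H H H (\<lambda>h1 h2. Q c h2 \<cdot> P c h1)" if c: "c \<in> C" for c
    by (intro double_multilinear PQ_rules c basis_closed[OF c])
  have mem: "mult twisted u v \<in> K_dual"
    by (rule K.twisted_mult_closed[OF R_matrix_terms(2,3,1) v u])
  have "\<langle>\<alpha>, endo (mult twisted u v) h\<rangle> = \<langle>\<alpha>, sw2 H h (\<lambda>h1 h2. W h1 (endo u h2))\<rangle>"
    if \<alpha>: "\<alpha> \<in> carrier dual" for \<alpha>
  proof -
    have "\<langle>\<alpha>, endo (mult twisted u v) h\<rangle> = \<langle>mult twisted u v, dtensor H \<alpha> h\<rangle>"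
      by (rule pairing_endo[OF mem \<alpha> h])
    also have "\<dots> = (\<Sum>c\<in>C. \<langle>\<alpha>, sw2 H h (\<lambda>h1 h2. Q c h2 \<cdot> P c h1)\<rangle>)"
      using K.twisted_mult_pairing[OF R_matrix_terms(2,3,1) v u pure_K[OF \<alpha> h]] summand[OF \<alpha>]
      by simp
    also have "\<dots> = \<langle>\<alpha>, \<Sum>c\<in>C. sw2 H h (\<lambda>h1 h2. Q c h2 \<cdot> P c h1)\<rangle>"
      by (rule linear_on_sum[OF vspace_axioms dual_linear[OF \<alpha>], symmetric])
        (rule sw2_closed[OF vspace_axioms h QP_bilinear])
    also have "(\<Sum>c\<in>C. sw2 H h (\<lambda>h1 h2. Q c h2 \<cdot> P c h1)) = sw2 H h (\<lambda>h1 h2. \<Sum>c\<in>C. Q c h2 \<cdot> P c h1)"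
      by (rule sw2_sum[OF vspace_axioms h QP_bilinear, symmetric])
    also have "\<dots> = sw2 H h (\<lambda>h1 h2. W h1 (endo u h2))"
      by (rule sw2_cong) (rule sum_QP)
    finally show ?thesis .
  qed
  moreover have "sw2 H h (\<lambda>h1 h2. W h1 (endo u h2)) \<in> carrier H"
    unfolding W_def by (intro double_multilinear endo_rules h)
  ultimately have "endo (mult twisted u v) h = sw2 H h (\<lambda>h1 h2. W h1 (endo u h2))"
    by (intro dual_separates endo_closed[OF mem h])
  then show ?thesis by (simp only: W_def)
qed

definition twisted_action :: "(('f, 'a \<Rightarrow> 'f, 'a) tensor \<Rightarrow> 'f) \<Rightarrow> 'a \<Rightarrow> 'a" where
  "twisted_action u h = sw2 H h (\<lambda>h1 h2. endo u h2 \<cdot> h1)"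

lemma twisted_action_conv: "twisted_action u = opp.conv (\<lambda>x. x) (endo u)"
  by (simp add: fun_eq_iff twisted_action_def opp.conv_def)

lemma twisted_action_linear:
  assumes "u \<in> K_dual"
  shows "linear_on H H (twisted_action u)"
  unfolding twisted_action_conv by (intro opp.conv_linear endo_linear assms linear_on_id)

lemma linear_twisted_action:
  assumes "h \<in> carrier H"
  shows "linear_on (dual_hopf K) H (\<lambda>u. twisted_action u h)"
  unfolding twisted_action_def
  using assms by (intro multilinear K.vspace_dual' linear_endo endo_closed endo_linear)

lemma twisted_mult_closed:
  assumes "u \<in> K_dual" and "v \<in> K_dual"
  shows "mult twisted u v \<in> K_dual"
  by (rule K.twisted_mult_closed[OF R_matrix_terms(2,3,1) assms(2,1)])

text \<open>
  Writing out the left side with \<open>endo_twisted_mult\<close> and the right side with multiplicativity of the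
  coproduct at \<open>U(h\<^sub>3) k\<close> gives the two bracketings of \<open>V(z\<^sub>2 h\<^sub>2) z\<^sub>1 h\<^sub>1\<close> with \<open>z = U(h\<^sub>3)\<close>.
\<close>

lemma twisted_action_mult:
  assumes u: "u \<in> K_dual" and v: "v \<in> K_dual" and h: "h \<in> carrier H"
  shows "twisted_action (mult twisted u v) h = twisted_action v (twisted_action u h)"
proof -
  note endo_rules = linear_on_compose[OF _ endo_linear[OF u]] linear_on_compose[OF _ endo_linear[OF v]]
    endo_closed[OF u] endo_closed[OF v]
  note rules = multilinear endo_rules
  let ?F = "\<lambda>h1 h2 h3. sw2 H (endo u h3) (\<lambda>z1 z2. endo v (z2 \<cdot> h2) \<cdot> z1 \<cdot> h1)"
  have "twisted_action (mult twisted u v) h =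
      sw2 H h (\<lambda>h1 k. sw2 H k (\<lambda>h2 h3. sw2 H (endo u h3) (\<lambda>z1 z2. endo v (z2 \<cdot> h2) \<cdot> z1)) \<cdot> h1)"
    unfolding twisted_action_def by (rule sw2_cong) (simp add: endo_twisted_mult[OF u v])
  also have "\<dots> = sw2 H h (\<lambda>h1 k. sw2 H k (\<lambda>h2 h3. sw2 H (endo u h3) (\<lambda>z1 z2. endo v (z2 \<cdot> h2) \<cdot> z1) \<cdot> h1))"
    by (rule sw2_cong, rule sw2_mult_right)
      (assumption | (intro rules; assumption))+
  also have "\<dots> = sw2 H h (\<lambda>h1 k. sw2 H k (?F h1))"
    by (intro sw2_cong sw2_mult_right)
      (assumption | (intro rules; assumption))+
  also have "\<dots> = sw2 H h (\<lambda>k h3. sw2 H k (\<lambda>h1 h2. ?F h1 h2 h3))"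
    by (rule sw2_coassoc[OF vspace_axioms h, symmetric]) (assumption | (intro rules; assumption))+
  also have "\<dots> = sw2 H h (\<lambda>k h3. twisted_action v (endo u h3 \<cdot> k))"
  proof (rule sw2_cong)
    fix k h3 assume k: "k \<in> carrier H" and h3: "h3 \<in> carrier H"
    have z: "endo u h3 \<in> carrier H" by (rule endo_closed[OF u h3])
    have "twisted_action v (endo u h3 \<cdot> k) =
        sw2 H (endo u h3) (\<lambda>z1 z2. sw2 H k (\<lambda>h1 h2. endo v (z2 \<cdot> h2) \<cdot> (z1 \<cdot> h1)))"
      unfolding twisted_action_def by (rule sw2_mult[OF vspace_axioms _ z k]) (intro rules)
    also have "\<dots> = sw2 H (endo u h3) (\<lambda>z1 z2. sw2 H k (\<lambda>h1 h2. endo v (z2 \<cdot> h2) \<cdot> z1 \<cdot> h1))"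
      by (intro sw2_cong mult_assoc[symmetric] endo_closed[OF v] mult_closed)
    also have "\<dots> = sw2 H k (\<lambda>h1 h2. ?F h1 h2 h3)"
      by (rule sw2_swap[OF vspace_axioms z k]) (assumption | (intro rules; assumption))+
    finally show "sw2 H k (\<lambda>h1 h2. ?F h1 h2 h3) = twisted_action v (endo u h3 \<cdot> k)" by (rule sym)
  qed
  also have "\<dots> = twisted_action v (twisted_action u h)"
    unfolding twisted_action_def[of u]
    by (rule linear_sw2[OF twisted_action_linear[OF v] vspace_axioms vspace_axioms h, symmetric]) (intro rules)
  finally show ?thesis .
qed

lemma twisted_one:
  shows "one twisted \<in> K_dual"
    and "\<alpha> \<in> carrier dual \<Longrightarrow> h \<in> carrier H \<Longrightarrow>
      \<langle>one twisted, dtensor H \<alpha> h\<rangle> = counit H h * \<langle>\<alpha>, \<one>\<rangle>"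
proof -
  have bil: "bilinear_on dual H field_vs (\<lambda>\<alpha> h. \<langle>\<alpha>, \<one>\<rangle> * counit H h)"
    by (intro multilinear counit_linear one_closed)
  have counit_K: "counit K = (\<lambda>t. sweedler dual H t (\<lambda>\<alpha> h. \<langle>\<alpha>, \<one>\<rangle> * counit H h))"
    by (simp add: drinfeld_double_def dual_hopf_def[of H] pairing_def)
  have one: "one twisted = restrict0 K (counit K)"
    by (simp add: dual_hopf_def)
  have "linear_on K field_vs (counit K)"
    unfolding counit_K
    by (rule linear_on_K[THEN iffD2, OF linear_on_sweedler_tensor[OF vspace_dual' vspace_field bil]])
  then have "linear_on K field_vs (restrict0 K (counit K))"
    by (rule linear_on_cong[OF K.vspace_axioms]) (simp add: restrict0_def)
  then show "one twisted \<in> K_dual"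
    unfolding one by (simp add: carrier_dual_hopf dual_carrier_def restrict0_def)
  show "\<langle>one twisted, dtensor H \<alpha> h\<rangle> = counit H h * \<langle>\<alpha>, \<one>\<rangle>"
    if "\<alpha> \<in> carrier dual" "h \<in> carrier H"
    using sweedler_pure[OF vspace_field bil that] pure_K[OF that]
    unfolding one pairing_def[of "restrict0 K (counit K)"] by (simp add: restrict0_def counit_K)
qed

lemma endo_one:
  assumes h: "h \<in> carrier H"
  shows "endo (one twisted) h = smul H (counit H h) \<one>"
  by (rule dual_separates)
    (use h in \<open>simp_all only: endo_closed twisted_one pairing_endo smul_closed one_closed
      linear_on_smul[OF dual_linear] smul_field\<close>)

theorem twisted_matrix_alg: "alg_isomorphic twisted (matrix_alg C)"
proof (rule full_right_action_iso[where act = twisted_action])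
  show "vspace twisted"
    using K.vspace_dual' by (simp add: vspace_def)
  show "linear_on twisted H (\<lambda>u. twisted_action u h)" if "h \<in> carrier H" for h
    using linear_twisted_action[OF that] by (simp add: linear_on_def)
  show "twisted_action (one twisted) h = h" if h: "h \<in> carrier H" for h
  proof -
    have "twisted_action (one twisted) h = opp.conv (\<lambda>x. x) (\<lambda>x. smul H (counit H x) \<one>) h"
      unfolding twisted_action_conv by (rule opp.conv_cong) (simp_all only: endo_one)
    then show ?thesis using opp.conv_counit_right[OF linear_on_id h] by simp
  qed
  show "u = 0" if u: "u \<in> carrier twisted" and zero: "\<And>h. h \<in> carrier H \<Longrightarrow> twisted_action u h = 0" for u
  proof (rule endo_inj)
    fix h assume h: "h \<in> carrier H"
    have "endo u h = opp.conv S' (twisted_action u) h"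
      using u h unfolding twisted_action_conv
      by (intro opp.conv_cancel_left[OF conv_inverse_S'_id, symmetric] endo_linear) simp_all
    then show "endo u h = 0"
      using opp.conv_zero(2)[OF S'_linear h zero] by simp
  qed (use u in simp)
  show "\<exists>u\<in>carrier twisted. \<forall>h\<in>carrier H. twisted_action u h = T h" if T: "linear_on H H T" for T
  proof -
    obtain u where u: "u \<in> K_dual"
      and eq: "\<And>h. h \<in> carrier H \<Longrightarrow> endo u h = opp.conv S' T h"
      using endo_surj[OF opp.conv_linear[OF S'_linear T]] by blast
    have "twisted_action u h = T h" if h: "h \<in> carrier H" for h
    proof -
      have "twisted_action u h = opp.conv (\<lambda>x. x) (opp.conv S' T) h"
        unfolding twisted_action_conv by (rule opp.conv_cong) (simp_all add: eq)
      then show ?thesis using opp.conv_cancel_left[OF conv_inverse_S' T h] by simp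
    qed
    then show ?thesis using u by auto
  qed
qed (simp_all only: K.twisted_dual_simps twisted_action_linear twisted_action_mult twisted_mult_closed
    twisted_one(1)[unfolded K.twisted_dual_simps])

end

section \<open>Transposition\<close>

theorem proposition3p24:
  fixes H :: "('f::field_char_0, 'a::ab_group_add) hopf" and B :: "'a set"
  assumes "hopf_algebra H" and "finite_dim H" and "basis_of H B"
  shows "alg_isomorphic
           (twisted_dual (drinfeld_double H) (R_matrix H B))
           (op_alg (heisenberg_double_left H))"
proof -
  interpret hopf_algebra H by fact
  interpret findim_hopf H by unfold_locales fact
  have "finite B"
  proof -
    obtain S where S: "finite S" "amb.span S = carrier H"
      using assms(2) by (auto simp: finite_dim_def)
    have "amb.independent B" "B \<subseteq> amb.span S"
      using assms(3) S(2) amb.span_superset[of B] by (auto simp: basis_of_def)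
    then show ?thesis using amb.independent_span_bound[OF S(1)] by blast
  qed
  then interpret findim_hopf_basis H B
    by unfold_locales (simp_all add: assms)
  have "alg_isomorphic (matrix_alg B) (op_alg (heisenberg_double_left H))"
    by (rule alg_isomorphic_trans[OF matrix_alg_op[OF finite_basis]
          alg_isomorphic_op[OF alg_isomorphic_sym[OF heisenberg_matrix_alg[OF based_vspace_axioms]]]])
  then show ?thesis
    by (rule alg_isomorphic_trans[OF twisted_matrix_alg])
qed

end
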